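(* Let $(\mathcal X,\Gamma)$ be a topological local diffusion space, and let $\mu$ be a probability measure on $(\Upsilon,\Sigma_{\mathrm v})$ which is conditionally absolutely continuous and satisfies the conditional closability assumption. Then the form $$\mathcal E^{\Upsilon,\mu}(u,v)=\int_\Upsilon\Gamma^\Upsilon(u,v)\,d\mu,\qquad u,v\in\mathrm{Cyl}_\mu(\mathcal D),$$ is well-defined (on $\mu$-classes), densely defined, and closable, and its closure $(\mathcal E^{\Upsilon,\mu},\mathscr D(\mathcal E^{\Upsilon,\mu}))$ is a Dirichlet form on $L^2(\mu)$.
   Context: A topological local structure $\mathcal X=(X,\tau,\Sigma,\mathsf m,\mathscr E)$ consists of a non-empty completely regular Hausdorff Luzin space $(X,\tau)$ (a continuous bijective image of a Polish space), a $\sigma$-algebra $\Sigma$ with $\mathscr B_\tau\subset\Sigma\subset\mathscr B_\tau^{\mathsf m}$ (Borel $\sigma$-algebra and its $\mathsf m$-completion) that contains all singletons and is, up to $\mathsf m$-null sets, countably generated, a $\sigma$-finite atomless Radon measure $\mathsf m$ on $\Sigma$ with full $\tau$-support, and a localizing ring $\mathscr E$: a family $\mathscr E\subset\{A\in\Sigma:\mathsf mA<\infty\}$ closed under finite unions and intersections, with $A\cap E\in\mathscr E$ for $A\in\Sigma$, $E\in\mathscr E$, such that $\mathscr E=\bigcup_h\{A\cap E_h:A\in\Sigma\}$ for some sequence $E_h\uparrow X$ in $\Sigma$ with $\mathsf mE_h<\infty$ (a localizing sequence), and such that every $x\in X$ has a $\tau$-neighbourhood in $\mathscr E$. $\mathcal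 C_0(\mathscr E)$ (resp. $\Sigma_b(\mathscr E)$) is the space of bounded $\tau$-continuous (resp. bounded $\Sigma$-measurable) real functions vanishing outside some $E\in\mathscr E$. $\mathcal C_b^\infty(\mathbb R^k)$ is the space of bounded smooth functions with bounded derivatives of all orders. A topological local diffusion space $(\mathcal X,\Gamma)$ is a topological local structure with a square field operator $(\Gamma,\mathcal D)$: $\mathcal D\subset\mathcal C_0(\mathscr E)$ is an algebra generating $\tau$ (functions identified with their $\mathsf m$-classes) with $\varphi\circ\mathbf f-\varphi(0)\in\mathcal D$ for $\mathbf f\in\mathcal D^k$, $\varphi\in\mathcal C_b^\infty(\mathbb R^k)$; $\Gamma:\mathcal D\times\mathcal D\to L^\infty(\mathsf m)$ is symmetric, bilinear, non-negative definite, takes values in $\mathsf m$-classes of functions in $\Sigma_b(\mathscr E)$, and satisfies $\Gamma(\varphi\circ\mathbf f-\varphi(0),\psi\circ\mathbf g-\psi(0))=\sum_{i,j}(\partial_i\varphi)(\mathbf f)(\partial_j\psi)(\mathbf g)\Gamma(f_i,g_j)$ $\mathsf m$-a.e.; the form $\mathcal E^{X,\mathsf m}(f,g)=\int\Gamma(f,g)\,d\mathsf m$ on $\mathcal D$ is closable and densely defined in $L^2(\mathsf m)$, and its closure is a quasi-regular Dirichlet form. A strong lifting $\ell:L^\infty(\mathsf m)\to\mathcal L^\infty(\mathsf m)$ (bounded $\Sigma$-measurable functions) is a linear, multiplicative, order preserving map with $\ell(1)=1$, $[\ell(f)]_{\mathsf m}=f$, $\ell(\varphi)=\varphi$ for $\varphi\in\mathcal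 C_b(X)$; such maps exist, and one is fixed. $\Upsilon$ is the set of all $\gamma=\sum_{i\le N}\delta_{x_i}$, $N\in\mathbb N_0\cup\{\infty\}$, $x_i\in X$ (repetitions allowed), with $\gamma E<\infty$ for all $E\in\mathscr E$; $\Sigma_{\mathrm v}$ is the $\sigma$-algebra generated by $\gamma\mapsto\gamma E$, $E\in\mathscr E$. Put $f^\star\gamma=\int f\,d\gamma$. $\mathrm{Cyl}(\mathcal D)$ is the space of functions $u=F(f_1^\star,\dots,f_k^\star)$, $F\in\mathcal C_b^\infty(\mathbb R^k)$, $f_i\in\mathcal D$, and $\mathrm{Cyl}_\mu(\mathcal D)$ the space of their $\mu$-classes. For $u=F(f_1^\star,\dots,f_k^\star)$, $v=G(g_1^\star,\dots,g_m^\star)$, $\Gamma^\Upsilon(u,v)(\gamma)=\sum_{i,j}\partial_iF(f_1^\star\gamma,\dots,f_k^\star\gamma)\,\partial_jG(g_1^\star\gamma,\dots,g_m^\star\gamma)\int\ell(\Gamma(f_i,g_j))\,d\gamma$. For $A\in\Sigma$ let $\gamma_A$ be the restriction of $\gamma$ to $A$. For $E\in\mathscr E$ let $\Upsilon(E)$ be the space of finite configurations on $E$, and let $\pi_{\mathsf m_E}$ be the Poisson measure on $\Upsilon(E)$ with intensity $\mathsf m|_E$. For $\eta\in\Upsilon$, $\mu^{\eta_{E^c}}$ is the regular conditional probability of $\mu$ given $\gamma_{E^c}=\eta_{E^c}$ (strongly consistent with $\gamma\mapsto\gamma_{E^c}$), and the projected conditional probability $\mu^\eta_E$ is the image of $\mu^{\eta_{E^c}}$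 under $\gamma\mapsto\gamma_E\in\Upsilon(E)$. $\mu$ is conditionally absolutely continuous if there is a localizing sequence $(E_h)_h$ such that, for $\mu$-a.e. $\eta$, $\mu^\eta_{E_h}\ll\pi_{\mathsf m_{E_h}}$ for all $h$. $\mu$ satisfies the conditional closability assumption if $\int\gamma E\,d\mu(\gamma)<\infty$ for all $E\in\mathscr E$, $\mu$ is conditionally absolutely continuous for some localizing sequence $(E_h)_h$, and, for every $h$ and $\mu$-a.e. $\eta\in\Upsilon$, the form $(u,v)\mapsto\int_{\Upsilon(E_h)}\Gamma^{\Upsilon(E_h)}(u,v)\,d\mu^\eta_{E_h}$, defined on $\mu^\eta_{E_h}$-classes of cylinder functions ($\Gamma^{\Upsilon(E_h)}$ and cylinder functions on $\Upsilon(E_h)$ being given by the same formulas with $\gamma\in\Upsilon(E_h)$), is closable on $L^2(\Upsilon(E_h),\mu^\eta_{E_h})$. *)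

theory Defs
  imports "HOL-Probability.Probability"
begin

text \<open>
  \<open>L\<^sup>p\<close>-classes are handled through representatives: functions carry measurability explicitly, and
  everything that lives on classes is required to respect almost-everywhere equality.
  The base space \<open>X\<close> is a whole type \<open>'x\<close> (hence non-empty) of class \<^class>\<open>t2_space\<close>; its
  \<open>\<sigma>\<close>-algebra \<open>\<Sigma>\<close> is \<^term>\<open>sets m\<close>, which may be larger than the Borel sets.
\<close>

section \<open>Function spaces\<close>

definition sq_integrable :: "'a measure \<Rightarrow> ('a \<Rightarrow> real) set" where
  "sq_integrable \<nu> = {f \<in> borel_measurable \<nu>. integrable \<nu> (\<lambda>x. (f x)\<^sup>2)}"

definition bounded_measurable :: "'a measure \<Rightarrow> ('a \<Rightarrow> real) set" where
  "bounded_measurable \<nu> = {f \<in> borel_measurable \<nu>. bounded (range f)}"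

definition bounded_continuous :: "('a::topological_space \<Rightarrow> real) set" where
  "bounded_continuous = {f. continuous_on UNIV f \<and> bounded (range f)}"

definition vanishing_outside :: "'a set set \<Rightarrow> ('a \<Rightarrow> real) set" where
  "vanishing_outside \<E> = {f. \<exists>E\<in>\<E>. \<forall>x. x \<notin> E \<longrightarrow> f x = 0}"

text \<open>
  A function on \<open>\<real>\<^sup>k\<close>, for variable \<open>k\<close>, is a function of \<open>x :: nat \<Rightarrow> real\<close> that depends on the
  coordinates \<open>x i\<close> with \<open>i < k\<close> only; continuity in the product topology is then continuity
  on \<open>\<real>\<^sup>k\<close>. Smoothness means that all iterated partial derivatives exist and are continuous.
\<close>

definition partial_deriv :: "nat \<Rightarrow> ((nat \<Rightarrow> real) \<Rightarrow> real) \<Rightarrow> (nat \<Rightarrow> real) \<Rightarrow> real" where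
  "partial_deriv i \<phi> x = deriv (\<lambda>t. \<phi> (x(i := t))) (x i)"

definition Cb_smooth :: "nat \<Rightarrow> ((nat \<Rightarrow> real) \<Rightarrow> real) set" where
  "Cb_smooth k = {\<phi>.
     (\<forall>x y. (\<forall>i<k. x i = y i) \<longrightarrow> \<phi> x = \<phi> y) \<and>
     (\<forall>is \<in> lists {..<k}. let \<psi> = foldr partial_deriv is \<phi> in
        bounded (range \<psi>) \<and> continuous_on UNIV \<psi> \<and>
        (\<forall>i<k. \<forall>x. (\<lambda>t. \<psi> (x(i := t))) differentiable at (x i)))}"

section \<open>Symmetric forms on \<open>L\<^sup>2\<close>\<close>

definition L2_dense :: "'a measure \<Rightarrow> ('a \<Rightarrow> real) set \<Rightarrow> bool" where
  "L2_dense \<nu> V \<longleftrightarrow> V \<subseteq> sq_integrable \<nu> \<and>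
     (\<forall>u\<in>sq_integrable \<nu>. \<forall>\<epsilon>>0. \<exists>v\<in>V. (\<integral>x. (u x - v x)\<^sup>2 \<partial>\<nu>) < \<epsilon>)"

type_synonym 'a form = "('a \<Rightarrow> real) \<Rightarrow> ('a \<Rightarrow> real) \<Rightarrow> real"

definition form1 :: "'a measure \<Rightarrow> 'a form \<Rightarrow> 'a form" where
  "form1 \<nu> Q u v = Q u v + (\<integral>x. u x * v x \<partial>\<nu>)"

definition form_Cauchy :: "'a form \<Rightarrow> (nat \<Rightarrow> 'a \<Rightarrow> real) \<Rightarrow> bool" where
  "form_Cauchy Q s \<longleftrightarrow>
     (\<forall>\<epsilon>>0. \<exists>N. \<forall>i\<ge>N. \<forall>j\<ge>N. Q (\<lambda>x. s i x - s j x) (\<lambda>x. s i x - s j x) < \<epsilon>)"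

definition form_closable :: "'a measure \<Rightarrow> ('a \<Rightarrow> real) set \<Rightarrow> 'a form \<Rightarrow> bool" where
  "form_closable \<nu> V Q \<longleftrightarrow>
     (\<forall>s. (\<forall>n. s n \<in> V) \<and> form_Cauchy Q s \<and> (\<lambda>n. \<integral>x. (s n x)\<^sup>2 \<partial>\<nu>) \<longlonglongrightarrow> 0
        \<longrightarrow> (\<lambda>n. Q (s n) (s n)) \<longlonglongrightarrow> 0)"

definition form_approx ::
    "'a measure \<Rightarrow> ('a \<Rightarrow> real) set \<Rightarrow> 'a form \<Rightarrow> (nat \<Rightarrow> 'a \<Rightarrow> real) \<Rightarrow> ('a \<Rightarrow> real) \<Rightarrow> bool" where
  "form_approx \<nu> V Q s u \<longleftrightarrow>
     (\<forall>n. s n \<in> V) \<and> form_Cauchy Q s \<and> (\<lambda>n. \<integral>x. (s n x - u x)\<^sup>2 \<partial>\<nu>) \<longlonglongrightarrow> 0"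

definition closure_dom :: "'a measure \<Rightarrow> ('a \<Rightarrow> real) set \<Rightarrow> 'a form \<Rightarrow> ('a \<Rightarrow> real) set" where
  "closure_dom \<nu> V Q = {u \<in> sq_integrable \<nu>. \<exists>s. form_approx \<nu> V Q s u}"

definition closure_form :: "'a measure \<Rightarrow> ('a \<Rightarrow> real) set \<Rightarrow> 'a form \<Rightarrow> 'a form" where
  "closure_form \<nu> V Q u v =
     (THE c. \<forall>s t. form_approx \<nu> V Q s u \<and> form_approx \<nu> V Q t v \<longrightarrow> (\<lambda>n. Q (s n) (t n)) \<longlonglongrightarrow> c)"

text \<open>Symmetric Dirichlet forms; the first group of conditions says that \<open>(Q, D)\<close> lives on classes.\<close>

definition dirichlet_form :: "'a measure \<Rightarrow> ('a \<Rightarrow> real) set \<Rightarrow> 'a form \<Rightarrow> bool" where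
  "dirichlet_form \<nu> D Q \<longleftrightarrow>
     (\<forall>u\<in>D. \<forall>v\<in>borel_measurable \<nu>. (AE x in \<nu>. u x = v x) \<longrightarrow>
        v \<in> D \<and> (\<forall>w\<in>D. Q u w = Q v w)) \<and>
     (\<lambda>x. 0) \<in> D \<and>
     (\<forall>u\<in>D. \<forall>v\<in>D. (\<lambda>x. u x + v x) \<in> D) \<and>
     (\<forall>u\<in>D. \<forall>c. (\<lambda>x. c * u x) \<in> D) \<and>
     (\<forall>u\<in>D. \<forall>v\<in>D. Q u v = Q v u) \<and>
     (\<forall>u\<in>D. \<forall>v\<in>D. \<forall>w\<in>D. Q (\<lambda>x. u x + v x) w = Q u w + Q v w) \<and>
     (\<forall>u\<in>D. \<forall>w\<in>D. \<forall>c. Q (\<lambda>x. c * u x) w = c * Q u w) \<and>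
     (\<forall>u\<in>D. 0 \<le> Q u u) \<and>
     L2_dense \<nu> D \<and>
     (\<forall>s. (\<forall>n. s n \<in> D) \<and> form_Cauchy (form1 \<nu> Q) s \<longrightarrow>
        (\<exists>u\<in>D. (\<lambda>n. form1 \<nu> Q (\<lambda>x. s n x - u x) (\<lambda>x. s n x - u x)) \<longlonglongrightarrow> 0)) \<and>
     (\<forall>u\<in>D. (\<lambda>x. min 1 (max 0 (u x))) \<in> D \<and>
        Q (\<lambda>x. min 1 (max 0 (u x))) (\<lambda>x. min 1 (max 0 (u x))) \<le> Q u u)"

subsection \<open>Quasi-regularity (Ma and Roeckner)\<close>

definition form_dense :: "'a measure \<Rightarrow> ('a \<Rightarrow> real) set \<Rightarrow> 'a form \<Rightarrow> ('a \<Rightarrow> real) set \<Rightarrow> bool" where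
  "form_dense \<nu> D Q A \<longleftrightarrow> A \<subseteq> D \<and>
     (\<forall>u\<in>D. \<forall>\<epsilon>>0. \<exists>v\<in>A. form1 \<nu> Q (\<lambda>x. u x - v x) (\<lambda>x. u x - v x) < \<epsilon>)"

definition form_nest ::
    "'a::topological_space measure \<Rightarrow> ('a \<Rightarrow> real) set \<Rightarrow> 'a form \<Rightarrow> (nat \<Rightarrow> 'a set) \<Rightarrow> bool" where
  "form_nest \<nu> D Q F \<longleftrightarrow> (\<forall>k. closed (F k)) \<and> incseq F \<and>
     form_dense \<nu> D Q (\<Union>k. {u \<in> D. AE x in \<nu>. x \<notin> F k \<longrightarrow> u x = 0})"

definition form_exceptional ::
    "'a::topological_space measure \<Rightarrow> ('a \<Rightarrow> real) set \<Rightarrow> 'a form \<Rightarrow> 'a set \<Rightarrow> bool" where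
  "form_exceptional \<nu> D Q N \<longleftrightarrow> (\<exists>F. form_nest \<nu> D Q F \<and> N \<subseteq> (\<Inter>k. - F k))"

definition quasi_continuous ::
    "'a::topological_space measure \<Rightarrow> ('a \<Rightarrow> real) set \<Rightarrow> 'a form \<Rightarrow> ('a \<Rightarrow> real) \<Rightarrow> bool" where
  "quasi_continuous \<nu> D Q f \<longleftrightarrow> (\<exists>F. form_nest \<nu> D Q F \<and> (\<forall>k. continuous_on (F k) f))"

definition quasi_regular ::
    "'a::topological_space measure \<Rightarrow> ('a \<Rightarrow> real) set \<Rightarrow> 'a form \<Rightarrow> bool" where
  "quasi_regular \<nu> D Q \<longleftrightarrow>
     (\<exists>F. form_nest \<nu> D Q F \<and> (\<forall>k. compact (F k))) \<and>
     (\<exists>A. form_dense \<nu> D Q A \<and>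
        (\<forall>u\<in>A. \<exists>v. quasi_continuous \<nu> D Q v \<and> (AE x in \<nu>. u x = v x))) \<and>
     (\<exists>(u :: nat \<Rightarrow> 'a \<Rightarrow> real) v N.
        (\<forall>n. u n \<in> D \<and> quasi_continuous \<nu> D Q (v n) \<and> (AE x in \<nu>. u n x = v n x)) \<and>
        form_exceptional \<nu> D Q N \<and>
        (\<forall>x y. x \<notin> N \<and> y \<notin> N \<and> x \<noteq> y \<longrightarrow> (\<exists>n. v n x \<noteq> v n y)))"

section \<open>Topological local diffusion spaces\<close>

text \<open>
  The domain of the continuous bijection is transported to the type \<open>'x\<close> itself, which loses nothing
  since the underlying set of the Polish space is in bijection with \<open>'x\<close>.
\<close>

definition Luzin_type :: "'x::topological_space itself \<Rightarrow> bool" where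
  "Luzin_type _ \<longleftrightarrow> (\<exists>(P :: 'x topology) f.
     completely_metrizable_space P \<and> second_countable P \<and>
     continuous_map P (euclidean :: 'x topology) f \<and> bij_betw f (topspace P) UNIV)"

definition measure_atom :: "'a measure \<Rightarrow> 'a set \<Rightarrow> bool" where
  "measure_atom \<nu> A \<longleftrightarrow> A \<in> sets \<nu> \<and> emeasure \<nu> A > 0 \<and>
     (\<forall>B\<in>sets \<nu>. B \<subseteq> A \<longrightarrow> emeasure \<nu> B = 0 \<or> emeasure \<nu> (A - B) = 0)"

definition localizing_sequence :: "'x measure \<Rightarrow> 'x set set \<Rightarrow> (nat \<Rightarrow> 'x set) \<Rightarrow> bool" where
  "localizing_sequence m \<E> E \<longleftrightarrow>
     (\<forall>h. E h \<in> sets m \<and> emeasure m (E h) < \<infinity>) \<and> incseq E \<and> (\<Union>h. E h) = UNIV \<and>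
     \<E> = (\<Union>h. {A \<inter> E h | A. A \<in> sets m})"

locale topological_local_structure = sigma_finite_measure m
  for m :: "'x::t2_space measure" +
  fixes \<E> :: "'x set set"
  assumes space_m: "space m = UNIV"
    and completely_regular: "completely_regular_space (euclidean :: 'x topology)"
    and Luzin: "Luzin_type TYPE('x)"
    and borel_subset: "sets borel \<subseteq> sets m"
    and subset_completion: "sets m \<subseteq> sets (completion (restr_to_subalg m borel))"
    and singletons: "\<And>x. {x} \<in> sets m"
    and essentially_countably_generated:
      "\<exists>C. countable C \<and> C \<subseteq> sets m \<and>
         (\<forall>A\<in>sets m. \<exists>B\<in>sigma_sets UNIV C. emeasure m ((A - B) \<union> (B - A)) = 0)"
    and atomless: "\<And>A. \<not> measure_atom m A"
    and Radon_locally_finite: "\<And>x. \<exists>U. open U \<and> x \<in> U \<and> emeasure m U < \<infinity>"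
    and Radon_inner_regular:
      "\<And>A. A \<in> sets m \<Longrightarrow> emeasure m A = (SUP K\<in>{K. compact K \<and> K \<subseteq> A}. emeasure m K)"
    and full_support: "\<And>U. open U \<Longrightarrow> U \<noteq> {} \<Longrightarrow> emeasure m U > 0"
    and ring_finite: "\<E> \<subseteq> {A \<in> sets m. emeasure m A < \<infinity>}"
    and ring_Un: "\<And>A B. A \<in> \<E> \<Longrightarrow> B \<in> \<E> \<Longrightarrow> A \<union> B \<in> \<E>"
    and ring_Int: "\<And>A B. A \<in> \<E> \<Longrightarrow> B \<in> \<E> \<Longrightarrow> A \<inter> B \<in> \<E>"
    and ring_ideal: "\<And>A E. A \<in> sets m \<Longrightarrow> E \<in> \<E> \<Longrightarrow> A \<inter> E \<in> \<E>"
    and ring_localizing: "\<exists>E. localizing_sequence m \<E> E"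
    and ring_nhds: "\<And>x. \<exists>E\<in>\<E>. x \<in> interior E"

text \<open>
  Since \<open>m\<close> has full support, a class in \<open>\<D>\<close> has exactly one continuous representative, so \<open>\<D>\<close>
  is a set of functions. \<^term>\<open>\<Gamma> f g\<close> is a bounded representative of a class in \<open>L\<^sup>\<infinity>\<close>.
\<close>

locale topological_local_diffusion_space = topological_local_structure m \<E>
  for m :: "'x::t2_space measure" and \<E> :: "'x set set" +
  fixes \<D> :: "('x \<Rightarrow> real) set"
    and \<Gamma> :: "('x \<Rightarrow> real) \<Rightarrow> ('x \<Rightarrow> real) \<Rightarrow> 'x \<Rightarrow> real"
  assumes D_subset: "\<D> \<subseteq> bounded_continuous \<inter> vanishing_outside \<E>"
    and D_zero: "(\<lambda>x. 0) \<in> \<D>"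
    and D_add: "\<And>f g. f \<in> \<D> \<Longrightarrow> g \<in> \<D> \<Longrightarrow> (\<lambda>x. f x + g x) \<in> \<D>"
    and D_scale: "\<And>c f. f \<in> \<D> \<Longrightarrow> (\<lambda>x. c * f x) \<in> \<D>"
    and D_mult: "\<And>f g. f \<in> \<D> \<Longrightarrow> g \<in> \<D> \<Longrightarrow> (\<lambda>x. f x * g x) \<in> \<D>"
    and D_generates: "open = generate_topology {f -` U | f U. f \<in> \<D> \<and> open U}"
    and D_compose: "\<And>k \<phi> f. \<phi> \<in> Cb_smooth k \<Longrightarrow> (\<And>i. i < k \<Longrightarrow> f i \<in> \<D>) \<Longrightarrow>
      (\<lambda>x. \<phi> (\<lambda>i. f i x) - \<phi> (\<lambda>i. 0)) \<in> \<D>"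
    and Gamma_Linf: "\<And>f g. f \<in> \<D> \<Longrightarrow> g \<in> \<D> \<Longrightarrow> \<Gamma> f g \<in> bounded_measurable m"
    and Gamma_local: "\<And>f g. f \<in> \<D> \<Longrightarrow> g \<in> \<D> \<Longrightarrow>
      \<exists>h \<in> bounded_measurable m \<inter> vanishing_outside \<E>. AE x in m. \<Gamma> f g x = h x"
    and Gamma_sym: "\<And>f g. f \<in> \<D> \<Longrightarrow> g \<in> \<D> \<Longrightarrow> AE x in m. \<Gamma> f g x = \<Gamma> g f x"
    and Gamma_add: "\<And>f g h. f \<in> \<D> \<Longrightarrow> g \<in> \<D> \<Longrightarrow> h \<in> \<D> \<Longrightarrow>
      AE x in m. \<Gamma> (\<lambda>y. f y + g y) h x = \<Gamma> f h x + \<Gamma> g h x"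
    and Gamma_scale: "\<And>c f h. f \<in> \<D> \<Longrightarrow> h \<in> \<D> \<Longrightarrow> AE x in m. \<Gamma> (\<lambda>y. c * f y) h x = c * \<Gamma> f h x"
    and Gamma_nonneg: "\<And>f. f \<in> \<D> \<Longrightarrow> AE x in m. 0 \<le> \<Gamma> f f x"
    and Gamma_diffusion: "\<And>k l \<phi> \<psi> f g. \<phi> \<in> Cb_smooth k \<Longrightarrow> \<psi> \<in> Cb_smooth l \<Longrightarrow>
      (\<And>i. i < k \<Longrightarrow> f i \<in> \<D>) \<Longrightarrow> (\<And>j. j < l \<Longrightarrow> g j \<in> \<D>) \<Longrightarrow>
      AE x in m.
        \<Gamma> (\<lambda>y. \<phi> (\<lambda>i. f i y) - \<phi> (\<lambda>i. 0)) (\<lambda>y. \<psi> (\<lambda>j. g j y) - \<psi> (\<lambda>j. 0)) x =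
        (\<Sum>i<k. \<Sum>j<l. partial_deriv i \<phi> (\<lambda>i. f i x) * partial_deriv j \<psi> (\<lambda>j. g j x) * \<Gamma> (f i) (g j) x)"
    and energy_dense: "L2_dense m \<D>"
    and energy_closable: "form_closable m \<D> (\<lambda>f g. \<integral>x. \<Gamma> f g x \<partial>m)"
    and energy_dirichlet: "dirichlet_form m
      (closure_dom m \<D> (\<lambda>f g. \<integral>x. \<Gamma> f g x \<partial>m)) (closure_form m \<D> (\<lambda>f g. \<integral>x. \<Gamma> f g x \<partial>m))"
    and energy_quasi_regular: "quasi_regular m
      (closure_dom m \<D> (\<lambda>f g. \<integral>x. \<Gamma> f g x \<partial>m)) (closure_form m \<D> (\<lambda>f g. \<integral>x. \<Gamma> f g x \<partial>m))"

definition strong_lifting ::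
    "'x::topological_space measure \<Rightarrow> (('x \<Rightarrow> real) \<Rightarrow> 'x \<Rightarrow> real) \<Rightarrow> bool" where
  "strong_lifting m lft \<longleftrightarrow>
     (\<forall>f\<in>bounded_measurable m. lft f \<in> bounded_measurable m \<and> (AE x in m. lft f x = f x)) \<and>
     (\<forall>f\<in>bounded_measurable m. \<forall>g\<in>bounded_measurable m.
        ((AE x in m. f x = g x) \<longrightarrow> lft f = lft g) \<and>
        ((AE x in m. f x \<le> g x) \<longrightarrow> (\<forall>x. lft f x \<le> lft g x)) \<and>
        lft (\<lambda>x. f x + g x) = (\<lambda>x. lft f x + lft g x) \<and>
        lft (\<lambda>x. f x * g x) = (\<lambda>x. lft f x * lft g x)) \<and>
     (\<forall>f\<in>bounded_measurable m. \<forall>c. lft (\<lambda>x. c * f x) = (\<lambda>x. c * lft f x)) \<and>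
     lft (\<lambda>x. 1) = (\<lambda>x. 1) \<and>
     (\<forall>\<phi>\<in>bounded_continuous. lft \<phi> = \<phi>)"

section \<open>Configuration spaces\<close>

text \<open>
  The sum of Dirac measures at the points \<open>x i\<close>, \<open>i \<in> I\<close>, is the image under \<open>x\<close> of the counting
  measure on \<open>I\<close>.
\<close>

definition dirac_sum :: "'x measure \<Rightarrow> nat set \<Rightarrow> (nat \<Rightarrow> 'x) \<Rightarrow> 'x measure" where
  "dirac_sum m I x = distr (count_space I) m x"

definition configurations :: "'x measure \<Rightarrow> 'x set set \<Rightarrow> 'x measure set" where
  "configurations m \<E> = {\<gamma>. (\<exists>(N::enat) x. \<gamma> = dirac_sum m {i. enat i < N} x) \<and>
     (\<forall>E\<in>\<E>. emeasure \<gamma> E < \<infinity>)}"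

text \<open>Only the \<open>\<sigma>\<close>-algebra \<open>\<Sigma>\<^sub>v\<close> of the following measure is used.\<close>

definition config_space :: "'x measure \<Rightarrow> 'x set set \<Rightarrow> 'x measure measure" where
  "config_space m \<E> = sigma (configurations m \<E>)
     (\<Union>E\<in>\<E>. {(\<lambda>\<gamma>. emeasure \<gamma> E) -` B \<inter> configurations m \<E> | B. B \<in> sets borel})"

text \<open>
  A configuration on a measurable set \<open>A\<close> is identified with a configuration on the whole space
  that does not charge the complement of \<open>A\<close>. For \<open>A \<in> \<E>\<close> such configurations are finite.
\<close>

definition configurations_on :: "'x measure \<Rightarrow> 'x set set \<Rightarrow> 'x set \<Rightarrow> 'x measure set" where
  "configurations_on m \<E> A = {\<gamma> \<in> configurations m \<E>. emeasure \<gamma> (- A) = 0}"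

definition config_space_on :: "'x measure \<Rightarrow> 'x set set \<Rightarrow> 'x set \<Rightarrow> 'x measure measure" where
  "config_space_on m \<E> A = restrict_space (config_space m \<E>) (configurations_on m \<E> A)"

definition config_restrict :: "'x set \<Rightarrow> 'x measure \<Rightarrow> 'x measure" where
  "config_restrict A \<gamma> = density \<gamma> (indicator A)"

text \<open>
  For \<open>m E < \<infinity>\<close>: the number of points is Poisson distributed with parameter \<open>m E\<close> and, given
  that number, the points are independent with distribution \<open>m\<^bsub>E\<^esub> / m E\<close>. The factors
  \<open>(m E)\<^sup>n\<close> cancel against the normalisation of the product measure.
\<close>

definition poisson_measure :: "'x measure \<Rightarrow> 'x set set \<Rightarrow> 'x set \<Rightarrow> 'x measure measure" where
  "poisson_measure m \<E> E =
     measure_of (configurations_on m \<E> E) (sets (config_space_on m \<E> E))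
       (\<lambda>B. \<Sum>n. ennreal (exp (- measure m E) / fact n) *
          emeasure (distr (PiM {..<n} (\<lambda>_. restrict_space m E)) (config_space_on m \<E> E)
             (dirac_sum m {..<n})) B)"

subsection \<open>Conditional probabilities\<close>

text \<open>
  \<^term>\<open>\<kappa>\<close> is a regular conditional probability of \<^term>\<open>\<mu>\<close> given the restriction of the configuration
  to the complement of \<open>E\<close>, indexed by configurations on the complement of \<open>E\<close>; the last
  condition is strong consistency.
\<close>

definition regular_cond_prob ::
    "'x measure \<Rightarrow> 'x set set \<Rightarrow> 'x measure measure \<Rightarrow> 'x set \<Rightarrow> ('x measure \<Rightarrow> 'x measure measure) \<Rightarrow> bool"
  where
  "regular_cond_prob m \<E> \<mu> E \<kappa> \<longleftrightarrow>
     \<kappa> \<in> config_space_on m \<E> (- E) \<rightarrow>\<^sub>M prob_algebra (config_space m \<E>) \<and>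
     (\<forall>A\<in>sets (config_space m \<E>). \<forall>B\<in>sets (config_space_on m \<E> (- E)).
        emeasure \<mu> {\<gamma> \<in> A. config_restrict (- E) \<gamma> \<in> B} =
        (\<integral>\<^sup>+\<zeta>\<in>B. emeasure (\<kappa> \<zeta>) A \<partial>distr \<mu> (config_space_on m \<E> (- E)) (config_restrict (- E)))) \<and>
     (AE \<zeta> in distr \<mu> (config_space_on m \<E> (- E)) (config_restrict (- E)).
        AE \<gamma> in \<kappa> \<zeta>. config_restrict (- E) \<gamma> = \<zeta>)"

definition projected_cond_prob ::
    "'x measure \<Rightarrow> 'x set set \<Rightarrow> ('x set \<Rightarrow> 'x measure \<Rightarrow> 'x measure measure) \<Rightarrow> 'x set \<Rightarrow>
     'x measure \<Rightarrow> 'x measure measure" where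
  "projected_cond_prob m \<E> \<kappa> E \<eta> =
     distr (\<kappa> E (config_restrict (- E) \<eta>)) (config_space_on m \<E> E) (config_restrict E)"

definition cond_abs_continuous_along ::
    "'x measure \<Rightarrow> 'x set set \<Rightarrow> ('x set \<Rightarrow> 'x measure \<Rightarrow> 'x measure measure) \<Rightarrow> 'x measure measure \<Rightarrow>
     (nat \<Rightarrow> 'x set) \<Rightarrow> bool" where
  "cond_abs_continuous_along m \<E> \<kappa> \<mu> E \<longleftrightarrow> localizing_sequence m \<E> E \<and>
     (AE \<eta> in \<mu>. \<forall>h. absolutely_continuous (poisson_measure m \<E> (E h))
        (projected_cond_prob m \<E> \<kappa> (E h) \<eta>))"

definition cond_abs_continuous ::
    "'x measure \<Rightarrow> 'x set set \<Rightarrow> ('x set \<Rightarrow> 'x measure \<Rightarrow> 'x measure measure) \<Rightarrow> 'x measure measure \<Rightarrow> bool"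
  where
  "cond_abs_continuous m \<E> \<kappa> \<mu> \<longleftrightarrow> (\<exists>E. cond_abs_continuous_along m \<E> \<kappa> \<mu> E)"

section \<open>Cylinder functions\<close>

text \<open>
  \<^term>\<open>(k, F, f)\<close> represents the cylinder function \<open>F(f\<^sub>0\<^sup>\<star>, \<dots>, f\<^bsub>k-1\<^esub>\<^sup>\<star>)\<close>. The definitions below
  apply to measures on the whole configuration space as well as to measures on
  \<^term>\<open>configurations_on m \<E> E\<close>.
\<close>

type_synonym 'x cylinder = "nat \<times> ((nat \<Rightarrow> real) \<Rightarrow> real) \<times> (nat \<Rightarrow> 'x \<Rightarrow> real)"

definition cylinders :: "('x \<Rightarrow> real) set \<Rightarrow> 'x cylinder set" where
  "cylinders \<D> = {(k, F, f). F \<in> Cb_smooth k \<and> (\<forall>i<k. f i \<in> \<D>)}"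

fun cyl_fun :: "'x cylinder \<Rightarrow> 'x measure \<Rightarrow> real" where
  "cyl_fun (k, F, f) \<gamma> = F (\<lambda>i. \<integral>x. f i x \<partial>\<gamma>)"

fun cyl_Gamma ::
    "(('x \<Rightarrow> real) \<Rightarrow> ('x \<Rightarrow> real) \<Rightarrow> 'x \<Rightarrow> real) \<Rightarrow> (('x \<Rightarrow> real) \<Rightarrow> 'x \<Rightarrow> real) \<Rightarrow>
     'x cylinder \<Rightarrow> 'x cylinder \<Rightarrow> 'x measure \<Rightarrow> real" where
  "cyl_Gamma \<Gamma> lft (k, F, f) (l, G, g) \<gamma> =
     (\<Sum>i<k. \<Sum>j<l. partial_deriv i F (\<lambda>i. \<integral>x. f i x \<partial>\<gamma>) * partial_deriv j G (\<lambda>j. \<integral>x. g j x \<partial>\<gamma>) *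
        (\<integral>x. lft (\<Gamma> (f i) (g j)) x \<partial>\<gamma>))"

text \<open>All measurable representatives of the \<open>\<nu>\<close>-classes of cylinder functions.\<close>

definition cyl_classes :: "('x \<Rightarrow> real) set \<Rightarrow> 'x measure measure \<Rightarrow> ('x measure \<Rightarrow> real) set" where
  "cyl_classes \<D> \<nu> = {u \<in> borel_measurable \<nu>. \<exists>a\<in>cylinders \<D>. AE \<gamma> in \<nu>. u \<gamma> = cyl_fun a \<gamma>}"

definition cyl_form_well_defined ::
    "('x \<Rightarrow> real) set \<Rightarrow> (('x \<Rightarrow> real) \<Rightarrow> ('x \<Rightarrow> real) \<Rightarrow> 'x \<Rightarrow> real) \<Rightarrow> (('x \<Rightarrow> real) \<Rightarrow> 'x \<Rightarrow> real) \<Rightarrow>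
     'x measure measure \<Rightarrow> bool" where
  "cyl_form_well_defined \<D> \<Gamma> lft \<nu> \<longleftrightarrow>
     (\<forall>a\<in>cylinders \<D>. \<forall>b\<in>cylinders \<D>. integrable \<nu> (cyl_Gamma \<Gamma> lft a b)) \<and>
     (\<forall>a\<in>cylinders \<D>. \<forall>a'\<in>cylinders \<D>. \<forall>b\<in>cylinders \<D>. \<forall>b'\<in>cylinders \<D>.
        (AE \<gamma> in \<nu>. cyl_fun a \<gamma> = cyl_fun a' \<gamma>) \<longrightarrow> (AE \<gamma> in \<nu>. cyl_fun b \<gamma> = cyl_fun b' \<gamma>) \<longrightarrow>
        (\<integral>\<gamma>. cyl_Gamma \<Gamma> lft a b \<gamma> \<partial>\<nu>) = (\<integral>\<gamma>. cyl_Gamma \<Gamma> lft a' b' \<gamma> \<partial>\<nu>))"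

definition cyl_form ::
    "('x \<Rightarrow> real) set \<Rightarrow> (('x \<Rightarrow> real) \<Rightarrow> ('x \<Rightarrow> real) \<Rightarrow> 'x \<Rightarrow> real) \<Rightarrow> (('x \<Rightarrow> real) \<Rightarrow> 'x \<Rightarrow> real) \<Rightarrow>
     'x measure measure \<Rightarrow> 'x measure form" where
  "cyl_form \<D> \<Gamma> lft \<nu> u v = (THE c. \<exists>a\<in>cylinders \<D>. \<exists>b\<in>cylinders \<D>.
     (AE \<gamma> in \<nu>. u \<gamma> = cyl_fun a \<gamma>) \<and> (AE \<gamma> in \<nu>. v \<gamma> = cyl_fun b \<gamma>) \<and>
     c = (\<integral>\<gamma>. cyl_Gamma \<Gamma> lft a b \<gamma> \<partial>\<nu>))"

text \<open>
  That the conditional forms are well defined on classes is part of saying that they are forms on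
  classes; it follows from closability along sequences of representatives, by considering
  constant sequences.
\<close>

definition cond_closability ::
    "'x measure \<Rightarrow> 'x set set \<Rightarrow> ('x \<Rightarrow> real) set \<Rightarrow> (('x \<Rightarrow> real) \<Rightarrow> ('x \<Rightarrow> real) \<Rightarrow> 'x \<Rightarrow> real) \<Rightarrow>
     (('x \<Rightarrow> real) \<Rightarrow> 'x \<Rightarrow> real) \<Rightarrow> ('x set \<Rightarrow> 'x measure \<Rightarrow> 'x measure measure) \<Rightarrow>
     'x measure measure \<Rightarrow> bool" where
  "cond_closability m \<E> \<D> \<Gamma> lft \<kappa> \<mu> \<longleftrightarrow>
     (\<forall>E\<in>\<E>. (\<integral>\<^sup>+\<gamma>. emeasure \<gamma> E \<partial>\<mu>) < \<infinity>) \<and>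
     (\<exists>E. cond_abs_continuous_along m \<E> \<kappa> \<mu> E \<and>
        (\<forall>h. AE \<eta> in \<mu>. let \<nu> = projected_cond_prob m \<E> \<kappa> (E h) \<eta> in
           cyl_form_well_defined \<D> \<Gamma> lft \<nu> \<and>
           form_closable \<nu> (cyl_classes \<D> \<nu>) (cyl_form \<D> \<Gamma> lft \<nu>)))"

end

theory Submission
  imports Defs
begin

text \<open>
  Everything is reduced to the forms on the configurations inside a set \<open>E = L h\<close> of the localizing
  sequence, given the configuration outside \<open>E\<close>. For fixed \<open>\<eta>\<close> outside \<open>E\<close>, the restriction of a
  cylinder function \<open>F(f\<^sub>1\<^sup>\<star>, \<dots>, f\<^sub>k\<^sup>\<star>)\<close> to the configurations with \<open>\<gamma>\<^bsub>- E\<^esub> = \<eta>\<^bsub>- E\<^esub>\<close> is the cylinder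
  function on \<open>E\<close> in which \<open>F\<close> is translated by the vector of the numbers \<open>f\<^sub>i\<^sup>\<star> \<eta>\<^bsub>- E\<^esub>\<close> (\<open>cyl_cond\<close>), and
  its square field there is the part of the full square field that comes from the points in \<open>E\<close>.

  \<^bold>\<open>Closability.\<close> Let \<open>(u n)\<close> be a sequence of cylinder functions that is Cauchy for the energy and tends
  to \<open>0\<close> in \<open>L\<^sup>2\<close>. Integrating the conditional energies and \<open>L\<^sup>2\<close>-norms over \<open>\<eta>\<close> and passing to a subsequence
  that converges fast enough, \<open>(u n)\<close> is Cauchy for almost every conditional form and tends to \<open>0\<close> in
  almost every conditional \<open>L\<^sup>2\<close>-space, so that its conditional energies tend to \<open>0\<close>. Fatou's lemma bounds
  the integrated conditional energy of \<open>u n\<close> by twice a bound for the energies of \<open>u n - u k\<close>, \<open>k\<close> large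
  (\<open>energy_le_of_tail\<close>), uniformly in \<open>h\<close>, and letting \<open>h\<close> tend to infinity gives the
  energy itself (\<open>energy_le_SUP\<close>, \<open>cylinder_closable\<close>). Here the lifting matters: it makes the matrix
  of the square fields non-negative definite at every point, so that the part of the energy in \<open>E\<close> is
  bounded by the energy. Constant sequences show that the form is well defined on classes (\<open>EE_null\<close>).

  \<^bold>\<open>Null sets.\<close> By conditional absolute continuity with respect to Poisson measures, a given \<open>m\<close>-null set is
  almost surely not charged by \<open>\<gamma>\<close> (\<open>AE_null\<close>). Therefore lifted square fields can be replaced by
  representatives supported in the ring, which are integrable because the intensity is finite there.

  \<^bold>\<open>Density.\<close> The events whose indicators are \<open>L\<^sup>1\<close>-limits of cylinder functions with values in \<open>[0, 1]\<close>
  form a \<open>\<sigma>\<close>-algebra that contains the null sets. It makes \<open>\<gamma> \<mapsto> f\<^sup>\<star> \<gamma>\<close>, \<open>f \<in> \<D>\<close>, measurable; since \<open>\<D>\<close>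
  is an algebra that generates the topology and Luzin spaces are hereditarily Lindelof, it also makes
  \<open>\<gamma> \<mapsto> \<gamma> B\<close> measurable for Borel sets \<open>B\<close>, first inside the sets \<open>{f > 0}\<close>, which cover the space up to
  at most one point, of measure \<open>0\<close> (\<open>approximable_sets\<close>).

  \<^bold>\<open>Dirichlet form.\<close> The closure of a closable form with a smooth approximate Markov property is a Dirichlet
  form (\<open>closure_dirichlet_form\<close>); lower semicontinuity is obtained by minimising over convex sets and
  the parallelogram identity. The smooth unit contractions of cylinder functions are cylinder functions
  with smaller square field (\<open>V_markov\<close>).
\<close>

section \<open>Bounded smooth functions of finitely many coordinates\<close>

lemma Cb_smooth_iff:
  "\<phi> \<in> Cb_smooth k \<longleftrightarrow>
     (\<forall>x y. (\<forall>i<k. x i = y i) \<longrightarrow> \<phi> x = \<phi> y) \<and> bounded (range \<phi>) \<and> continuous_on UNIV \<phi> \<and>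
     (\<forall>i<k. (\<forall>x. (\<lambda>t. \<phi> (x(i := t))) differentiable at (x i)) \<and> partial_deriv i \<phi> \<in> Cb_smooth k)"
  (is "?L \<longleftrightarrow> ?R")
proof
  assume L: ?L
  have dep: "\<forall>x y. (\<forall>i<k. x i = y i) \<longrightarrow> \<phi> x = \<phi> y"
    and it: "\<And>is. is \<in> lists {..<k} \<Longrightarrow> let \<psi> = foldr partial_deriv is \<phi> in
        bounded (range \<psi>) \<and> continuous_on UNIV \<psi> \<and>
        (\<forall>i<k. \<forall>x. (\<lambda>t. \<psi> (x(i := t))) differentiable at (x i))"
    using L unfolding Cb_smooth_def by blast+
  have "partial_deriv i \<phi> \<in> Cb_smooth k" if "i < k" for i
  proof -
    have "partial_deriv i \<phi> x = partial_deriv i \<phi> y" if "\<forall>j<k. x j = y j" for x y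
    proof -
      have "(\<lambda>t. \<phi> (x(i := t))) = (\<lambda>t. \<phi> (y(i := t)))"
        using dep that by (auto intro!: ext)
      then show ?thesis using that \<open>i < k\<close> by (simp add: partial_deriv_def)
    qed
    moreover have "let \<psi> = foldr partial_deriv is (partial_deriv i \<phi>) in
        bounded (range \<psi>) \<and> continuous_on UNIV \<psi> \<and>
        (\<forall>i<k. \<forall>x. (\<lambda>t. \<psi> (x(i := t))) differentiable at (x i))" if "is \<in> lists {..<k}" for "is"
      using it[of "is @ [i]"] that \<open>i < k\<close> by simp
    ultimately show ?thesis unfolding Cb_smooth_def by blast
  qed
  then show ?R using dep it[of "[]"] by (simp add: Let_def)
next
  assume R: ?R
  have "let \<psi> = foldr partial_deriv is \<phi> in
        bounded (range \<psi>) \<and> continuous_on UNIV \<psi> \<and>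
        (\<forall>i<k. \<forall>x. (\<lambda>t. \<psi> (x(i := t))) differentiable at (x i))" if "is \<in> lists {..<k}" for "is"
    using that
  proof (cases "is" rule: rev_cases)
    case Nil
    then show ?thesis using R by (simp add: Let_def)
  next
    case (snoc js i)
    then have "i < k" "js \<in> lists {..<k}" using that by auto
    then have "partial_deriv i \<phi> \<in> Cb_smooth k" using R by blast
    then show ?thesis using \<open>js \<in> lists {..<k}\<close> unfolding snoc Cb_smooth_def by simp
  qed
  then show ?L using R unfolding Cb_smooth_def by blast
qed

text \<open>
  The class \<^term>\<open>Cb_smooth k\<close> is the largest set of bounded continuous functions of the first
  \<open>k\<close> coordinates that is stable under partial derivatives; all closure properties below are
  proved by exhibiting a stable set.
\<close>

lemma Cb_smooth_coinduct:
  assumes "\<phi> \<in> S"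
    and dep: "\<And>\<psi> x y. \<psi> \<in> S \<Longrightarrow> (\<And>i. i < k \<Longrightarrow> x i = y i) \<Longrightarrow> \<psi> x = \<psi> y"
    and bdd: "\<And>\<psi>. \<psi> \<in> S \<Longrightarrow> bounded (range \<psi>)"
    and cont: "\<And>\<psi>. \<psi> \<in> S \<Longrightarrow> continuous_on UNIV \<psi>"
    and diff: "\<And>\<psi> i x. \<psi> \<in> S \<Longrightarrow> i < k \<Longrightarrow> (\<lambda>t. \<psi> (x(i := t))) differentiable at (x i)"
    and stable: "\<And>\<psi> i. \<psi> \<in> S \<Longrightarrow> i < k \<Longrightarrow> partial_deriv i \<psi> \<in> S"
  shows "\<phi> \<in> Cb_smooth k"
proof -
  have "foldr partial_deriv is \<phi> \<in> S" if "is \<in> lists {..<k}" for "is"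
    using that by induction (auto simp: assms(1) stable)
  then show ?thesis unfolding Cb_smooth_def Let_def
    using assms(1) dep bdd cont diff by (auto intro!: dep[OF assms(1)])
qed

lemma Cb_smooth_dep: "\<phi> \<in> Cb_smooth k \<Longrightarrow> (\<And>i. i < k \<Longrightarrow> x i = y i) \<Longrightarrow> \<phi> x = \<phi> y"
  using Cb_smooth_iff[of \<phi> k] by blast

lemma Cb_smooth_bounded: "\<phi> \<in> Cb_smooth k \<Longrightarrow> bounded (range \<phi>)"
  using Cb_smooth_iff[of \<phi> k] by blast

lemma Cb_smooth_continuous: "\<phi> \<in> Cb_smooth k \<Longrightarrow> continuous_on UNIV \<phi>"
  using Cb_smooth_iff[of \<phi> k] by blast

lemma Cb_smooth_differentiable:
  "\<phi> \<in> Cb_smooth k \<Longrightarrow> i < k \<Longrightarrow> (\<lambda>t. \<phi> (x(i := t))) differentiable at (x i)"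
  using Cb_smooth_iff[of \<phi> k] by blast

lemma Cb_smooth_partial: "\<phi> \<in> Cb_smooth k \<Longrightarrow> i < k \<Longrightarrow> partial_deriv i \<phi> \<in> Cb_smooth k"
  using Cb_smooth_iff[of \<phi> k] by blast

lemma partial_deriv_eqI:
  "((\<lambda>t. \<phi> (x(i := t))) has_real_derivative d) (at (x i)) \<Longrightarrow> partial_deriv i \<phi> x = d"
  unfolding partial_deriv_def by (rule DERIV_imp_deriv)

lemma has_partial_deriv:
  fixes \<phi> :: "(nat \<Rightarrow> real) \<Rightarrow> real"
  assumes "(\<lambda>t. \<phi> (x(i := t))) differentiable at (x i)"
  shows "((\<lambda>t. \<phi> (x(i := t))) has_real_derivative partial_deriv i \<phi> x) (at (x i))"
  using assms unfolding partial_deriv_def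
  using DERIV_imp_deriv real_differentiable_def by blast

lemma Cb_smooth_has_partial:
  "\<phi> \<in> Cb_smooth k \<Longrightarrow> i < k \<Longrightarrow>
    ((\<lambda>t. \<phi> (x(i := t))) has_real_derivative partial_deriv i \<phi> x) (at (x i))"
  by (intro has_partial_deriv Cb_smooth_differentiable)

lemma partial_deriv_indep:
  assumes "\<And>x y. (\<And>j. j \<noteq> i \<Longrightarrow> x j = y j) \<Longrightarrow> \<phi> x = \<phi> y"
  shows "partial_deriv i \<phi> x = 0"
proof (rule partial_deriv_eqI)
  have "(\<lambda>t. \<phi> (x(i := t))) = (\<lambda>t. \<phi> x)" by (intro ext assms) simp
  then show "((\<lambda>t. \<phi> (x(i := t))) has_real_derivative 0) (at (x i))" by simp
qed

lemma Cb_smooth_const: "(\<lambda>_. c) \<in> Cb_smooth k"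
proof (rule Cb_smooth_coinduct[where S = "range (\<lambda>c _. c)"])
  fix \<psi> :: "(nat \<Rightarrow> real) \<Rightarrow> real" and i :: nat
  assume "\<psi> \<in> range (\<lambda>c _. c)"
  then have "partial_deriv i \<psi> = (\<lambda>_. 0)" by (auto intro!: ext partial_deriv_indep)
  then show "partial_deriv i \<psi> \<in> range (\<lambda>c _. c)" by simp
qed auto

text \<open>Translations, and the two embeddings of coordinates needed for pairs of cylinder functions.\<close>

lemma partial_deriv_reindex:
  "partial_deriv i (\<lambda>x. \<psi> (\<lambda>j. x (j + p) + c j)) x =
     (if p \<le> i then partial_deriv (i - p) \<psi> (\<lambda>j. x (j + p) + c j) else 0)"
proof (cases "p \<le> i")
  case True
  have *: "(\<lambda>j. (x(i := t)) (j + p) + c j) = (\<lambda>j. x (j + p) + c j)(i - p := t + c (i - p))" for t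
    using True by (auto simp: fun_eq_iff)
  have "(deriv (\<lambda>t. \<psi> ((\<lambda>j. x (j + p) + c j)(i - p := t + c (i - p)))) (x i)) =
    deriv (\<lambda>t. \<psi> ((\<lambda>j. x (j + p) + c j)(i - p := t))) (x i + c (i - p))"
    unfolding deriv_def
    by (rule arg_cong[where f = Eps]) (auto intro!: ext simp: DERIV_shift)
  then show ?thesis using True unfolding partial_deriv_def * by simp
next
  case False
  then show ?thesis by (auto intro!: partial_deriv_indep arg_cong[where f = \<psi>])
qed

lemma Cb_smooth_reindex:
  assumes "\<phi> \<in> Cb_smooth k" "p + k \<le> n"
  shows "(\<lambda>x. \<phi> (\<lambda>j. x (j + p) + c j)) \<in> Cb_smooth n"
proof (rule Cb_smooth_coinduct[where S = "(\<lambda>\<psi> x. \<psi> (\<lambda>j. x (j + p) + c j)) ` Cb_smooth k"])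
  let ?r = "\<lambda>x j. x (j + p) + c j" and ?S = "(\<lambda>\<psi> x. \<psi> (\<lambda>j. x (j + p) + c j)) ` Cb_smooth k"
  fix \<psi>' :: "(nat \<Rightarrow> real) \<Rightarrow> real" assume "\<psi>' \<in> ?S"
  then obtain \<psi> where \<psi>: "\<psi>' = (\<lambda>x. \<psi> (?r x))" "\<psi> \<in> Cb_smooth k" by auto
  show "\<psi>' x = \<psi>' y" if "\<And>i. i < n \<Longrightarrow> x i = y i" for x y
    unfolding \<psi> using that \<open>p + k \<le> n\<close> by (intro Cb_smooth_dep[OF \<psi>(2)]) auto
  show "bounded (range \<psi>')"
    using Cb_smooth_bounded[OF \<psi>(2)] unfolding \<psi> by (rule bounded_subset) auto
  show "continuous_on UNIV \<psi>'"
    unfolding \<psi> by (rule continuous_on_compose2[OF Cb_smooth_continuous[OF \<psi>(2)]])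
      (auto intro!: continuous_intros continuous_on_coordinatewise_then_product)
  fix i assume "i < n"
  have z: "(\<lambda>_. 0) \<in> Cb_smooth k" by (rule Cb_smooth_const)
  show "partial_deriv i \<psi>' \<in> ?S"
  proof (cases "p \<le> i \<and> i < p + k")
    case True
    then have "partial_deriv i \<psi>' = (\<lambda>x. partial_deriv (i - p) \<psi> (?r x))"
      unfolding \<psi> by (intro ext) (simp add: partial_deriv_reindex)
    moreover have "partial_deriv (i - p) \<psi> \<in> Cb_smooth k"
      using True \<psi> by (intro Cb_smooth_partial) auto
    ultimately show ?thesis by blast
  next
    case False
    have "partial_deriv i \<psi>' x = 0" for x
      unfolding \<psi>(1) using False
      by (intro partial_deriv_indep Cb_smooth_dep[OF \<psi>(2)]) (auto simp: not_le not_less)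
    then have "partial_deriv i \<psi>' = (\<lambda>x. (\<lambda>_. 0) (?r x))" by auto
    then show ?thesis using z by (rule image_eqI)
  qed
  show "(\<lambda>t. \<psi>' (x(i := t))) differentiable at (x i)" for x
  proof (cases "p \<le> i \<and> i < p + k")
    case True
    then have *: "?r (x(i := t)) = (?r x)(i - p := t + c (i - p))" for t
      by (auto simp: fun_eq_iff)
    have "(\<lambda>t. \<psi> ((?r x)(i - p := t))) differentiable at (?r x (i - p))"
      using True \<psi> by (intro Cb_smooth_differentiable) auto
    then have "((\<lambda>t. \<psi> ((?r x)(i - p := t))) has_real_derivative
        deriv (\<lambda>t. \<psi> ((?r x)(i - p := t))) (x i + c (i - p))) (at (x i + c (i - p)))"
      using True by (simp add: DERIV_deriv_iff_real_differentiable)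
    then show ?thesis unfolding \<psi> * DERIV_shift real_differentiable_def by blast
  next
    case False
    have "(\<lambda>t. \<psi>' (x(i := t))) = (\<lambda>t. \<psi>' x)"
      unfolding \<psi>(1) using False
      by (intro ext Cb_smooth_dep[OF \<psi>(2)]) (auto simp: not_le not_less)
    then show ?thesis by simp
  qed
qed (use assms(1) in blast)

lemma Cb_smooth_translate:
  "\<phi> \<in> Cb_smooth k \<Longrightarrow> (\<lambda>x. \<phi> (\<lambda>j. x j + c j)) \<in> Cb_smooth k"
  using Cb_smooth_reindex[of \<phi> k 0 k c] by simp

lemma Cb_smooth_mono: "\<phi> \<in> Cb_smooth k \<Longrightarrow> k \<le> n \<Longrightarrow> \<phi> \<in> Cb_smooth n"
  using Cb_smooth_reindex[of \<phi> k 0 n "\<lambda>_. 0"] by simp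

lemma Cb_smooth_shift:
  "\<phi> \<in> Cb_smooth k \<Longrightarrow> p + k \<le> n \<Longrightarrow> (\<lambda>x. \<phi> (\<lambda>j. x (j + p))) \<in> Cb_smooth n"
  using Cb_smooth_reindex[of \<phi> k p n "\<lambda>_. 0"] by simp

subsection \<open>Composition with the logistic function\<close>

text \<open>The logistic function, whose derivative is a polynomial in itself.\<close>

definition logistic :: "real \<Rightarrow> real" where
  "logistic t = 1 / (1 + exp (- t))"

lemma logistic_gt_0: "0 < logistic t" and logistic_lt_1: "logistic t < 1"
  by (auto simp: logistic_def field_simps add_pos_pos)

lemma abs_logistic_le: "\<bar>logistic t\<bar> \<le> 1"
  using logistic_gt_0[of t] logistic_lt_1[of t] by simp

lemma DERIV_logistic:
  "(logistic has_real_derivative logistic t * (1 - logistic t)) (at t)"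
proof -
  have "1 + exp (- t) \<noteq> 0" using exp_gt_zero[of "- t"] by linarith
  then show ?thesis unfolding logistic_def
    by (auto intro!: derivative_eq_intros simp: divide_simps) 
qed

lemma mono_logistic: "s \<le> t \<Longrightarrow> logistic s \<le> logistic t"
  by (auto simp: logistic_def intro!: divide_left_mono mult_pos_pos add_pos_pos)

text \<open>
  The algebra generated by \<^term>\<open>Cb_smooth k\<close> and one further function of the form
  \<open>logistic \<circ> h\<close>; here \<open>h\<close> itself need not be bounded.
\<close>

inductive_set logistic_algebra :: "nat \<Rightarrow> ((nat \<Rightarrow> real) \<Rightarrow> real) \<Rightarrow> ((nat \<Rightarrow> real) \<Rightarrow> real) set"
  for k h where
    base: "\<phi> \<in> Cb_smooth k \<Longrightarrow> \<phi> \<in> logistic_algebra k h"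
  | logi: "(\<lambda>x. logistic (h x)) \<in> logistic_algebra k h"
  | add: "\<phi> \<in> logistic_algebra k h \<Longrightarrow> \<psi> \<in> logistic_algebra k h \<Longrightarrow>
      (\<lambda>x. \<phi> x + \<psi> x) \<in> logistic_algebra k h"
  | mult: "\<phi> \<in> logistic_algebra k h \<Longrightarrow> \<psi> \<in> logistic_algebra k h \<Longrightarrow>
      (\<lambda>x. \<phi> x * \<psi> x) \<in> logistic_algebra k h"

lemma logistic_algebra_Cb_smooth:
  assumes dep: "\<And>x y. (\<And>i. i < k \<Longrightarrow> x i = y i) \<Longrightarrow> h x = h y"
    and cont: "continuous_on UNIV h"
    and diff: "\<And>i x. i < k \<Longrightarrow> (\<lambda>t. h (x(i := t))) differentiable at (x i)"
    and partial: "\<And>i. i < k \<Longrightarrow> partial_deriv i h \<in> Cb_smooth k"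
    and \<phi>: "\<phi> \<in> logistic_algebra k h"
  shows "\<phi> \<in> Cb_smooth k"
proof (rule Cb_smooth_coinduct[OF \<phi>])
  fix \<psi> assume "\<psi> \<in> logistic_algebra k h"
  then have *: "(\<forall>x y. (\<forall>i<k. x i = y i) \<longrightarrow> \<psi> x = \<psi> y) \<and> (\<exists>B. \<forall>x. \<bar>\<psi> x\<bar> \<le> B) \<and> continuous_on UNIV \<psi> \<and>
     (\<forall>i<k. (\<forall>x. (\<lambda>t. \<psi> (x(i := t))) differentiable at (x i)) \<and> partial_deriv i \<psi> \<in> logistic_algebra k h)"
  proof induction
    case (base \<phi>)
    show ?case
    proof (intro conjI allI impI)
      show "\<phi> x = \<phi> y" if "\<forall>i<k. x i = y i" for x y using Cb_smooth_dep[OF base] that by blast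
      show "\<exists>B. \<forall>x. \<bar>\<phi> x\<bar> \<le> B" using Cb_smooth_bounded[OF base] by (auto simp: bounded_iff)
    qed (use Cb_smooth_continuous[OF base] Cb_smooth_differentiable[OF base]
        logistic_algebra.base[OF Cb_smooth_partial[OF base]] in blast)+
  next
    case logi
    have 1: "logistic (h x) = logistic (h y)" if "\<forall>i<k. x i = y i" for x y
      using dep[of x y] that by simp
    have 2: "\<exists>B. \<forall>x. \<bar>logistic (h x)\<bar> \<le> B"
      using abs_logistic_le by blast
    have "continuous_on UNIV logistic"
      by (rule DERIV_continuous_on[OF has_field_derivative_at_within[OF DERIV_logistic]])
    then have 3: "continuous_on UNIV (\<lambda>x. logistic (h x))"
      using cont by (rule continuous_on_compose2) auto
    have D: "((\<lambda>t. logistic (h (x(i := t)))) has_real_derivative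
      (logistic (h x) * (1 - logistic (h x)) * partial_deriv i h x)) (at (x i))" if "i < k" for i x
      using DERIV_chain2[OF DERIV_logistic has_partial_deriv[OF diff[OF that]], of x]
      unfolding fun_upd_triv .
    have 4: "(\<lambda>t. logistic (h (x(i := t)))) differentiable at (x i)" if "i < k" for i x
      using D[OF that] real_differentiable_def by blast
    have "partial_deriv i (\<lambda>x. logistic (h x)) =
      (\<lambda>x. (logistic (h x) * (1 + (-1) * logistic (h x))) * partial_deriv i h x)" if "i < k" for i
      by (intro ext partial_deriv_eqI) (use D[OF that] in simp)
    moreover have "(\<lambda>x. (logistic (h x) * (1 + (-1) * logistic (h x))) * partial_deriv i h x)
        \<in> logistic_algebra k h" if "i < k" for i
      by (intro logistic_algebra.intros Cb_smooth_const partial that)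
    ultimately show ?case using 1 2 3 4 by (simp del: fun_upd_apply)
  next
    case (add \<phi> \<psi>)
    then obtain B C where BC: "\<And>x. \<bar>\<phi> x\<bar> \<le> B" "\<And>x. \<bar>\<psi> x\<bar> \<le> C" by metis
    have 2: "\<exists>B. \<forall>x. \<bar>\<phi> x + \<psi> x\<bar> \<le> B"
    proof (intro exI allI)
      show "\<bar>\<phi> x + \<psi> x\<bar> \<le> B + C" for x using BC(1)[of x] BC(2)[of x] by linarith
    qed
    have D: "((\<lambda>t. \<phi> (x(i := t)) + \<psi> (x(i := t))) has_real_derivative
      (partial_deriv i \<phi> x + partial_deriv i \<psi> x)) (at (x i))" if "i < k" for i x
      by (intro DERIV_add has_partial_deriv) (use add that in blast)+
    then have "partial_deriv i (\<lambda>x. \<phi> x + \<psi> x) = (\<lambda>x. partial_deriv i \<phi> x + partial_deriv i \<psi> x)"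
      if "i < k" for i by (intro ext partial_deriv_eqI) (use that in simp)
    moreover have "(\<lambda>t. \<phi> (x(i := t)) + \<psi> (x(i := t))) differentiable at (x i)" if "i < k" for i x
      using D[OF that] real_differentiable_def by blast
    moreover have "continuous_on UNIV (\<lambda>x. \<phi> x + \<psi> x)" using add by (intro continuous_on_add) auto
    moreover have "\<forall>x y. (\<forall>i<k. x i = y i) \<longrightarrow> \<phi> x + \<psi> x = \<phi> y + \<psi> y"
      using add.IH by metis
    ultimately show ?case using 2 add by (simp add: logistic_algebra.add del: fun_upd_apply)
  next
    case (mult \<phi> \<psi>)
    then obtain B C where BC: "\<And>x. \<bar>\<phi> x\<bar> \<le> B" "\<And>x. \<bar>\<psi> x\<bar> \<le> C" by metis
    have 2: "\<exists>B. \<forall>x. \<bar>\<phi> x * \<psi> x\<bar> \<le> B"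
    proof (intro exI allI)
      show "\<bar>\<phi> x * \<psi> x\<bar> \<le> B * C" for x
        using mult_mono[OF BC(1)[of x] BC(2)[of x]] BC(1)[of x] by (simp add: abs_mult)
    qed
    have D: "((\<lambda>t. \<phi> (x(i := t)) * \<psi> (x(i := t))) has_real_derivative
      (partial_deriv i \<phi> x * \<psi> x + partial_deriv i \<psi> x * \<phi> x)) (at (x i))" if "i < k" for i x
    proof -
      have a: "((\<lambda>t. \<phi> (x(i := t))) has_real_derivative partial_deriv i \<phi> x) (at (x i))"
        and b: "((\<lambda>t. \<psi> (x(i := t))) has_real_derivative partial_deriv i \<psi> x) (at (x i))"
        by (intro has_partial_deriv; use mult that in blast)+
      show ?thesis using DERIV_mult[OF a b] by simp
    qed
    then have "partial_deriv i (\<lambda>x. \<phi> x * \<psi> x) = (\<lambda>x. partial_deriv i \<phi> x * \<psi> x + partial_deriv i \<psi> x * \<phi> x)"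
      if "i < k" for i by (intro ext partial_deriv_eqI) (use that in simp)
    moreover have "(\<lambda>t. \<phi> (x(i := t)) * \<psi> (x(i := t))) differentiable at (x i)" if "i < k" for i x
      using D[OF that] real_differentiable_def by blast
    moreover have "continuous_on UNIV (\<lambda>x. \<phi> x * \<psi> x)" using mult by (intro continuous_on_mult) auto
    moreover have "\<forall>x y. (\<forall>i<k. x i = y i) \<longrightarrow> \<phi> x * \<psi> x = \<phi> y * \<psi> y"
      using mult.IH by metis
    ultimately show ?case using 2 mult
      by (simp add: logistic_algebra.add logistic_algebra.mult del: fun_upd_apply)
  qed
  show "\<psi> x = \<psi> y" if "\<And>i. i < k \<Longrightarrow> x i = y i" for x y using * that by blast
  show "bounded (range \<psi>)" using * by (auto simp: bounded_iff)
  show "continuous_on UNIV \<psi>" using * by blast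
  show "(\<lambda>t. \<psi> (x(i := t))) differentiable at (x i)" "partial_deriv i \<psi> \<in> logistic_algebra k h"
    if "i < k" for i x using * that by blast+
qed

lemma Cb_smooth_add: "\<phi> \<in> Cb_smooth k \<Longrightarrow> \<psi> \<in> Cb_smooth k \<Longrightarrow> (\<lambda>x. \<phi> x + \<psi> x) \<in> Cb_smooth k"
  and Cb_smooth_mult: "\<phi> \<in> Cb_smooth k \<Longrightarrow> \<psi> \<in> Cb_smooth k \<Longrightarrow> (\<lambda>x. \<phi> x * \<psi> x) \<in> Cb_smooth k"
proof -
  have z: "(\<lambda>_. 0) \<in> Cb_smooth k" by (rule Cb_smooth_const)
  have *: "\<theta> \<in> Cb_smooth k" if "\<theta> \<in> logistic_algebra k (\<lambda>_. 0)" for \<theta>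
    using logistic_algebra_Cb_smooth[OF _ _ _ Cb_smooth_partial[OF z] that] by simp
  assume "\<phi> \<in> Cb_smooth k" "\<psi> \<in> Cb_smooth k"
  then show "(\<lambda>x. \<phi> x + \<psi> x) \<in> Cb_smooth k" "(\<lambda>x. \<phi> x * \<psi> x) \<in> Cb_smooth k"
    by (intro *; auto intro: logistic_algebra.intros)+
qed

lemma Cb_smooth_scale: "\<phi> \<in> Cb_smooth k \<Longrightarrow> (\<lambda>x. c * \<phi> x) \<in> Cb_smooth k"
  by (intro Cb_smooth_mult Cb_smooth_const)

lemma Cb_smooth_logistic:
  assumes "\<And>x y. (\<And>i. i < k \<Longrightarrow> x i = y i) \<Longrightarrow> h x = h y" "continuous_on UNIV h"
    "\<And>i x. i < k \<Longrightarrow> (\<lambda>t. h (x(i := t))) differentiable at (x i)"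
    "\<And>i. i < k \<Longrightarrow> partial_deriv i h \<in> Cb_smooth k"
  shows "(\<lambda>x. logistic (h x)) \<in> Cb_smooth k"
  by (rule logistic_algebra_Cb_smooth[OF assms logistic_algebra.logi])

lemma Cb_smooth_logistic_coord: "(\<lambda>x. logistic (a * x 0 + b)) \<in> Cb_smooth 1"
proof (rule Cb_smooth_logistic)
  have D: "((\<lambda>t. a * (x(i := t)) 0 + b) has_real_derivative a) (at (x i))" if "i < 1" for x :: "nat \<Rightarrow> real" and i
    using that by (auto intro!: derivative_eq_intros)
  show "(\<lambda>t. a * (x(i := t)) 0 + b) differentiable at (x i)" if "i < 1" for x :: "nat \<Rightarrow> real" and i
    using D[OF that] real_differentiable_def by blast
  have "partial_deriv i (\<lambda>x. a * x 0 + b) = (\<lambda>_. a)" if "i < 1" for i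
    by (intro ext partial_deriv_eqI D that)
  then show "partial_deriv i (\<lambda>x. a * x 0 + b) \<in> Cb_smooth 1" if "i < 1" for i
    using that by (simp add: Cb_smooth_const)
qed (auto intro!: continuous_intros)

subsection \<open>A smooth unit contraction\<close>

text \<open>
  The difference of two soft-plus functions \<open>\<epsilon> ln (1 + exp (t / \<epsilon>))\<close>: a smooth approximation of
  \<open>t \<mapsto> min 1 (max 0 t)\<close> with values in \<open>[0, 1]\<close> and derivative in \<open>[0, 1]\<close>.
\<close>

definition soft_clip :: "real \<Rightarrow> real \<Rightarrow> real" where
  "soft_clip \<epsilon> t = \<epsilon> * ln (1 + exp (t / \<epsilon>)) - \<epsilon> * ln (1 + exp ((t - 1) / \<epsilon>))"

text \<open>The derivative of \<^const>\<open>soft_clip\<close>.\<close>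

definition soft_clip' :: "real \<Rightarrow> real \<Rightarrow> real" where
  "soft_clip' \<epsilon> t = logistic (t / \<epsilon>) - logistic ((t - 1) / \<epsilon>)"

lemma DERIV_soft_clip:
  assumes "\<epsilon> > 0" shows "(soft_clip \<epsilon> has_real_derivative soft_clip' \<epsilon> t) (at t)"
proof -
  have pos: "1 + exp s > 0" for s :: real by (simp add: add_pos_pos)
  have l: "logistic s = exp s / (1 + exp s)" for s
    using pos[of s] pos[of "-s"] by (simp add: logistic_def exp_minus divide_simps)
  have ne: "1 + exp s \<noteq> 0" for s :: real using pos[of s] by simp
  show ?thesis unfolding soft_clip_def[abs_def] soft_clip'_def l
    using assms by (auto intro!: derivative_eq_intros simp: pos ne)
qed

lemma soft_clip'_bounds:
  assumes "\<epsilon> > 0" shows "0 \<le> soft_clip' \<epsilon> t" "soft_clip' \<epsilon> t \<le> 1"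
proof -
  show "0 \<le> soft_clip' \<epsilon> t" using mono_logistic[of "(t - 1) / \<epsilon>" "t / \<epsilon>"] assms
    by (simp add: soft_clip'_def divide_right_mono)
  show "soft_clip' \<epsilon> t \<le> 1"
    using logistic_lt_1[of "t / \<epsilon>"] logistic_gt_0[of "(t - 1) / \<epsilon>"] by (simp add: soft_clip'_def)
qed

lemma soft_plus_bounds:
  fixes \<epsilon> t :: real
  assumes "\<epsilon> > 0"
  shows "max 0 t \<le> \<epsilon> * ln (1 + exp (t / \<epsilon>))" "\<epsilon> * ln (1 + exp (t / \<epsilon>)) \<le> max 0 t + \<epsilon> * ln 2"
proof -
  have *: "max 0 s \<le> ln (1 + exp s)" "ln (1 + exp s) \<le> max 0 s + ln 2" for s :: real
  proof -
    have pos: "1 + exp s > 0" by (simp add: add_pos_pos)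
    have "exp (max 0 s) \<le> 1 + exp s" by (auto simp: max_def add_nonneg_nonneg)
    then show "max 0 s \<le> ln (1 + exp s)" using pos by (simp add: ln_ge_iff)
    have "1 + exp s \<le> 2 * exp (max 0 s)" by (auto simp: max_def)
    then have "ln (1 + exp s) \<le> ln (2 * exp (max 0 s))" using pos by simp
    then show "ln (1 + exp s) \<le> max 0 s + ln 2" by (simp add: ln_mult)
  qed
  have m: "\<epsilon> * max 0 (t / \<epsilon>) = max 0 t" using assms by (auto simp: max_def field_simps)
  show "max 0 t \<le> \<epsilon> * ln (1 + exp (t / \<epsilon>))" using mult_left_mono[OF *(1), of \<epsilon> "t/\<epsilon>"] assms m by simp
  have "\<epsilon> * ln (1 + exp (t / \<epsilon>)) \<le> \<epsilon> * (max 0 (t / \<epsilon>) + ln 2)"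
    using mult_left_mono[OF *(2), of \<epsilon> "t/\<epsilon>"] assms by simp
  then show "\<epsilon> * ln (1 + exp (t / \<epsilon>)) \<le> max 0 t + \<epsilon> * ln 2"
    by (simp only: distrib_left m)
qed

lemma soft_clip_approx:
  assumes "\<epsilon> > 0" shows "\<bar>soft_clip \<epsilon> t - min 1 (max 0 t)\<bar> \<le> \<epsilon>"
proof -
  have "\<epsilon> * ln 2 \<le> \<epsilon> * 1" using assms ln2_le_25_over_36 by (intro mult_left_mono) auto
  moreover have "min 1 (max 0 t) = max 0 t - max 0 (t - 1)" by auto
  ultimately show ?thesis
    using soft_plus_bounds[OF assms, of t] soft_plus_bounds[OF assms, of "t - 1"]
    unfolding soft_clip_def by linarith
qed

lemma soft_clip_nonneg:
  assumes "\<epsilon> > 0" shows "0 \<le> soft_clip \<epsilon> t"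
proof -
  have "exp ((t - 1) / \<epsilon>) \<le> exp (t / \<epsilon>)" using assms by (simp add: divide_right_mono)
  then have "ln (1 + exp ((t - 1) / \<epsilon>)) \<le> ln (1 + exp (t / \<epsilon>))" by (simp add: add_pos_pos)
  then show ?thesis using assms by (simp add: soft_clip_def mult_left_mono)
qed

lemma soft_clip_le_1:
  assumes "\<epsilon> > 0" shows "soft_clip \<epsilon> t \<le> 1"
proof -
  have pos: "1 + exp s > 0" for s :: real by (simp add: add_pos_pos)
  have "exp (t / \<epsilon>) = exp (1 / \<epsilon>) * exp ((t - 1) / \<epsilon>)"
    by (simp add: exp_add[symmetric] add_divide_distrib[symmetric])
  then have "1 + exp (t / \<epsilon>) \<le> exp (1 / \<epsilon>) * (1 + exp ((t - 1) / \<epsilon>))"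
    using assms by (simp add: distrib_left)
  then have "ln (1 + exp (t / \<epsilon>)) \<le> ln (exp (1 / \<epsilon>) * (1 + exp ((t - 1) / \<epsilon>)))"
    using pos by simp
  also have "\<dots> = 1 / \<epsilon> + ln (1 + exp ((t - 1) / \<epsilon>))"
    using pos[of "(t - 1) / \<epsilon>"] by (simp add: ln_mult)
  finally have "\<epsilon> * ln (1 + exp (t / \<epsilon>)) \<le> \<epsilon> * (1 / \<epsilon> + ln (1 + exp ((t - 1) / \<epsilon>)))"
    using assms by (simp add: mult_left_mono)
  then show ?thesis using assms by (simp add: soft_clip_def distrib_left)
qed

lemma Cb_smooth_soft_clip:
  assumes F: "F \<in> Cb_smooth k" and "\<epsilon> > 0"
  shows "(\<lambda>x. soft_clip \<epsilon> (F x)) \<in> Cb_smooth k"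
    and "i < k \<Longrightarrow> partial_deriv i (\<lambda>x. soft_clip \<epsilon> (F x)) x = soft_clip' \<epsilon> (F x) * partial_deriv i F x"
proof -
  have D: "((\<lambda>t. soft_clip \<epsilon> (F (x(i := t)))) has_real_derivative
      soft_clip' \<epsilon> (F x) * partial_deriv i F x) (at (x i))" if "i < k" for i x
    using DERIV_chain2[OF DERIV_soft_clip[OF \<open>\<epsilon> > 0\<close>] Cb_smooth_has_partial[OF F that], of x] by simp
  then have p: "partial_deriv i (\<lambda>x. soft_clip \<epsilon> (F x)) x = soft_clip' \<epsilon> (F x) * partial_deriv i F x"
    if "i < k" for i x using that by (intro partial_deriv_eqI) auto
  then show "i < k \<Longrightarrow> partial_deriv i (\<lambda>x. soft_clip \<epsilon> (F x)) x = soft_clip' \<epsilon> (F x) * partial_deriv i F x" .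
  have aff: "(\<lambda>x. c * F x + d) \<in> Cb_smooth k" for c d
    by (intro Cb_smooth_add Cb_smooth_scale F Cb_smooth_const)
  have lg: "(\<lambda>x. logistic (c * F x + d)) \<in> Cb_smooth k" for c d
    by (rule Cb_smooth_logistic[OF Cb_smooth_dep[OF aff[of c d]] Cb_smooth_continuous[OF aff]
         Cb_smooth_differentiable[OF aff] Cb_smooth_partial[OF aff]])
  have "(\<lambda>x. logistic (1/\<epsilon> * F x + 0) + (-1) * logistic (1/\<epsilon> * F x + (-1/\<epsilon>))) \<in> Cb_smooth k"
    by (intro Cb_smooth_add Cb_smooth_scale lg)
  also have "(\<lambda>x. logistic (1/\<epsilon> * F x + 0) + (-1) * logistic (1/\<epsilon> * F x + (-1/\<epsilon>))) = (\<lambda>x. soft_clip' \<epsilon> (F x))"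
    by (simp add: soft_clip'_def diff_divide_distrib)
  finally have s': "(\<lambda>x. soft_clip' \<epsilon> (F x)) \<in> Cb_smooth k" .
  show "(\<lambda>x. soft_clip \<epsilon> (F x)) \<in> Cb_smooth k"
  proof (subst Cb_smooth_iff, intro conjI allI impI)
    show "soft_clip \<epsilon> (F x) = soft_clip \<epsilon> (F y)" if "\<forall>i<k. x i = y i" for x y
      using Cb_smooth_dep[OF F, of x y] that by simp
    show "bounded (range (\<lambda>x. soft_clip \<epsilon> (F x)))"
      using soft_clip_nonneg[OF \<open>\<epsilon> > 0\<close>] soft_clip_le_1[OF \<open>\<epsilon> > 0\<close>]
      by (intro boundedI[where B = 1]) auto
    show "continuous_on UNIV (\<lambda>x. soft_clip \<epsilon> (F x))"
      by (rule continuous_on_compose2[OF DERIV_continuous_on Cb_smooth_continuous[OF F]])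
        (rule has_field_derivative_at_within[OF DERIV_soft_clip[OF \<open>\<epsilon> > 0\<close>]], rule subset_UNIV)
    fix i assume "i < k"
    then show "(\<lambda>t. soft_clip \<epsilon> (F (x(i := t)))) differentiable at (x i)" for x
      using D real_differentiable_def by blast
    have "partial_deriv i (\<lambda>x. soft_clip \<epsilon> (F x)) = (\<lambda>x. soft_clip' \<epsilon> (F x) * partial_deriv i F x)"
      using p \<open>i < k\<close> by blast
    then show "partial_deriv i (\<lambda>x. soft_clip \<epsilon> (F x)) \<in> Cb_smooth k"
      using \<open>i < k\<close> by (simp add: Cb_smooth_mult s' Cb_smooth_partial[OF F])
  qed
qed

section \<open>Closable forms\<close>

subsection \<open>Non-negative symmetric bilinear forms\<close>

text \<open>The squares of sums and differences in a form, and the squared \<open>L\<^sup>2\<close>-distance.\<close>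

abbreviation sqsum :: "'a form \<Rightarrow> ('a \<Rightarrow> real) \<Rightarrow> ('a \<Rightarrow> real) \<Rightarrow> real" where
  "sqsum Q u v \<equiv> Q (\<lambda>x. u x + v x) (\<lambda>x. u x + v x)"

abbreviation sqdist :: "'a form \<Rightarrow> ('a \<Rightarrow> real) \<Rightarrow> ('a \<Rightarrow> real) \<Rightarrow> real" where
  "sqdist Q u v \<equiv> Q (\<lambda>x. u x - v x) (\<lambda>x. u x - v x)"

abbreviation L2dist :: "'a measure \<Rightarrow> ('a \<Rightarrow> real) \<Rightarrow> ('a \<Rightarrow> real) \<Rightarrow> real" where
  "L2dist M u v \<equiv> \<integral>x. (u x - v x)\<^sup>2 \<partial>M"

text \<open>
  The seminorm calculus of a form on a linear space of functions. It applies to the form on cylinder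
  functions, to its closure, and to the inner product of \<open>L\<^sup>2\<close>.
\<close>

locale nonneg_form =
  fixes V :: "('a \<Rightarrow> real) set" and Q :: "'a form"
  assumes zero: "(\<lambda>x. 0) \<in> V"
    and add: "u \<in> V \<Longrightarrow> v \<in> V \<Longrightarrow> (\<lambda>x. u x + v x) \<in> V"
    and scale: "u \<in> V \<Longrightarrow> (\<lambda>x. c * u x) \<in> V"
    and sym: "u \<in> V \<Longrightarrow> v \<in> V \<Longrightarrow> Q u v = Q v u"
    and form_add: "u \<in> V \<Longrightarrow> v \<in> V \<Longrightarrow> w \<in> V \<Longrightarrow> Q (\<lambda>x. u x + v x) w = Q u w + Q v w"
    and form_scale: "u \<in> V \<Longrightarrow> w \<in> V \<Longrightarrow> Q (\<lambda>x. c * u x) w = c * Q u w"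
    and nonneg: "u \<in> V \<Longrightarrow> 0 \<le> Q u u"
begin

lemma diff: "u \<in> V \<Longrightarrow> v \<in> V \<Longrightarrow> (\<lambda>x. u x - v x) \<in> V"
  using add[of u "\<lambda>x. -1 * v x"] scale[of v "-1"] by simp

lemma form_add_right: "u \<in> V \<Longrightarrow> v \<in> V \<Longrightarrow> w \<in> V \<Longrightarrow> Q w (\<lambda>x. u x + v x) = Q w u + Q w v"
  using sym form_add add by simp

lemma form_scale_right: "u \<in> V \<Longrightarrow> w \<in> V \<Longrightarrow> Q w (\<lambda>x. c * u x) = c * Q w u"
  using sym form_scale scale by simp

lemma form_square_add:
  "u \<in> V \<Longrightarrow> v \<in> V \<Longrightarrow> sqsum Q u v = Q u u + 2 * Q u v + Q v v"
  by (simp add: form_add form_add_right add sym[of v u])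

lemma form_square_scale: "u \<in> V \<Longrightarrow> Q (\<lambda>x. c * u x) (\<lambda>x. c * u x) = c\<^sup>2 * Q u u"
  by (simp add: form_scale form_scale_right scale power2_eq_square)

lemma form_square_diff:
  assumes "u \<in> V" "v \<in> V"
  shows "sqdist Q u v = Q u u - 2 * Q u v + Q v v"
proof -
  have "Q (\<lambda>x. u x + -1 * v x) (\<lambda>x. u x + -1 * v x) =
      Q u u + 2 * Q u (\<lambda>x. -1 * v x) + Q (\<lambda>x. -1 * v x) (\<lambda>x. -1 * v x)"
    by (intro form_square_add assms scale)
  also have "\<dots> = Q u u - 2 * Q u v + Q v v"
    unfolding form_scale_right[OF assms(2,1)] form_square_scale[OF assms(2)] by simp
  finally show ?thesis by simp
qed

lemma form_diff_self: "u \<in> V \<Longrightarrow> sqdist Q u u = 0"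
  using form_square_diff[of u u] by simp

lemma form_square_commute:
  assumes "u \<in> V" "v \<in> V"
  shows "sqdist Q u v = sqdist Q v u"
  using assms by (simp add: form_square_diff sym)

lemma parallelogram:
  "u \<in> V \<Longrightarrow> v \<in> V \<Longrightarrow> sqsum Q u v + sqdist Q u v =
     2 * Q u u + 2 * Q v v"
  by (simp add: form_square_add form_square_diff)

lemma form_add_le:
  "u \<in> V \<Longrightarrow> v \<in> V \<Longrightarrow> sqsum Q u v \<le> 2 * Q u u + 2 * Q v v"
  using parallelogram[of u v] nonneg[OF diff, of u v] by linarith

lemma form_diff_le:
  "u \<in> V \<Longrightarrow> v \<in> V \<Longrightarrow> sqdist Q u v \<le> 2 * Q u u + 2 * Q v v"
  using parallelogram[of u v] nonneg[OF add, of u v] by linarith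

lemma form_diff_le':
  assumes "u \<in> V" "v \<in> V" "w \<in> V"
  shows "sqdist Q u w \<le>
    2 * sqdist Q u v + 2 * sqdist Q v w"
  using form_add_le[OF diff diff, of u v v w] assms by simp

lemma Cauchy_Schwarz:
  assumes "u \<in> V" "v \<in> V"
  shows "(Q u v)\<^sup>2 \<le> Q u u * Q v v"
proof -
  have *: "0 \<le> Q u u + 2 * t * Q u v + t\<^sup>2 * Q v v" for t
    using nonneg[OF add[OF assms(1) scale[OF assms(2), of t]]] assms
    by (simp add: form_square_add form_square_scale scale form_scale_right)
  show ?thesis
  proof (cases "Q v v = 0")
    case True
    have "Q u v = 0"
    proof (rule ccontr)
      assume "Q u v \<noteq> 0"
      then have "2 * (-(Q u u + 1) / (2 * Q u v)) * Q u v = - (Q u u + 1)" by simp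
      then show False using *[of "-(Q u u + 1) / (2 * Q u v)"] True by simp
    qed
    then show ?thesis using True by simp
  next
    case False
    then have pos: "Q v v > 0" using nonneg[OF assms(2)] by simp
    have "0 \<le> Q u u + 2 * (- Q u v / Q v v) * Q u v + (- Q u v / Q v v)\<^sup>2 * Q v v" by (rule *)
    also have "\<dots> = Q u u - (Q u v)\<^sup>2 / Q v v" using pos by (simp add: field_simps power2_eq_square)
    finally show ?thesis using pos by (simp add: field_simps)
  qed
qed

lemma seminorm_add:
  assumes "u \<in> V" "v \<in> V"
  shows "sqrt (sqsum Q u v) \<le> sqrt (Q u u) + sqrt (Q v v)"
proof (rule real_le_lsqrt)
  have "\<bar>Q u v\<bar> \<le> sqrt (Q u u * Q v v)"
    using Cauchy_Schwarz[OF assms] by (intro real_le_rsqrt) simp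
  then have "Q u v \<le> sqrt (Q u u) * sqrt (Q v v)" by (simp add: real_sqrt_mult)
  then show "sqsum Q u v \<le> (sqrt (Q u u) + sqrt (Q v v))\<^sup>2"
    using assms nonneg by (simp add: form_square_add power2_sum)
qed (use assms nonneg in auto)

lemma seminorm_diff:
  assumes "u \<in> V" "v \<in> V"
  shows "\<bar>sqrt (Q u u) - sqrt (Q v v)\<bar> \<le> sqrt (sqdist Q u v)"
proof -
  have "sqrt (Q u u) \<le> sqrt (sqdist Q u v) + sqrt (Q v v)"
    using seminorm_add[OF diff assms(2), of u v] assms by simp
  moreover have "sqrt (Q v v) \<le> sqrt (sqdist Q v u) + sqrt (Q u u)"
    using seminorm_add[OF diff assms(1), of v u] assms by simp
  ultimately show ?thesis using form_square_commute[OF assms] by (simp add: abs_le_iff)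
qed

lemma form_CauchyD: "form_Cauchy Q s \<Longrightarrow> \<epsilon> > 0 \<Longrightarrow>
    \<exists>N. \<forall>i\<ge>N. \<forall>j\<ge>N. sqdist Q (s i) (s j) < \<epsilon>"
  unfolding form_Cauchy_def by blast

lemma form_Cauchy_add:
  assumes "\<And>n. s n \<in> V" "\<And>n. t n \<in> V" "form_Cauchy Q s" "form_Cauchy Q t"
  shows "form_Cauchy Q (\<lambda>n x. s n x + t n x)"
  unfolding form_Cauchy_def
proof (intro allI impI)
  fix \<epsilon> :: real assume "\<epsilon> > 0"
  then have "\<epsilon> / 4 > 0" by simp
  with assms(3,4) obtain N M where N: "\<forall>i\<ge>N. \<forall>j\<ge>N. sqdist Q (s i) (s j) < \<epsilon> / 4"
    and M: "\<forall>i\<ge>M. \<forall>j\<ge>M. sqdist Q (t i) (t j) < \<epsilon> / 4"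
    using form_CauchyD by meson
  show "\<exists>N. \<forall>i\<ge>N. \<forall>j\<ge>N. Q (\<lambda>x. (s i x + t i x) - (s j x + t j x)) (\<lambda>x. (s i x + t i x) - (s j x + t j x)) < \<epsilon>"
  proof (intro exI allI impI)
    fix i j assume ij: "i \<ge> max N M" "j \<ge> max N M"
    have "Q (\<lambda>x. (s i x - s j x) + (t i x - t j x)) (\<lambda>x. (s i x - s j x) + (t i x - t j x)) \<le>
      2 * sqdist Q (s i) (s j) + 2 * sqdist Q (t i) (t j)"
      by (intro form_add_le diff assms)
    also have "\<dots> < \<epsilon>" using N[rule_format, of i j] M[rule_format, of i j] ij by simp
    finally show "Q (\<lambda>x. (s i x + t i x) - (s j x + t j x)) (\<lambda>x. (s i x + t i x) - (s j x + t j x)) < \<epsilon>"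
      by (simp add: add_diff_add)
  qed
qed

lemma form_Cauchy_scale:
  assumes "\<And>n. s n \<in> V" "form_Cauchy Q s"
  shows "form_Cauchy Q (\<lambda>n x. c * s n x)"
  unfolding form_Cauchy_def
proof (intro allI impI)
  fix \<epsilon> :: real assume "\<epsilon> > 0"
  then have "\<epsilon> / (c\<^sup>2 + 1) > 0" by (simp add: add_nonneg_pos)
  then obtain N where N: "\<forall>i\<ge>N. \<forall>j\<ge>N. sqdist Q (s i) (s j) < \<epsilon> / (c\<^sup>2 + 1)"
    using form_CauchyD[OF assms(2)] by meson
  show "\<exists>N. \<forall>i\<ge>N. \<forall>j\<ge>N. Q (\<lambda>x. c * s i x - c * s j x) (\<lambda>x. c * s i x - c * s j x) < \<epsilon>"
  proof (intro exI allI impI)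
    fix i j assume ij: "i \<ge> N" "j \<ge> N"
    have d: "(\<lambda>x. s i x - s j x) \<in> V" by (intro diff assms)
    have "c\<^sup>2 * sqdist Q (s i) (s j) \<le>
      (c\<^sup>2 + 1) * sqdist Q (s i) (s j)"
      using nonneg[OF d] by (simp add: distrib_right)
    also have "\<dots> < (c\<^sup>2 + 1) * (\<epsilon> / (c\<^sup>2 + 1))"
      using N[rule_format, OF ij] by (intro mult_strict_left_mono) (auto simp: add_nonneg_pos)
    also have "\<dots> = \<epsilon>" using sum_power2_gt_zero_iff[of c 1] by simp
    finally show "Q (\<lambda>x. c * s i x - c * s j x) (\<lambda>x. c * s i x - c * s j x) < \<epsilon>"
      using form_square_scale[OF d, of c] by (simp add: right_diff_distrib)
  qed
qed

lemma form_Cauchy_diff: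
  assumes "\<And>n. s n \<in> V" "\<And>n. t n \<in> V" "form_Cauchy Q s" "form_Cauchy Q t"
  shows "form_Cauchy Q (\<lambda>n x. s n x - t n x)"
proof -
  have "form_Cauchy Q (\<lambda>n x. s n x + -1 * t n x)"
    by (intro form_Cauchy_add form_Cauchy_scale assms scale)
  then show ?thesis by simp
qed

lemma form_Cauchy_const: "u \<in> V \<Longrightarrow> form_Cauchy Q (\<lambda>n. u)"
  unfolding form_Cauchy_def by (simp only: form_diff_self) simp

lemma form_Cauchy_square_convergent:
  assumes V: "\<And>n. s n \<in> V" and C: "form_Cauchy Q s"
  shows "convergent (\<lambda>n. Q (s n) (s n))"
proof -
  have "Cauchy (\<lambda>n. sqrt (Q (s n) (s n)))"
  proof (rule metric_CauchyI)
    fix e :: real assume "e > 0"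
    then have "e\<^sup>2 > 0" by simp
    then obtain N where N: "\<forall>i\<ge>N. \<forall>j\<ge>N. sqdist Q (s i) (s j) < e\<^sup>2"
      using form_CauchyD[OF C] by meson
    show "\<exists>M. \<forall>m\<ge>M. \<forall>n\<ge>M. dist (sqrt (Q (s m) (s m))) (sqrt (Q (s n) (s n))) < e"
    proof (intro exI allI impI)
      fix m n assume mn: "m \<ge> N" "n \<ge> N"
      have "sqrt (sqdist Q (s m) (s n)) < e"
        using N[rule_format, OF mn] \<open>e > 0\<close> by (intro real_less_lsqrt) auto
      then show "dist (sqrt (Q (s m) (s m))) (sqrt (Q (s n) (s n))) < e"
        using seminorm_diff[OF V V, of m n] by (simp add: dist_real_def)
    qed
  qed
  then obtain l where "(\<lambda>n. sqrt (Q (s n) (s n))) \<longlonglongrightarrow> l"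
    using real_Cauchy_convergent convergentD by blast
  then have "(\<lambda>n. (sqrt (Q (s n) (s n)))\<^sup>2) \<longlonglongrightarrow> l\<^sup>2" by (intro tendsto_intros)
  then show ?thesis using nonneg[OF V] by (simp add: convergent_def) blast
qed

lemma polarization:
  assumes "u \<in> V" "v \<in> V"
  shows "Q u v = (sqsum Q u v - sqdist Q u v) / 4"
  using assms by (simp add: form_square_add form_square_diff)

lemma form_Cauchy_convergent:
  assumes "\<And>n. s n \<in> V" "\<And>n. t n \<in> V" "form_Cauchy Q s" "form_Cauchy Q t"
  shows "convergent (\<lambda>n. Q (s n) (t n))"
proof -
  obtain a b where "(\<lambda>n. sqsum Q (s n) (t n)) \<longlonglongrightarrow> a"
    "(\<lambda>n. sqdist Q (s n) (t n)) \<longlonglongrightarrow> b"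
    using form_Cauchy_square_convergent[OF add[OF assms(1,2)] form_Cauchy_add[OF assms]]
      form_Cauchy_square_convergent[OF diff[OF assms(1,2)] form_Cauchy_diff[OF assms]]
    by (auto simp: convergent_def)
  then have "(\<lambda>n. (sqsum Q (s n) (t n) - sqdist Q (s n) (t n)) / 4)
    \<longlonglongrightarrow> (a - b) / 4" by (intro tendsto_intros) auto
  then show ?thesis unfolding convergent_def polarization[OF assms(1,2)] by blast
qed

lemma square_tendsto_cong:
  assumes "\<And>n. s n \<in> V" "\<And>n. s' n \<in> V" "(\<lambda>n. Q (s n) (s n)) \<longlonglongrightarrow> a"
    and "(\<lambda>n. sqdist Q (s n) (s' n)) \<longlonglongrightarrow> 0"
  shows "(\<lambda>n. Q (s' n) (s' n)) \<longlonglongrightarrow> a"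
proof -
  have "(\<lambda>n. sqrt (sqdist Q (s n) (s' n))) \<longlonglongrightarrow> sqrt 0"
    by (intro tendsto_intros assms)
  then have "(\<lambda>n. sqrt (Q (s n) (s n)) - sqrt (Q (s' n) (s' n))) \<longlonglongrightarrow> 0"
    by (rule Lim_null_comparison[rotated, OF tendsto_eq_rhs])
      (use seminorm_diff[OF assms(1,2)] in auto)
  from tendsto_diff[OF tendsto_real_sqrt[OF assms(3)] this]
  have "(\<lambda>n. sqrt (Q (s' n) (s' n))) \<longlonglongrightarrow> sqrt a" by simp
  then have "(\<lambda>n. (sqrt (Q (s' n) (s' n)))\<^sup>2) \<longlonglongrightarrow> (sqrt a)\<^sup>2" by (rule tendsto_power)
  moreover have "a \<ge> 0" by (rule LIMSEQ_le_const[OF assms(3)]) (use nonneg assms in auto)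
  ultimately show ?thesis by (simp only: real_sqrt_pow2 nonneg[OF assms(2)])
qed

text \<open>The limit of \<open>Q (s n) (t n)\<close> does not change when the sequences are changed by null sequences.\<close>

lemma tendsto_cong_form:
  assumes V: "\<And>n. s n \<in> V" "\<And>n. s' n \<in> V" "\<And>n. t n \<in> V" "\<And>n. t' n \<in> V"
    and C: "form_Cauchy Q s" "form_Cauchy Q t"
    and s: "(\<lambda>n. sqdist Q (s n) (s' n)) \<longlonglongrightarrow> 0"
    and t: "(\<lambda>n. sqdist Q (t n) (t' n)) \<longlonglongrightarrow> 0"
    and lim: "(\<lambda>n. Q (s n) (t n)) \<longlonglongrightarrow> c"
  shows "(\<lambda>n. Q (s' n) (t' n)) \<longlonglongrightarrow> c"
proof -
  obtain a b where a: "(\<lambda>n. sqsum Q (s n) (t n)) \<longlonglongrightarrow> a"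
    and b: "(\<lambda>n. sqdist Q (s n) (t n)) \<longlonglongrightarrow> b"
    using form_Cauchy_square_convergent[OF add[OF V(1,3)] form_Cauchy_add[OF V(1,3) C]]
      form_Cauchy_square_convergent[OF diff[OF V(1,3)] form_Cauchy_diff[OF V(1,3) C]]
    by (auto simp: convergent_def)
  have "(\<lambda>n. 2 * sqdist Q (s n) (s' n) + 2 * sqdist Q (t n) (t' n)) \<longlonglongrightarrow> 2 * 0 + 2 * 0"
    by (intro tendsto_intros s t)
  then have st: "(\<lambda>n. 2 * sqdist Q (s n) (s' n) + 2 * sqdist Q (t n) (t' n)) \<longlonglongrightarrow> 0"
    by simp
  have "(\<lambda>n. Q (\<lambda>x. (s n x - s' n x) + (t n x - t' n x)) (\<lambda>x. (s n x - s' n x) + (t n x - t' n x))) \<longlonglongrightarrow> 0"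
    by (rule tendsto_sandwich[OF _ _ tendsto_const st])
      (intro always_eventually allI form_add_le nonneg add diff V)+
  then have "(\<lambda>n. Q (\<lambda>x. (s n x + t n x) - (s' n x + t' n x)) (\<lambda>x. (s n x + t n x) - (s' n x + t' n x))) \<longlonglongrightarrow> 0"
    by (simp add: add_diff_add)
  from square_tendsto_cong[OF add[OF V(1,3)] add[OF V(2,4)] a this]
  have a': "(\<lambda>n. sqsum Q (s' n) (t' n)) \<longlonglongrightarrow> a" .
  have "(\<lambda>n. Q (\<lambda>x. (s n x - s' n x) - (t n x - t' n x)) (\<lambda>x. (s n x - s' n x) - (t n x - t' n x))) \<longlonglongrightarrow> 0"
    by (rule tendsto_sandwich[OF _ _ tendsto_const st])
      (intro always_eventually allI form_diff_le nonneg add diff V)+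
  moreover have "(\<lambda>x. (s n x - s' n x) - (t n x - t' n x)) = (\<lambda>x. (s n x - t n x) - (s' n x - t' n x))" for n
    by (auto simp: algebra_simps)
  ultimately have "(\<lambda>n. Q (\<lambda>x. (s n x - t n x) - (s' n x - t' n x)) (\<lambda>x. (s n x - t n x) - (s' n x - t' n x))) \<longlonglongrightarrow> 0"
    by simp
  from square_tendsto_cong[OF diff[OF V(1,3)] diff[OF V(2,4)] b this]
  have b': "(\<lambda>n. sqdist Q (s' n) (t' n)) \<longlonglongrightarrow> b" .
  have "(\<lambda>n. (sqsum Q (s n) (t n) - sqdist Q (s n) (t n)) / 4) \<longlonglongrightarrow> (a - b) / 4"
    by (intro tendsto_intros a b) simp
  from LIMSEQ_unique[OF lim[unfolded polarization[OF V(1,3)]] this] have c: "c = (a - b) / 4" .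
  show ?thesis unfolding polarization[OF V(2,4)] c by (intro tendsto_intros a' b') simp
qed

end

subsection \<open>Square integrable functions\<close>

lemma sq_integrableD:
  "u \<in> sq_integrable \<nu> \<Longrightarrow> u \<in> borel_measurable \<nu>" "u \<in> sq_integrable \<nu> \<Longrightarrow> integrable \<nu> (\<lambda>x. (u x)\<^sup>2)"
  by (auto simp: sq_integrable_def)

lemma sq_integrable_mult:
  assumes "u \<in> sq_integrable \<nu>" "v \<in> sq_integrable \<nu>"
  shows "integrable \<nu> (\<lambda>x. u x * v x)"
proof (rule Bochner_Integration.integrable_bound)
  note [measurable] = assms[THEN sq_integrableD(1)]
  show "integrable \<nu> (\<lambda>x. (u x)\<^sup>2 + (v x)\<^sup>2)" using assms by (auto simp: sq_integrable_def)
  show "(\<lambda>x. u x * v x) \<in> borel_measurable \<nu>" by measurable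
  have "\<bar>a * b\<bar> \<le> a\<^sup>2 + b\<^sup>2" for a b :: real
    proof -
    have "2 * \<bar>a * b\<bar> \<le> a\<^sup>2 + b\<^sup>2" using sum_squares_bound[of "\<bar>a\<bar>" "\<bar>b\<bar>"] by (simp add: abs_mult)
    moreover have "0 \<le> \<bar>a * b\<bar>" by simp
    ultimately show ?thesis by linarith
  qed
  then show "AE x in \<nu>. norm (u x * v x) \<le> norm ((u x)\<^sup>2 + (v x)\<^sup>2)" by simp
qed

lemma sq_integrable_nonneg_form: "nonneg_form (sq_integrable \<nu>) (\<lambda>u v. \<integral>x. u x * v x \<partial>\<nu>)"
proof
  fix u v :: "'a \<Rightarrow> real" assume u: "u \<in> sq_integrable \<nu>"
  note [measurable] = sq_integrableD(1)[OF u]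
  show "(\<lambda>x. c * u x) \<in> sq_integrable \<nu>" for c
    using u by (auto simp: sq_integrable_def power_mult_distrib)
  assume v: "v \<in> sq_integrable \<nu>"
  note [measurable] = sq_integrableD(1)[OF v]
  show "(\<lambda>x. u x + v x) \<in> sq_integrable \<nu>"
    using sq_integrableD(2)[OF u] sq_integrableD(2)[OF v] sq_integrable_mult[OF u v]
    by (auto simp: sq_integrable_def power2_sum mult.assoc)
next
  fix u v w :: "'a \<Rightarrow> real" and c :: real
  assume uw: "u \<in> sq_integrable \<nu>" "w \<in> sq_integrable \<nu>"
  show "(\<integral>x. c * u x * w x \<partial>\<nu>) = c * (\<integral>x. u x * w x \<partial>\<nu>)" by (simp add: mult.assoc)
  show "(\<integral>x. u x * w x \<partial>\<nu>) = (\<integral>x. w x * u x \<partial>\<nu>)" by (simp add: mult.commute)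
  assume "v \<in> sq_integrable \<nu>"
  with uw show "(\<integral>x. (u x + v x) * w x \<partial>\<nu>) = (\<integral>x. u x * w x \<partial>\<nu>) + (\<integral>x. v x * w x \<partial>\<nu>)"
    by (simp add: distrib_right sq_integrable_mult)
qed (auto simp: sq_integrable_def)

lemma sq_integrable_cong:
  "u \<in> sq_integrable \<nu> \<Longrightarrow> v \<in> borel_measurable \<nu> \<Longrightarrow> (AE x in \<nu>. u x = v x) \<Longrightarrow> v \<in> sq_integrable \<nu>"
  unfolding sq_integrable_def
  by (auto intro: integrable_cong_AE_imp[of _ "\<lambda>x. (u x)\<^sup>2"])

lemma (in finite_measure) bounded_sq_integrable:
  assumes "u \<in> borel_measurable M" "AE x in M. \<bar>u x\<bar> \<le> B"
  shows "u \<in> sq_integrable M"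
proof -
  have "integrable M (\<lambda>x. (u x)\<^sup>2)"
  proof (rule integrable_const_bound[where B = "B\<^sup>2"])
    show "AE x in M. norm ((u x)\<^sup>2) \<le> B\<^sup>2" using assms(2) 
    proof eventually_elim
      case (elim x)
      then have "\<bar>u x\<bar>\<^sup>2 \<le> B\<^sup>2" by (intro power_mono) auto
      then show ?case by simp
    qed
  qed (use assms(1) in measurable)
  then show ?thesis using assms by (simp add: sq_integrable_def)
qed

context prob_space
begin

interpretation L2: nonneg_form "sq_integrable M" "\<lambda>u v. \<integral>x. u x * v x \<partial>M"
  by (rule sq_integrable_nonneg_form)

lemma integral_abs_le_sqrt:
  assumes "u \<in> sq_integrable M"
  shows "integrable M u" "(\<integral>x. \<bar>u x\<bar> \<partial>M) \<le> sqrt (\<integral>x. (u x)\<^sup>2 \<partial>M)"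
proof -
  have one: "(\<lambda>x. 1) \<in> sq_integrable M" by (auto simp: sq_integrable_def)
  show "integrable M u" using sq_integrable_mult[OF assms one] by simp
  have abs: "(\<lambda>x. \<bar>u x\<bar>) \<in> sq_integrable M" using assms by (auto simp: sq_integrable_def)
  have "(\<integral>x. \<bar>u x\<bar> \<partial>M)\<^sup>2 \<le> (\<integral>x. (u x)\<^sup>2 \<partial>M)"
    using L2.Cauchy_Schwarz[OF abs one] by (simp add: prob_space power2_eq_square)
  then show "(\<integral>x. \<bar>u x\<bar> \<partial>M) \<le> sqrt (\<integral>x. (u x)\<^sup>2 \<partial>M)" by (intro real_le_rsqrt)
qed

text \<open>Completeness of \<open>L\<^sup>2\<close> follows from that of \<open>L\<^sup>1\<close> and Fatou's lemma.\<close>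

lemma L2_complete:
  assumes s: "\<And>n. s n \<in> sq_integrable M"
    and C: "form_Cauchy (\<lambda>u v. \<integral>x. u x * v x \<partial>M) s"
  shows "\<exists>u\<in>sq_integrable M. (\<lambda>n. L2dist M (s n) u) \<longlonglongrightarrow> 0"
proof -
  note [measurable] = sq_integrableD(1)[OF s]
  have C': "\<exists>N. \<forall>i\<ge>N. \<forall>j\<ge>N. L2dist M (s i) (s j) < \<epsilon>" if "\<epsilon> > 0" for \<epsilon>
    using C that by (simp add: form_Cauchy_def power2_eq_square)
  have "\<exists>N. \<forall>i\<ge>N. \<forall>j\<ge>N. (\<integral>x. norm (s i x - s j x) \<partial>M) < e" if "e > 0" for e
  proof -
    have "e\<^sup>2 > 0" using that by simp
    then obtain N where N: "\<And>i j. i \<ge> N \<Longrightarrow> j \<ge> N \<Longrightarrow> L2dist M (s i) (s j) < e\<^sup>2" using C' by meson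
    have "(\<integral>x. norm (s i x - s j x) \<partial>M) < e" if "i \<ge> N" "j \<ge> N" for i j
    proof -
      have "(\<integral>x. \<bar>s i x - s j x\<bar> \<partial>M) \<le> sqrt (L2dist M (s i) (s j))"
        by (intro integral_abs_le_sqrt L2.diff s)
      also have "\<dots> < e" using N[OF that] \<open>e > 0\<close> by (intro real_less_lsqrt) auto
      finally show ?thesis by simp
    qed
    then show ?thesis by blast
  qed
  then obtain r where r: "strict_mono r" and AEc: "AE x in M. Cauchy (\<lambda>i. s (r i) x)"
    using cauchy_L1_AE_cauchy_subseq[of M s] integral_abs_le_sqrt(1)[OF s] by metis
  define u where "u x = lim (\<lambda>i. s (r i) x)" for x
  have [measurable]: "u \<in> borel_measurable M" unfolding u_def by measurable
  have lim: "AE x in M. (\<lambda>i. s (r i) x) \<longlonglongrightarrow> u x"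
    using AEc by eventually_elim (simp add: u_def convergent_LIMSEQ_iff[symmetric] real_Cauchy_convergent)
  have Fatou: "(\<integral>\<^sup>+x. ennreal ((s n x - u x)\<^sup>2) \<partial>M) \<le> ennreal \<epsilon>"
    if N: "\<And>i j. i \<ge> N \<Longrightarrow> j \<ge> N \<Longrightarrow> L2dist M (s i) (s j) < \<epsilon>" and n: "n \<ge> N" for n N \<epsilon>
  proof -
    have "(\<integral>\<^sup>+x. ennreal ((s n x - u x)\<^sup>2) \<partial>M) =
      (\<integral>\<^sup>+x. liminf (\<lambda>i. ennreal ((s n x - s (r i) x)\<^sup>2)) \<partial>M)"
    proof (rule nn_integral_cong_AE)
      show "AE x in M. ennreal ((s n x - u x)\<^sup>2) = liminf (\<lambda>i. ennreal ((s n x - s (r i) x)\<^sup>2))"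
        using lim
      proof eventually_elim
        case (elim x)
        then have "(\<lambda>i. ennreal ((s n x - s (r i) x)\<^sup>2)) \<longlonglongrightarrow> ennreal ((s n x - u x)\<^sup>2)"
          by (intro tendsto_ennrealI tendsto_intros)
        from lim_imp_Liminf[OF _ this] show ?case by simp
      qed
    qed
    also have "\<dots> \<le> liminf (\<lambda>i. \<integral>\<^sup>+x. ennreal ((s n x - s (r i) x)\<^sup>2) \<partial>M)"
      by (rule nn_integral_liminf) measurable
    also have "\<dots> \<le> liminf (\<lambda>i. ennreal \<epsilon>)"
    proof (rule Liminf_mono, unfold eventually_sequentially, intro exI allI impI)
      fix i assume "i \<ge> N"
      then have "r i \<ge> N" using seq_suble[OF r, of i] by simp
      have "(\<integral>\<^sup>+x. ennreal ((s n x - s (r i) x)\<^sup>2) \<partial>M) = ennreal (\<integral>x. (s n x - s (r i) x)\<^sup>2 \<partial>M)"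
        by (intro nn_integral_eq_integral sq_integrableD(2) L2.diff s) simp
      then show "(\<integral>\<^sup>+x. ennreal ((s n x - s (r i) x)\<^sup>2) \<partial>M) \<le> ennreal \<epsilon>"
        using N[OF n \<open>r i \<ge> N\<close>] by (simp add: ennreal_leI less_imp_le)
    qed
    also have "\<dots> = ennreal \<epsilon>" by (simp add: Liminf_const)
    finally show ?thesis .
  qed
  have su: "(\<lambda>x. s N x - u x) \<in> sq_integrable M"
    if "\<And>i j. i \<ge> N \<Longrightarrow> j \<ge> N \<Longrightarrow> L2dist M (s i) (s j) < \<epsilon>" for N \<epsilon>
  proof -
    have "integrable M (\<lambda>x. (s N x - u x)\<^sup>2)"
    proof (rule integrableI_nonneg)
      show "(\<integral>\<^sup>+x. ennreal ((s N x - u x)\<^sup>2) \<partial>M) < \<infinity>"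
        by (rule order.strict_trans1[OF Fatou[OF that order_refl]]) simp_all
    qed auto
    then show ?thesis by (simp add: sq_integrable_def)
  qed
  obtain N where "\<And>i j. i \<ge> N \<Longrightarrow> j \<ge> N \<Longrightarrow> L2dist M (s i) (s j) < 1"
    using C'[of 1] by auto
  then have "(\<lambda>x. s N x - u x) \<in> sq_integrable M" by (rule su)
  from L2.diff[OF s[of N] this] have u: "u \<in> sq_integrable M" by simp
  have "(\<lambda>n. L2dist M (s n) u) \<longlonglongrightarrow> 0"
  proof (rule LIMSEQ_I)
    fix e :: real assume "e > 0"
    then have e: "e / 2 > 0" by simp
    then obtain N where N: "\<And>i j. i \<ge> N \<Longrightarrow> j \<ge> N \<Longrightarrow> L2dist M (s i) (s j) < e / 2" using C' by meson
    have "L2dist M (s n) u \<le> e / 2" if "n \<ge> N" for n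
    proof -
      have "ennreal (L2dist M (s n) u) = (\<integral>\<^sup>+x. ennreal ((s n x - u x)\<^sup>2) \<partial>M)"
        by (intro nn_integral_eq_integral[symmetric] sq_integrableD(2) L2.diff s u) simp
      also have "\<dots> \<le> ennreal (e / 2)" by (rule Fatou[OF N that])
      finally show ?thesis using e by (simp add: ennreal_le_iff)
    qed
    then show "\<exists>N. \<forall>n\<ge>N. norm (L2dist M (s n) u - 0) < e"
      using \<open>e > 0\<close> by (intro exI[of _ N] allI impI) (force intro: le_less_trans)
  qed
  then show ?thesis using u by blast
qed

end

subsection \<open>Closures\<close>

text \<open>
  A closable form on a dense space \<open>V\<close> of functions on a probability space. The last condition is
  the Markov property in its approximate form: \<open>V\<close> is only required to contain functions close to
  the unit contraction of \<open>u\<close>. That \<open>Q\<close> respects almost everywhere equality need not be required,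
  since it follows from closability along constant sequences.
\<close>

locale closable_form = prob_space M + nonneg_form V Q
  for M :: "'a measure" and V :: "('a \<Rightarrow> real) set" and Q :: "'a form" +
  assumes V_sub: "V \<subseteq> sq_integrable M"
    and closable: "form_closable M V Q"
    and dense: "L2_dense M V"
    and markov: "u \<in> V \<Longrightarrow> \<epsilon> > 0 \<Longrightarrow>
      \<exists>v\<in>V. Q v v \<le> Q u u \<and> (AE x in M. \<bar>v x - min 1 (max 0 (u x))\<bar> \<le> \<epsilon>)"
begin

interpretation L2: nonneg_form "sq_integrable M" "\<lambda>u v. \<integral>x. u x * v x \<partial>M"
  by (rule sq_integrable_nonneg_form)

abbreviation D where "D \<equiv> closure_dom M V Q"
abbreviation QD where "QD \<equiv> closure_form M V Q"
abbreviation approx where "approx \<equiv> form_approx M V Q"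

lemma VD: "u \<in> V \<Longrightarrow> u \<in> sq_integrable M" using V_sub by blast

lemma L2_add_le:
  assumes "u \<in> sq_integrable M" "v \<in> sq_integrable M"
  shows "(\<integral>x. (u x + v x)\<^sup>2 \<partial>M) \<le> 2 * (\<integral>x. (u x)\<^sup>2 \<partial>M) + 2 * (\<integral>x. (v x)\<^sup>2 \<partial>M)"
  using L2.form_add_le[OF assms] by (simp add: power2_eq_square)

lemma approxD: "approx s u \<Longrightarrow> s n \<in> V" "approx s u \<Longrightarrow> form_Cauchy Q s"
  "approx s u \<Longrightarrow> (\<lambda>n. L2dist M (s n) u) \<longlonglongrightarrow> 0"
  by (auto simp: form_approx_def)

lemma approx_cong:
  assumes "approx s u" "AE x in M. u x = v x" "u \<in> sq_integrable M" "v \<in> borel_measurable M"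
  shows "approx s v"
proof -
  note [measurable] = sq_integrableD(1)[OF VD[OF approxD(1)[OF assms(1)]]] sq_integrableD(1)[OF assms(3)] assms(4)
  have "L2dist M (s n) u = L2dist M (s n) v" for n
    by (rule integral_cong_AE) (use assms(2) in auto)
  then show ?thesis using assms(1) by (simp add: form_approx_def)
qed

lemma L2_tendsto_add:
  assumes "\<And>n. s n \<in> sq_integrable M" "\<And>n. t n \<in> sq_integrable M"
    "(\<lambda>n. \<integral>x. (s n x)\<^sup>2 \<partial>M) \<longlonglongrightarrow> 0" "(\<lambda>n. \<integral>x. (t n x)\<^sup>2 \<partial>M) \<longlonglongrightarrow> 0"
  shows "(\<lambda>n. \<integral>x. (s n x + t n x)\<^sup>2 \<partial>M) \<longlonglongrightarrow> 0"
proof (rule tendsto_sandwich[OF _ _ tendsto_const])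
  show "(\<lambda>n. 2 * (\<integral>x. (s n x)\<^sup>2 \<partial>M) + 2 * (\<integral>x. (t n x)\<^sup>2 \<partial>M)) \<longlonglongrightarrow> 0"
    using tendsto_add[OF tendsto_mult[OF tendsto_const[of 2] assms(3)] tendsto_mult[OF tendsto_const[of 2] assms(4)]] by simp
qed (auto intro!: always_eventually L2_add_le assms)

lemma approx_add:
  assumes "approx s u" "approx t v" "u \<in> sq_integrable M" "v \<in> sq_integrable M"
  shows "approx (\<lambda>n x. s n x + t n x) (\<lambda>x. u x + v x)"
proof -
  have "(\<lambda>n. \<integral>x. ((s n x - u x) + (t n x - v x))\<^sup>2 \<partial>M) \<longlonglongrightarrow> 0"
    using approxD[OF assms(1)] approxD[OF assms(2)]
    by (intro L2_tendsto_add L2.diff VD assms) auto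
  then show ?thesis
    using approxD[OF assms(1)] approxD[OF assms(2)]
    by (auto simp: form_approx_def add_diff_add intro!: add form_Cauchy_add)
qed

lemma approx_scale:
  assumes "approx s u"
  shows "approx (\<lambda>n x. c * s n x) (\<lambda>x. c * u x)"
proof -
  have "(\<lambda>n. c\<^sup>2 * L2dist M (s n) u) \<longlonglongrightarrow> c\<^sup>2 * 0"
    using approxD[OF assms] by (intro tendsto_intros) auto
  moreover have "(\<integral>x. (c * s n x - c * u x)\<^sup>2 \<partial>M) = c\<^sup>2 * L2dist M (s n) u" for n
    by (simp flip: right_diff_distrib add: power_mult_distrib)
  ultimately show ?thesis
    using approxD[OF assms] by (auto simp: form_approx_def intro!: scale form_Cauchy_scale)
qed

lemma approx_const: "u \<in> V \<Longrightarrow> approx (\<lambda>n. u) u"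
  by (simp add: form_approx_def form_Cauchy_const)

text \<open>This is where closability enters: it makes the closed form well defined.\<close>

lemma approx_unique:
  assumes "approx s u" "approx t u" "u \<in> sq_integrable M"
  shows "(\<lambda>n. sqdist Q (s n) (t n)) \<longlonglongrightarrow> 0"
proof -
  note * = approx_add[OF assms(1) approx_scale[OF assms(2), of "-1"] assms(3) L2.scale[OF assms(3)]]
  have "(\<lambda>n. Q (\<lambda>x. s n x + -1 * t n x) (\<lambda>x. s n x + -1 * t n x)) \<longlonglongrightarrow> 0"
    using closable approxD[OF *] unfolding form_closable_def by simp
  then show ?thesis by simp
qed

lemma closure_form_tendsto:
  assumes "approx s u" "approx t v" "u \<in> sq_integrable M" "v \<in> sq_integrable M"
  shows "(\<lambda>n. Q (s n) (t n)) \<longlonglongrightarrow> QD u v"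
proof -
  obtain c where c: "(\<lambda>n. Q (s n) (t n)) \<longlonglongrightarrow> c"
    using form_Cauchy_convergent[OF approxD(1)[OF assms(1)] approxD(1)[OF assms(2)]
        approxD(2)[OF assms(1)] approxD(2)[OF assms(2)]] by (auto simp: convergent_def)
  have all: "(\<lambda>n. Q (s' n) (t' n)) \<longlonglongrightarrow> c" if "approx s' u" "approx t' v" for s' t'
    by (rule tendsto_cong_form[OF approxD(1)[OF assms(1)] approxD(1)[OF that(1)] approxD(1)[OF assms(2)]
        approxD(1)[OF that(2)] approxD(2)[OF assms(1)] approxD(2)[OF assms(2)]
        approx_unique[OF assms(1) that(1) assms(3)] approx_unique[OF assms(2) that(2) assms(4)] c])
  have "QD u v = c"
    unfolding closure_form_def
  proof (rule the_equality)
    show "d = c" if "\<forall>s t. approx s u \<and> approx t v \<longrightarrow> (\<lambda>n. Q (s n) (t n)) \<longlonglongrightarrow> d" for d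
      using that assms(1,2) c LIMSEQ_unique by blast
  qed (use all in blast)
  then show ?thesis using c by simp
qed

lemma domD: "u \<in> D \<Longrightarrow> u \<in> sq_integrable M" "u \<in> D \<Longrightarrow> \<exists>s. approx s u"
  by (auto simp: closure_dom_def)

lemma domI: "u \<in> sq_integrable M \<Longrightarrow> approx s u \<Longrightarrow> u \<in> D"
  by (auto simp: closure_dom_def)

lemma V_dom: "u \<in> V \<Longrightarrow> u \<in> D"
  by (rule domI[OF VD approx_const])

lemma closure_form_extends:
  assumes "u \<in> V" "v \<in> V" shows "QD u v = Q u v"
  using closure_form_tendsto[OF approx_const[OF assms(1)] approx_const[OF assms(2)] VD[OF assms(1)] VD[OF assms(2)]]
  by (simp add: LIMSEQ_const_iff)

sublocale closure: nonneg_form D QD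
proof
  fix u v w :: "'a \<Rightarrow> real" and c :: real
  assume u: "u \<in> D"
  then obtain s where s: "approx s u" using domD by blast
  show "(\<lambda>x. c * u x) \<in> D" by (rule domI[OF L2.scale[OF domD(1)[OF u]] approx_scale[OF s]])
  show "0 \<le> QD u u"
    by (rule LIMSEQ_le_const[OF closure_form_tendsto[OF s s domD(1)[OF u] domD(1)[OF u]]])
      (use nonneg approxD(1)[OF s] in blast)
  assume w: "w \<in> D"
  then obtain r where r: "approx r w" using domD by blast
  have "(\<lambda>n. Q (\<lambda>x. c * s n x) (r n)) \<longlonglongrightarrow> c * QD u w"
    unfolding form_scale[OF approxD(1)[OF s] approxD(1)[OF r]]
    by (intro tendsto_intros closure_form_tendsto s r domD(1) u w)
  with closure_form_tendsto[OF approx_scale[OF s, of c] r L2.scale[OF domD(1)[OF u]] domD(1)[OF w]]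
  show "QD (\<lambda>x. c * u x) w = c * QD u w" by (rule LIMSEQ_unique)
  have "(\<lambda>n. Q (s n) (r n)) \<longlonglongrightarrow> QD w u"
    unfolding sym[OF approxD(1)[OF s] approxD(1)[OF r]]
    by (intro closure_form_tendsto s r domD(1) u w)
  with closure_form_tendsto[OF s r domD(1)[OF u] domD(1)[OF w]]
  show "QD u w = QD w u" by (rule LIMSEQ_unique)
  assume v: "v \<in> D"
  then obtain t where t: "approx t v" using domD by blast
  note st = approx_add[OF s t domD(1)[OF u] domD(1)[OF v]]
  note uv = L2.add[OF domD(1)[OF u] domD(1)[OF v]]
  show "(\<lambda>x. u x + v x) \<in> D" by (rule domI[OF uv st])
  have "(\<lambda>n. Q (\<lambda>x. s n x + t n x) (r n)) \<longlonglongrightarrow> QD u w + QD v w"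
    unfolding form_add[OF approxD(1)[OF s] approxD(1)[OF t] approxD(1)[OF r]]
    by (intro tendsto_intros closure_form_tendsto s t r domD(1) u v w)
  with closure_form_tendsto[OF st r uv domD(1)[OF w]]
  show "QD (\<lambda>x. u x + v x) w = QD u w + QD v w" by (rule LIMSEQ_unique)
qed (use V_dom zero in blast)

lemma approx_form_tendsto:
  assumes "approx s u" "u \<in> sq_integrable M"
  shows "(\<lambda>n. sqdist QD (s n) u) \<longlonglongrightarrow> 0"
proof (rule LIMSEQ_I)
  fix e :: real assume "e > 0"
  then have "e / 2 > 0" by simp
  then obtain N where N: "\<forall>i\<ge>N. \<forall>j\<ge>N. sqdist Q (s i) (s j) < e / 2"
    using form_CauchyD[OF approxD(2)[OF assms(1)]] by meson
  have u: "u \<in> D" by (rule domI[OF assms(2,1)])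
  show "\<exists>N. \<forall>n\<ge>N. norm (sqdist QD (s n) u - 0) < e"
  proof (intro exI allI impI)
    fix n assume n: "n \<ge> N"
    note sn = approxD(1)[OF assms(1)]
    have a: "approx (\<lambda>m x. s n x + -1 * s m x) (\<lambda>x. s n x + -1 * u x)"
      by (intro approx_add approx_scale approx_const sn assms VD L2.scale)
    have sq: "(\<lambda>x. s n x + -1 * u x) \<in> sq_integrable M" by (intro L2.add L2.scale VD sn assms)
    have "QD (\<lambda>x. s n x + -1 * u x) (\<lambda>x. s n x + -1 * u x) \<le> e / 2"
      by (rule LIMSEQ_le_const2[OF closure_form_tendsto[OF a a sq sq]])
        (use N n in \<open>auto intro!: exI[of _ N] less_imp_le\<close>)
    moreover have "0 \<le> sqdist QD (s n) u"
      by (intro closure.nonneg closure.diff u V_dom sn)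
    ultimately show "norm (sqdist QD (s n) u - 0) < e" using \<open>e > 0\<close> by simp
  qed
qed

lemma dom_approximable:
  assumes "u \<in> D" "\<epsilon> > 0"
  shows "\<exists>v\<in>V. sqdist QD u v < \<epsilon> \<and> L2dist M u v < \<epsilon>"
proof -
  obtain s where s: "approx s u" using domD assms by blast
  have "\<forall>\<^sub>F n in sequentially. sqdist QD (s n) u < \<epsilon>"
    by (rule order_tendstoD(2)[OF approx_form_tendsto[OF s domD(1)[OF assms(1)]] assms(2)])
  moreover have "\<forall>\<^sub>F n in sequentially. L2dist M (s n) u < \<epsilon>"
    by (rule order_tendstoD(2)[OF approxD(3)[OF s] assms(2)])
  ultimately have "\<exists>n. sqdist QD (s n) u < \<epsilon> \<and> L2dist M (s n) u < \<epsilon>"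
    by (intro eventually_happens'[OF sequentially_bot] eventually_conj)
  then obtain n where n: "sqdist QD (s n) u < \<epsilon>" "L2dist M (s n) u < \<epsilon>"
    by blast
  note sn = approxD(1)[OF s]
  have "sqdist QD u (s n) < \<epsilon>"
    using n(1) closure.form_square_commute[OF assms(1) V_dom[OF sn]] by simp
  moreover have "L2dist M u (s n) < \<epsilon>"
    using n(2) by (simp add: power2_commute[of "u _"])
  ultimately show ?thesis using sn by blast
qed

text \<open>
  The \<open>L\<^sup>2\<close>-limit of a Cauchy sequence in the domain is approximated by elements \<open>v n\<close> of \<open>V\<close> that are
  \<open>1 / (n + 1)\<close>-close to the sequence.
\<close>

lemma closure_complete:
  assumes s: "\<And>n. s n \<in> D" and C: "form_Cauchy (form1 M QD) s"
  shows "\<exists>u\<in>D. (\<lambda>n. sqdist (form1 M QD) (s n) u) \<longlonglongrightarrow> 0"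
proof -
  have f1: "form1 M QD u u = QD u u + (\<integral>x. (u x)\<^sup>2 \<partial>M)" for u
    by (simp add: form1_def power2_eq_square)
  have sq: "0 \<le> (\<integral>x. (u x)\<^sup>2 \<partial>M)" for u :: "'a \<Rightarrow> real" by simp
  have dij: "0 \<le> sqdist QD (s i) (s j)" for i j
    by (intro closure.nonneg closure.diff s)
  have "form_Cauchy (\<lambda>u v. \<integral>x. u x * v x \<partial>M) s"
    unfolding form_Cauchy_def
  proof (intro allI impI)
    fix e :: real assume "e > 0"
    then obtain N where "\<forall>i\<ge>N. \<forall>j\<ge>N. sqdist (form1 M QD) (s i) (s j) < e"
      using C unfolding form_Cauchy_def by blast
    then show "\<exists>N. \<forall>i\<ge>N. \<forall>j\<ge>N. (\<integral>x. (s i x - s j x) * (s i x - s j x) \<partial>M) < e"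
      unfolding form1_def using dij by (smt (verit))
  qed
  then obtain u where u: "u \<in> sq_integrable M" and lim: "(\<lambda>n. L2dist M (s n) u) \<longlonglongrightarrow> 0"
    using L2_complete domD(1)[OF s] by blast
  have "\<forall>n. \<exists>v. v \<in> V \<and> sqdist QD (s n) v < inverse (Suc n) \<and>
      L2dist M (s n) v < inverse (Suc n)"
    by (intro allI dom_approximable[OF s, unfolded Bex_def]) simp
  from choice[OF this] obtain v where v: "\<And>n. v n \<in> V" and vQ: "\<And>n. sqdist QD (s n) (v n) < inverse (Suc n)"
    and vL: "\<And>n. L2dist M (s n) (v n) < inverse (Suc n)" by blast
  note vD = V_dom[OF v]
  have vQ0: "(\<lambda>n. sqdist QD (s n) (v n)) \<longlonglongrightarrow> 0"
    by (rule tendsto_sandwich[OF _ _ tendsto_const LIMSEQ_inverse_real_of_nat])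
      (intro always_eventually allI closure.nonneg closure.diff s vD less_imp_le[OF vQ])+
  have vL0: "(\<lambda>n. L2dist M (s n) (v n)) \<longlonglongrightarrow> 0"
    by (rule tendsto_sandwich[OF _ _ tendsto_const LIMSEQ_inverse_real_of_nat])
      (use vL in \<open>auto intro!: always_eventually less_imp_le\<close>)
  have "(\<lambda>n. \<integral>x. ((s n x - u x) + - 1 * (s n x - v n x))\<^sup>2 \<partial>M) \<longlonglongrightarrow> 0"
    using vL0 by (intro L2_tendsto_add lim L2.scale L2.diff domD(1)[OF s] domD(1)[OF vD] u)
      (simp add: power2_commute[of "v _ _"])
  then have vu: "(\<lambda>n. L2dist M (v n) u) \<longlonglongrightarrow> 0" by simp
  have "form_Cauchy Q v"
    unfolding form_Cauchy_def
  proof (intro allI impI)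
    fix e :: real assume "e > 0"
    \<comment> \<open>the comparison of \<open>v i\<close> with \<open>v j\<close> through \<open>s i\<close> and \<open>s j\<close> has total weight \<open>2 + 4 + 4\<close>\<close>
    then have e10: "e / 10 > 0" by simp
    obtain N where N0: "\<forall>i\<ge>N. \<forall>j\<ge>N. sqdist (form1 M QD) (s i) (s j) < e / 10"
      using C e10 unfolding form_Cauchy_def by blast
    have N: "sqdist QD (s i) (s j) < e / 10" if "i \<ge> N" "j \<ge> N" for i j
    proof -
      have "sqdist QD (s i) (s j) \<le> sqdist (form1 M QD) (s i) (s j)"
        unfolding f1 by simp
      also have "\<dots> < e / 10" using N0 that by blast
      finally show ?thesis .
    qed
    obtain K where K: "sqdist QD (s i) (v i) < e / 10" if "i \<ge> K" for i
      using order_tendstoD(2)[OF vQ0 e10] unfolding eventually_sequentially by blast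
    show "\<exists>N. \<forall>i\<ge>N. \<forall>j\<ge>N. sqdist Q (v i) (v j) < e"
    proof (intro exI allI impI)
      fix i j assume ij: "i \<ge> max N K" "j \<ge> max N K"
      have "sqdist Q (v i) (v j) = sqdist QD (v i) (v j)"
        by (intro closure_form_extends[symmetric] diff v)
      also have "\<dots> \<le> 2 * sqdist QD (v i) (s i) + 2 * sqdist QD (s i) (v j)"
        by (rule closure.form_diff_le'[OF vD s vD])
      also have "\<dots> \<le> 2 * sqdist QD (v i) (s i) + 2 *
          (2 * sqdist QD (s i) (s j) + 2 * sqdist QD (s j) (v j))"
        by (intro add_mono mult_left_mono order_refl closure.form_diff_le' s vD) auto
      also have "sqdist QD (v i) (s i) = sqdist QD (s i) (v i)"
        by (rule closure.form_square_commute[OF vD s])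
      also have "2 * sqdist QD (s i) (v i) + 2 *
          (2 * sqdist QD (s i) (s j) + 2 * sqdist QD (s j) (v j))
          < 2 * (e / 10) + 2 * (2 * (e / 10) + 2 * (e / 10))"
        by (intro add_strict_mono mult_strict_left_mono K N) (use ij in auto)
      also have "\<dots> = e" by simp
      finally show "sqdist Q (v i) (v j) < e" .
    qed
  qed
  then have a: "approx v u" using v vu by (simp add: form_approx_def)
  have uD: "u \<in> D" by (rule domI[OF u a])
  have "(\<lambda>n. 2 * sqdist QD (s n) (v n) + 2 * sqdist QD (v n) u) \<longlonglongrightarrow> 2 * 0 + 2 * 0"
    by (intro tendsto_intros vQ0 approx_form_tendsto[OF a u])
  then have "(\<lambda>n. sqdist QD (s n) u) \<longlonglongrightarrow> 0"
    by (rule tendsto_sandwich[OF _ _ tendsto_const, rotated -1, OF tendsto_eq_rhs])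
      (simp_all add: closure.form_diff_le'[OF s vD uD] closure.nonneg[OF closure.diff[OF s uD]])
  from tendsto_add[OF this lim] show ?thesis using uD unfolding f1 by (intro bexI[of _ u]) simp
qed

text \<open>
  Lower semicontinuity of the closed form along sequences in \<open>V\<close>. Minimising the form over the
  convex sets of those \<open>v \<in> V\<close> that lie within \<open>1 / n\<close> of the limit gives, by the parallelogram
  identity, a Cauchy sequence; this replaces weak compactness.
\<close>

lemma closure_lsc:
  assumes v: "\<And>n. v n \<in> V" and w: "w \<in> sq_integrable M"
    and lim: "(\<lambda>n. L2dist M (v n) w) \<longlonglongrightarrow> 0"
    and le: "\<forall>\<^sub>F n in sequentially. Q (v n) (v n) \<le> c"
  shows "w \<in> D" "QD w w \<le> c"
proof -
  define C where "C n = {u\<in>V. L2dist M u w \<le> inverse (Suc n)}" for n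
  define d where "d n = (INF u\<in>C n. Q u u)" for n
  have C_anti: "C j \<subseteq> C i" if "i \<le> j" for i j
    using that by (auto simp: C_def intro: order_trans le_imp_inverse_le)
  have C_low: "\<exists>u\<in>C n. Q u u \<le> c" for n
  proof -
    have "\<forall>\<^sub>F k in sequentially. L2dist M (v k) w < inverse (Suc n)"
      by (rule order_tendstoD(2)[OF lim]) simp
    with le have "\<forall>\<^sub>F k in sequentially. Q (v k) (v k) \<le> c \<and> L2dist M (v k) w < inverse (Suc n)"
      by (rule eventually_conj)
    then have "\<exists>k. Q (v k) (v k) \<le> c \<and> L2dist M (v k) w < inverse (Suc n)"
      by (rule eventually_happens'[OF sequentially_bot])
    then show ?thesis unfolding C_def using v by (auto intro: less_imp_le)
  qed
  have ne: "C n \<noteq> {}" for n using C_low by blast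
  have bb: "bdd_below ((\<lambda>u. Q u u) ` C n)" for n
    by (rule bdd_belowI[of _ 0]) (auto simp: C_def nonneg)
  have d_le: "d n \<le> Q u u" if "u \<in> C n" for n u
    unfolding d_def by (rule cINF_lower[OF bb that])
  have d_c: "d n \<le> c" for n using C_low[of n] d_le order_trans by blast
  have "incseq d"
    unfolding incseq_def d_def using C_anti by (intro allI impI cINF_superset_mono ne bb) auto
  then have "convergent d" using incseq_convergent[of d c] d_c unfolding convergent_def by metis
  then have dC: "Cauchy d" by (rule convergent_Cauchy)
  have "\<exists>z\<in>C n. Q z z < d n + inverse (Suc n)" for n
    unfolding d_def cINF_less_iff[OF ne bb, symmetric] by simp
  then obtain z where z: "\<And>n. z n \<in> C n" and zd: "\<And>n. Q (z n) (z n) < d n + inverse (Suc n)" by metis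
  have zV: "z n \<in> V" for n using z by (simp add: C_def)
  have mid: "(\<lambda>x. 1/2 * (z i x + z j x)) \<in> C i" if "i \<le> j" for i j
  proof -
    have zi: "L2dist M (z i) w \<le> inverse (Suc i)" "L2dist M (z j) w \<le> inverse (Suc i)"
      using z[of i] z[of j] C_anti[OF that] by (auto simp: C_def)
    have "(\<integral>x. ((z i x - w x) + (z j x - w x))\<^sup>2 \<partial>M) \<le> 2 * L2dist M (z i) w + 2 * L2dist M (z j) w"
      by (intro L2_add_le L2.diff VD zV w)
    also have "\<dots> \<le> 4 * inverse (Suc i)" using zi by simp
    finally have "1/4 * (\<integral>x. ((z i x - w x) + (z j x - w x))\<^sup>2 \<partial>M) \<le> inverse (Suc i)" by simp
    also have "1/4 * (\<integral>x. ((z i x - w x) + (z j x - w x))\<^sup>2 \<partial>M) = (\<integral>x. (1/2 * (z i x + z j x) - w x)\<^sup>2 \<partial>M)"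
      by (subst integral_mult_right_zero[symmetric], rule Bochner_Integration.integral_cong)
        (auto simp: power2_eq_square algebra_simps)
    finally show ?thesis unfolding C_def using scale[OF add[OF zV zV], of "1/2" i j] by simp
  qed
  have est: "sqdist Q (z i) (z j) \<le> 2 * (d j - d i) + 2 * inverse (Suc i) + 2 * inverse (Suc j)"
    if "i \<le> j" for i j
  proof -
    have "d i \<le> Q (\<lambda>x. 1/2 * (z i x + z j x)) (\<lambda>x. 1/2 * (z i x + z j x))"
      by (rule d_le[OF mid[OF that]])
    also have "\<dots> = 1/4 * sqsum Q (z i) (z j)"
      by (subst form_square_scale) (auto intro!: add zV simp: power2_eq_square)
    finally have "d i \<le> 1/4 * sqsum Q (z i) (z j)" .
    moreover have "T \<le> 2 * (dj - di) + 2 * a + 2 * b"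
      if "di \<le> 1/4 * S" "S + T = 2 * qi + 2 * qj" "qi < di + a" "qj < dj + b" for S T di dj qi qj a b :: real
      using that by simp
    ultimately show ?thesis using parallelogram[OF zV zV, of i j] zd[of i] zd[of j] by blast
  qed
  have "form_Cauchy Q z"
    unfolding form_Cauchy_def
  proof (intro allI impI)
    fix e :: real assume "e > 0"
    then have e: "e / 6 > 0" by simp
    obtain N where N: "\<And>i j. i \<ge> N \<Longrightarrow> j \<ge> N \<Longrightarrow> \<bar>d i - d j\<bar> < e / 6"
      using metric_CauchyD[OF dC e] by (auto simp: dist_real_def)
    obtain K where K: "\<And>i. i \<ge> K \<Longrightarrow> inverse (Suc i) < e / 6"
      using order_tendstoD(2)[OF LIMSEQ_inverse_real_of_nat e] unfolding eventually_sequentially by blast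
    have *: "sqdist Q (z i) (z j) < e" if "i \<ge> max N K" "j \<ge> max N K" "i \<le> j" for i j
    proof -
      have "q < e" if "q \<le> 2 * (dj - di) + 2 * a + 2 * b" "\<bar>di - dj\<bar> < e / 6" "a < e / 6" "b < e / 6"
        for q di dj a b :: real
      proof -
        have "dj - di \<le> \<bar>di - dj\<bar>" using abs_ge_self[of "dj - di"] abs_minus_commute[of di dj] by simp
        also note that(2)
        finally show ?thesis using that by simp
      qed
      then show ?thesis using est[OF that(3)] N[of i j] K[of i] K[of j] that by (meson max.boundedE)
    qed
    show "\<exists>N. \<forall>i\<ge>N. \<forall>j\<ge>N. sqdist Q (z i) (z j) < e"
    proof (intro exI allI impI)
      fix i j assume "i \<ge> max N K" "j \<ge> max N K"
      then show "sqdist Q (z i) (z j) < e"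
        using *[of i j] *[of j i] form_square_commute[OF zV zV, of i j] linear[of i j] by metis
    qed
  qed
  moreover have "(\<lambda>n. L2dist M (z n) w) \<longlonglongrightarrow> 0"
    by (rule tendsto_sandwich[OF _ _ tendsto_const LIMSEQ_inverse_real_of_nat])
      (use z in \<open>auto intro!: always_eventually simp: C_def\<close>)
  ultimately have a: "approx z w" using zV by (simp add: form_approx_def)
  show "w \<in> D" by (rule domI[OF w a])
  have "(\<lambda>n. c + inverse (Suc n)) \<longlonglongrightarrow> c + 0" by (intro tendsto_intros LIMSEQ_inverse_real_of_nat)
  then have "QD w w \<le> c + 0"
  proof (rule LIMSEQ_le[OF closure_form_tendsto[OF a a w w]])
    show "\<exists>N. \<forall>n\<ge>N. Q (z n) (z n) \<le> c + inverse (Suc n)"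
    proof (intro exI allI impI)
      show "Q (z n) (z n) \<le> c + inverse (Suc n)" for n using zd[of n] d_c[of n] by simp
    qed
  qed
  then show "QD w w \<le> c" by simp
qed

text \<open>
  If \<open>s n\<close> approximates \<open>u\<close>, functions \<open>v n\<close> in \<open>V\<close> close to the unit contractions of \<open>s n\<close> converge to
  the unit contraction of \<open>u\<close>, and lower semicontinuity applies.
\<close>

lemma closure_markov:
  assumes u: "u \<in> D"
  defines "w \<equiv> \<lambda>x. min 1 (max 0 (u x))"
  shows "w \<in> D" "QD w w \<le> QD u u"
proof -
  obtain s where s: "approx s u" using domD u by blast
  note sV = approxD(1)[OF s]
  have "\<forall>n. \<exists>v. v \<in> V \<and> Q v v \<le> Q (s n) (s n) \<and> (AE x in M. \<bar>v x - min 1 (max 0 (s n x))\<bar> \<le> inverse (Suc n))"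
    by (intro allI markov[OF sV, unfolded Bex_def]) simp
  from choice[OF this] obtain v where v: "\<And>n. v n \<in> V" and vQ: "\<And>n. Q (v n) (v n) \<le> Q (s n) (s n)"
    and va: "\<And>n. AE x in M. \<bar>v n x - min 1 (max 0 (s n x))\<bar> \<le> inverse (Suc n)" by blast
  have [measurable]: "u \<in> borel_measurable M" "s n \<in> borel_measurable M" "v n \<in> borel_measurable M" for n
    using domD(1)[OF u] VD[OF sV] VD[OF v] by (auto simp: sq_integrable_def)
  have w: "w \<in> sq_integrable M"
    by (rule bounded_sq_integrable[where B = 1]) (auto simp: w_def)
  have c: "(\<lambda>x. min 1 (max 0 (s n x))) \<in> sq_integrable M" for n
    by (rule bounded_sq_integrable[where B = 1]) auto
  have c1: "(\<lambda>n. \<integral>x. (v n x - min 1 (max 0 (s n x)))\<^sup>2 \<partial>M) \<longlonglongrightarrow> 0"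
  proof (rule tendsto_sandwich[OF _ _ tendsto_const])
    have "(\<lambda>n. (inverse (Suc n))\<^sup>2) \<longlonglongrightarrow> (0::real)\<^sup>2" by (intro tendsto_intros LIMSEQ_inverse_real_of_nat)
    then show "(\<lambda>n. (inverse (Suc n))\<^sup>2) \<longlonglongrightarrow> (0::real)" by simp
    show "\<forall>\<^sub>F n in sequentially. (\<integral>x. (v n x - min 1 (max 0 (s n x)))\<^sup>2 \<partial>M) \<le> (inverse (Suc n))\<^sup>2"
    proof (intro always_eventually allI)
      fix n
      have "(\<integral>x. (v n x - min 1 (max 0 (s n x)))\<^sup>2 \<partial>M) \<le> (\<integral>x. (inverse (Suc n))\<^sup>2 \<partial>M)"
      proof (rule integral_mono_AE)
        show "integrable M (\<lambda>x. (v n x - min 1 (max 0 (s n x)))\<^sup>2)"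
          by (intro sq_integrableD(2) L2.diff VD v c)
        show "AE x in M. (v n x - min 1 (max 0 (s n x)))\<^sup>2 \<le> (inverse (Suc n))\<^sup>2"
          using va[of n] by eventually_elim (metis abs_ge_zero power2_abs power_mono)
      qed simp
      then show "(\<integral>x. (v n x - min 1 (max 0 (s n x)))\<^sup>2 \<partial>M) \<le> (inverse (Suc n))\<^sup>2" by (simp add: prob_space)
    qed
  qed simp
  have c2: "(\<lambda>n. \<integral>x. (min 1 (max 0 (s n x)) - w x)\<^sup>2 \<partial>M) \<longlonglongrightarrow> 0"
  proof (rule tendsto_sandwich[OF _ _ tendsto_const approxD(3)[OF s]])
    show "\<forall>\<^sub>F n in sequentially. (\<integral>x. (min 1 (max 0 (s n x)) - w x)\<^sup>2 \<partial>M) \<le> L2dist M (s n) u"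
    proof (intro always_eventually allI integral_mono)
      have "\<bar>min 1 (max 0 a) - min 1 (max 0 b)\<bar> \<le> \<bar>a - b\<bar>" for a b :: real by linarith
      then show "(min 1 (max 0 (s n x)) - w x)\<^sup>2 \<le> (s n x - u x)\<^sup>2" for n x
        unfolding w_def by (metis abs_le_square_iff)
    qed (intro sq_integrableD(2) L2.diff VD sV c w domD(1) u)+
  qed simp
  have "(\<lambda>n. \<integral>x. ((v n x - min 1 (max 0 (s n x))) + (min 1 (max 0 (s n x)) - w x))\<^sup>2 \<partial>M) \<longlonglongrightarrow> 0"
    by (intro L2_tendsto_add c1 c2 L2.diff VD v c w)
  then have lim: "(\<lambda>n. L2dist M (v n) w) \<longlonglongrightarrow> 0" by simp
  have ev: "\<forall>\<^sub>F n in sequentially. Q (v n) (v n) \<le> QD u u + \<delta>" if "\<delta> > 0" for \<delta>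
  proof -
    have "\<forall>\<^sub>F n in sequentially. Q (s n) (s n) < QD u u + \<delta>"
      by (rule order_tendstoD(2)[OF closure_form_tendsto[OF s s domD(1)[OF u] domD(1)[OF u]]]) (use that in simp)
    then show ?thesis by eventually_elim (use vQ in \<open>meson le_less_trans less_imp_le\<close>)
  qed
  show "w \<in> D" by (rule closure_lsc(1)[OF v w lim ev[of 1]]) simp
  show "QD w w \<le> QD u u" by (rule field_le_epsilon) (rule closure_lsc(2)[OF v w lim ev])
qed

theorem closure_dirichlet_form: "dirichlet_form M D QD"
  unfolding dirichlet_form_def
proof (intro conjI ballI allI impI)
  fix u v assume u: "u \<in> D" and v: "v \<in> borel_measurable M" and eq: "AE x in M. u x = v x"
  obtain s where s: "approx s u" using domD u by blast
  have vs: "approx s v" by (rule approx_cong[OF s eq domD(1)[OF u] v])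
  have vsq: "v \<in> sq_integrable M" by (rule sq_integrable_cong[OF domD(1)[OF u] v eq])
  show "v \<in> D" by (rule domI[OF vsq vs])
  fix w assume w: "w \<in> D"
  then obtain r where r: "approx r w" using domD by blast
  show "QD u w = QD v w"
    by (rule LIMSEQ_unique[OF closure_form_tendsto[OF s r domD(1)[OF u] domD(1)[OF w]]
      closure_form_tendsto[OF vs r vsq domD(1)[OF w]]])
next
  have "D \<subseteq> sq_integrable M" using domD by blast
  then show "L2_dense M D" using dense V_dom unfolding L2_dense_def by blast
next
  fix s assume "(\<forall>n. s n \<in> D) \<and> form_Cauchy (form1 M QD) s"
  then show "\<exists>u\<in>D. (\<lambda>n. sqdist (form1 M QD) (s n) u) \<longlonglongrightarrow> 0"
    using closure_complete by blast
qed (auto intro: closure.zero closure.add closure.scale closure.sym closure.form_add closure.form_scale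
    closure.nonneg closure_markov)

end

section \<open>Configurations\<close>

lemma sets_dirac_sum [simp]: "sets (dirac_sum m I x) = sets m"
  and space_dirac_sum [simp]: "space (dirac_sum m I x) = space m"
  by (simp_all add: dirac_sum_def)

lemma emeasure_dirac_sum:
  assumes "space m = UNIV" "A \<in> sets m"
  shows "emeasure (dirac_sum m I x) A = emeasure (count_space I) {i\<in>I. x i \<in> A}"
proof -
  have "x \<in> measurable (count_space I) m" using assms(1) by simp
  then have "emeasure (dirac_sum m I x) A = emeasure (count_space I) (x -` A \<inter> I)"
    unfolding dirac_sum_def using assms(2) by (simp add: emeasure_distr)
  also have "x -` A \<inter> I = {i\<in>I. x i \<in> A}" by auto
  finally show ?thesis .
qed

lemma emeasure_count_space_subset:
  "X \<subseteq> J \<Longrightarrow> J \<subseteq> I \<Longrightarrow> emeasure (count_space I) X = emeasure (count_space J) X"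
  by (simp add: emeasure_count_space)

lemma sets_config_restrict [simp]: "sets (config_restrict A \<gamma>) = sets \<gamma>"
  and space_config_restrict [simp]: "space (config_restrict A \<gamma>) = space \<gamma>"
  by (simp_all add: config_restrict_def)

lemma emeasure_config_restrict:
  assumes "A \<in> sets \<gamma>" "B \<in> sets \<gamma>"
  shows "emeasure (config_restrict A \<gamma>) B = emeasure \<gamma> (A \<inter> B)"
proof -
  have "emeasure (config_restrict A \<gamma>) B = (\<integral>\<^sup>+x. indicator (A \<inter> B) x \<partial>\<gamma>)"
    unfolding config_restrict_def using assms
    by (subst emeasure_density) (auto simp del: nn_integral_indicator simp flip: indicator_inter_arith)
  then show ?thesis using assms by simp
qed

text \<open>Restrictions of configurations are configurations: the remaining points are enumerated anew.\<close>

lemma config_restrict_dirac_sum: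
  assumes "space m = UNIV" "A \<in> sets m"
  shows "\<exists>(N'::enat) x'. config_restrict A (dirac_sum m {i. enat i < N} x) = dirac_sum m {i. enat i < N'} x'"
proof -
  let ?I = "{i. enat i < N}"
  define J where "J = {i\<in>?I. x i \<in> A}"
  obtain e and N' :: enat where e: "bij_betw e {i. enat i < N'} J"
  proof (cases "finite J")
    case True
    then obtain e where "bij_betw e {..<card J} J"
      using ex_bij_betw_nat_finite[of J] by (auto simp: atLeast0LessThan)
    moreover have "{i. enat i < enat (card J)} = {..<card J}" by auto
    ultimately show ?thesis using that by metis
  next
    case False
    then have "bij_betw (enumerate J) UNIV J" by (rule bij_enumerate)
    moreover have "{i. enat i < \<infinity>} = UNIV" by auto
    ultimately show ?thesis using that by metis
  qed
  let ?I' = "{i. enat i < N'}"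
  have "config_restrict A (dirac_sum m ?I x) = dirac_sum m ?I' (x \<circ> e)"
  proof (rule measure_eqI)
    fix B assume "B \<in> sets (config_restrict A (dirac_sum m ?I x))"
    then have B: "B \<in> sets m" by simp
    have "emeasure (dirac_sum m ?I' (x \<circ> e)) B = emeasure (count_space ?I') (e -` {i\<in>J. x i \<in> B} \<inter> ?I')"
      using assms B e by (simp add: emeasure_dirac_sum)
        (auto intro!: arg_cong[where f = "emeasure _"] dest: bij_betwE)
    also have "\<dots> = emeasure (distr (count_space ?I') (count_space J) e) {i\<in>J. x i \<in> B}"
      using e by (subst emeasure_distr) (auto dest: bij_betwE)
    also have "\<dots> = emeasure (count_space J) {i\<in>J. x i \<in> B}"
      by (simp add: distr_bij_count_space[OF e])
    also have "\<dots> = emeasure (count_space ?I) {i\<in>J. x i \<in> B}"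
      by (rule emeasure_count_space_subset[symmetric]) (auto simp: J_def)
    also have "{i\<in>J. x i \<in> B} = {i\<in>?I. x i \<in> A \<inter> B}" by (auto simp: J_def)
    finally show "emeasure (config_restrict A (dirac_sum m ?I x)) B = emeasure (dirac_sum m ?I' (x \<circ> e)) B"
      using assms B by (simp add: emeasure_config_restrict emeasure_dirac_sum)
  qed simp
  then show ?thesis by blast
qed

context topological_local_structure
begin

text \<open>The configurations, and the configurations on a set, as sets and as measurable spaces.\<close>

abbreviation Conf where "Conf \<equiv> configurations m \<E>"
abbreviation CS where "CS \<equiv> config_space m \<E>"
abbreviation Conf_on where "Conf_on \<equiv> configurations_on m \<E>"
abbreviation CS_on where "CS_on \<equiv> config_space_on m \<E>"

lemma ring_sets: "E \<in> \<E> \<Longrightarrow> E \<in> sets m"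
  using ring_finite by blast

lemma localizing_sequenceD:
  assumes "localizing_sequence m \<E> L"
  shows "L h \<in> \<E>" "L h \<in> sets m" "incseq L" "(\<Union>h. L h) = UNIV" "E \<in> \<E> \<Longrightarrow> \<exists>h. E \<subseteq> L h"
proof -
  show 1: "L h \<in> sets m" "incseq L" "(\<Union>h. L h) = UNIV" for h
    using assms by (auto simp: localizing_sequence_def)
  have eq: "\<E> = (\<Union>h. {A \<inter> L h | A. A \<in> sets m})"
    using assms unfolding localizing_sequence_def by blast
  have "L h \<in> {A \<inter> L h | A. A \<in> sets m}" using 1(1)[of h] by blast
  then show "L h \<in> \<E>" by (subst eq) blast
  show "\<exists>h. E \<subseteq> L h" if "E \<in> \<E>" using that by (subst (asm) eq) blast
qed

lemma Conf_sets: "\<gamma> \<in> Conf \<Longrightarrow> sets \<gamma> = sets m"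
  and Conf_space: "\<gamma> \<in> Conf \<Longrightarrow> space \<gamma> = UNIV"
  using space_m by (auto simp: configurations_def)

lemma Conf_finite: "\<gamma> \<in> Conf \<Longrightarrow> E \<in> \<E> \<Longrightarrow> emeasure \<gamma> E < \<infinity>"
  by (auto simp: configurations_def)

lemma Conf_restrict:
  assumes "\<gamma> \<in> Conf" "A \<in> sets m"
  shows "config_restrict A \<gamma> \<in> Conf_on A" "config_restrict A \<gamma> \<in> Conf"
proof -
  have A: "A \<in> sets \<gamma>" using assms Conf_sets by simp
  have "\<exists>(N::enat) x. config_restrict A \<gamma> = dirac_sum m {i. enat i < N} x"
    using assms config_restrict_dirac_sum[OF space_m] by (auto simp: configurations_def)
  moreover have "emeasure (config_restrict A \<gamma>) E < \<infinity>" if "E \<in> \<E>" for E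
  proof -
    have E: "E \<in> sets \<gamma>" using that ring_sets Conf_sets[OF assms(1)] by simp
    have "emeasure \<gamma> (A \<inter> E) \<le> emeasure \<gamma> E" using E by (intro emeasure_mono) auto
    also have "\<dots> < \<infinity>" using Conf_finite assms that by blast
    finally show ?thesis using A E by (simp add: emeasure_config_restrict)
  qed
  ultimately show c: "config_restrict A \<gamma> \<in> Conf" by (simp add: configurations_def)
  have "- A \<in> sets \<gamma>" using A Conf_space[OF assms(1)] by (metis Compl_eq_Diff_UNIV sets.compl_sets)
  then have "emeasure (config_restrict A \<gamma>) (- A) = 0" using A by (simp add: emeasure_config_restrict)
  then show "config_restrict A \<gamma> \<in> Conf_on A" using c by (simp add: configurations_on_def)
qed

lemma space_CS: "space CS = Conf"
  unfolding config_space_def by (rule space_measure_of) auto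

lemma space_CS_on: "space (CS_on A) = Conf_on A"
  unfolding config_space_on_def by (auto simp: space_restrict_space space_CS configurations_on_def)

lemma measurable_emeasure_ring: "E \<in> \<E> \<Longrightarrow> (\<lambda>\<gamma>. emeasure \<gamma> E) \<in> borel_measurable CS"
proof (rule measurableI)
  fix B :: "ennreal set" assume E: "E \<in> \<E>" and B: "B \<in> sets borel"
  let ?G = "\<Union>E\<in>\<E>. {(\<lambda>\<gamma>. emeasure \<gamma> E) -` B \<inter> Conf | B. B \<in> sets borel}"
  have "sets CS = sigma_sets Conf ?G" unfolding config_space_def by (rule sets_measure_of) auto
  moreover have "(\<lambda>\<gamma>. emeasure \<gamma> E) -` B \<inter> Conf \<in> ?G" using E B by blast
  ultimately show "(\<lambda>\<gamma>. emeasure \<gamma> E) -` B \<inter> space CS \<in> sets CS"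
    unfolding space_CS by (auto intro: sigma_sets.Basic)
qed simp

lemma measurable_CS:
  assumes "\<And>x. x \<in> space M \<Longrightarrow> f x \<in> Conf"
    and "\<And>E. E \<in> \<E> \<Longrightarrow> (\<lambda>x. emeasure (f x) E) \<in> borel_measurable M"
  shows "f \<in> M \<rightarrow>\<^sub>M CS"
  unfolding config_space_def
proof (rule measurable_measure_of)
  fix Y assume "Y \<in> (\<Union>E\<in>\<E>. {(\<lambda>\<gamma>. emeasure \<gamma> E) -` B \<inter> Conf | B. B \<in> sets borel})"
  then obtain E B where Y: "Y = (\<lambda>\<gamma>. emeasure \<gamma> E) -` B \<inter> Conf" "E \<in> \<E>" "B \<in> sets borel" by auto
  have "f -` Y \<inter> space M = (\<lambda>x. emeasure (f x) E) -` B \<inter> space M" unfolding Y using assms(1) by auto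
  then show "f -` Y \<inter> space M \<in> sets M" using measurable_sets[OF assms(2)] Y by simp
qed (use assms(1) in auto)

lemma measurable_emeasure_CS [measurable]:
  assumes "A \<in> sets m" shows "(\<lambda>\<gamma>. emeasure \<gamma> A) \<in> borel_measurable CS"
proof -
  obtain L where L: "localizing_sequence m \<E> L" using ring_localizing by blast
  note L' = localizing_sequenceD[OF L]
  have AL: "A \<inter> L h \<in> \<E>" for h using ring_ideal assms L'(1) by blast
  have "(SUP h. emeasure \<gamma> (A \<inter> L h)) = emeasure \<gamma> A" if "\<gamma> \<in> space CS" for \<gamma>
  proof -
    have "\<gamma> \<in> Conf" using that by (simp add: space_CS)
    then have "range (\<lambda>h. A \<inter> L h) \<subseteq> sets \<gamma>" using AL ring_sets Conf_sets by blast
    moreover have "incseq (\<lambda>h. A \<inter> L h)" using L'(3) by (fastforce simp: incseq_def)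
    moreover have "(\<Union>h. A \<inter> L h) = A" using L'(4) by auto
    ultimately show ?thesis using SUP_emeasure_incseq by metis
  qed
  moreover have "(\<lambda>\<gamma>. SUP h. emeasure \<gamma> (A \<inter> L h)) \<in> borel_measurable CS"
    using measurable_emeasure_ring[OF AL] by measurable
  ultimately show ?thesis by (simp cong: measurable_cong)
qed

lemma measurable_nn_integral_CS:
  assumes "g \<in> borel_measurable m" shows "(\<lambda>\<gamma>. \<integral>\<^sup>+x. g x \<partial>\<gamma>) \<in> borel_measurable CS"
  using assms
proof (induction rule: borel_measurable_induct)
  case (cong f g)
  have "(\<integral>\<^sup>+x. f x \<partial>\<gamma>) = (\<integral>\<^sup>+x. g x \<partial>\<gamma>)" if "\<gamma> \<in> space CS" for \<gamma>
    using cong that space_m by (intro nn_integral_cong) auto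
  then show ?case using cong by (simp cong: measurable_cong)
next
  case (set A)
  have "(\<integral>\<^sup>+x. indicator A x \<partial>\<gamma>) = emeasure \<gamma> A" if "\<gamma> \<in> space CS" for \<gamma>
    using that set by (simp add: space_CS Conf_sets)
  then show ?case using set by (simp cong: measurable_cong)
next
  case (mult u c)
  have "(\<integral>\<^sup>+x. c * u x \<partial>\<gamma>) = c * (\<integral>\<^sup>+x. u x \<partial>\<gamma>)" if "\<gamma> \<in> space CS" for \<gamma>
    using that mult by (intro nn_integral_cmult) (simp add: space_CS Conf_sets cong: measurable_cong_sets)
  then show ?case using mult by (simp cong: measurable_cong)
next
  case (add u v)
  have "(\<integral>\<^sup>+x. v x + u x \<partial>\<gamma>) = (\<integral>\<^sup>+x. v x \<partial>\<gamma>) + (\<integral>\<^sup>+x. u x \<partial>\<gamma>)" if "\<gamma> \<in> space CS" for \<gamma>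
    using that add by (intro nn_integral_add) (simp_all add: space_CS Conf_sets cong: measurable_cong_sets)
  then show ?case using add by (simp cong: measurable_cong)
next
  case (seq U)
  have "(\<integral>\<^sup>+x. (SUP i. U i) x \<partial>\<gamma>) = (SUP i. \<integral>\<^sup>+x. U i x \<partial>\<gamma>)" if "\<gamma> \<in> space CS" for \<gamma>
    unfolding SUP_apply using that seq
    by (intro nn_integral_monotone_convergence_SUP) (simp_all add: space_CS Conf_sets cong: measurable_cong_sets)
  then show ?case using seq by (simp cong: measurable_cong)
qed

text \<open>
  The integral is zero by convention where \<open>g\<close> is not integrable; the configurations with this property
  form a measurable set.
\<close>

lemma measurable_integral_CS:
  fixes g :: "'x \<Rightarrow> real"
  assumes "g \<in> borel_measurable m" shows "(\<lambda>\<gamma>. \<integral>x. g x \<partial>\<gamma>) \<in> borel_measurable CS"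
proof -
  let ?p = "\<lambda>\<gamma>. \<integral>\<^sup>+x. ennreal (g x) \<partial>\<gamma>" and ?n = "\<lambda>\<gamma>. \<integral>\<^sup>+x. ennreal (- g x) \<partial>\<gamma>"
  have [measurable]: "?p \<in> borel_measurable CS" "?n \<in> borel_measurable CS"
    by (intro measurable_nn_integral_CS; use assms in measurable)+
  have "(\<integral>x. g x \<partial>\<gamma>) = (if ?p \<gamma> \<noteq> \<infinity> \<and> ?n \<gamma> \<noteq> \<infinity> then enn2real (?p \<gamma>) - enn2real (?n \<gamma>) else 0)"
    if "\<gamma> \<in> space CS" for \<gamma>
  proof -
    have "g \<in> borel_measurable \<gamma>"
      using that assms by (simp add: space_CS Conf_sets cong: measurable_cong_sets)
    then show ?thesis
      using real_integrable_def[of \<gamma> g] real_lebesgue_integral_def[of \<gamma> g] not_integrable_integral_eq[of \<gamma> g]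
      by auto
  qed
  then show ?thesis by (simp cong: measurable_cong)
qed

lemma measurable_config_restrict [measurable]:
  assumes "A \<in> sets m" shows "config_restrict A \<in> CS \<rightarrow>\<^sub>M CS_on A"
  unfolding config_space_on_def
proof (rule measurable_restrict_space2)
  show "config_restrict A \<in> space CS \<rightarrow> Conf_on A" using Conf_restrict assms by (auto simp: space_CS)
  show "config_restrict A \<in> CS \<rightarrow>\<^sub>M CS"
  proof (rule measurable_CS)
    fix E assume E: "E \<in> \<E>"
    have "emeasure (config_restrict A \<gamma>) E = emeasure \<gamma> (A \<inter> E)" if "\<gamma> \<in> space CS" for \<gamma>
      using that assms ring_sets[OF E] by (intro emeasure_config_restrict) (auto simp: space_CS Conf_sets)
    then show "(\<lambda>\<gamma>. emeasure (config_restrict A \<gamma>) E) \<in> borel_measurable CS"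
      using assms ring_sets[OF E] by (simp cong: measurable_cong)
  qed (use Conf_restrict assms in \<open>auto simp: space_CS\<close>)
qed

lemma measurable_CS_on: "f \<in> borel_measurable CS \<Longrightarrow> f \<in> borel_measurable (CS_on A)"
  unfolding config_space_on_def by (rule measurable_restrict_space1)

lemma Compl_sets_m: "A \<in> sets m \<Longrightarrow> - A \<in> sets m"
  using space_m by (metis Compl_eq_Diff_UNIV sets.compl_sets)

lemma integral_config_restrict:
  fixes g :: "'x \<Rightarrow> real"
  assumes "\<gamma> \<in> Conf" "A \<in> sets m" "g \<in> borel_measurable m"
  shows "(\<integral>x. g x \<partial>config_restrict A \<gamma>) = (\<integral>x. indicator A x * g x \<partial>\<gamma>)"
    and "integrable (config_restrict A \<gamma>) g \<longleftrightarrow> integrable \<gamma> (\<lambda>x. indicator A x * g x)"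
proof -
  have g: "g \<in> borel_measurable \<gamma>" using assms by (simp add: Conf_sets cong: measurable_cong_sets)
  have A: "A \<in> sets \<gamma>" using assms Conf_sets by simp
  have *: "config_restrict A \<gamma> = density \<gamma> (\<lambda>x. ennreal (indicator A x))"
    by (simp add: config_restrict_def ennreal_indicator)
  show "(\<integral>x. g x \<partial>config_restrict A \<gamma>) = (\<integral>x. indicator A x * g x \<partial>\<gamma>)"
    unfolding * using g A by (subst integral_density) auto
  show "integrable (config_restrict A \<gamma>) g \<longleftrightarrow> integrable \<gamma> (\<lambda>x. indicator A x * g x)"
    unfolding * using g A by (subst integrable_density) auto
qed

lemma Conf_integrable:
  fixes g :: "'x \<Rightarrow> real"
  assumes "\<gamma> \<in> Conf" "g \<in> borel_measurable m" "bounded (range g)" "g \<in> vanishing_outside \<E>"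
  shows "integrable \<gamma> g"
proof -
  obtain E where E: "E \<in> \<E>" "\<And>x. x \<notin> E \<Longrightarrow> g x = 0" using assms(4) by (auto simp: vanishing_outside_def)
  obtain B where B: "\<And>x. \<bar>g x\<bar> \<le> B" using assms(3) by (auto simp: bounded_iff)
  have g: "g \<in> borel_measurable \<gamma>" using assms by (simp add: Conf_sets cong: measurable_cong_sets)
  show ?thesis
  proof (rule Bochner_Integration.integrable_bound[OF _ g])
    have "E \<in> sets \<gamma>" using E ring_sets Conf_sets assms by simp
    then show "integrable \<gamma> (\<lambda>x. B * indicator E x)"
      using Conf_finite[OF assms(1) E(1)] by (auto simp: less_top)
    have "norm (g x) \<le> norm (B * indicator E x)" for x
      using E(2)[of x] B[of x] by (auto simp: indicator_def)
    then show "AE x in \<gamma>. norm (g x) \<le> norm (B * indicator E x)" by simp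
  qed
qed

lemma restrict_integrable:
  fixes g :: "'x \<Rightarrow> real"
  assumes "\<gamma> \<in> Conf" "E \<in> \<E>" "g \<in> bounded_measurable m"
  shows "integrable (config_restrict E \<gamma>) g"
proof -
  have g: "g \<in> borel_measurable m" "bounded (range g)" using assms by (auto simp: bounded_measurable_def)
  obtain B where B: "\<And>x. \<bar>g x\<bar> \<le> B" using g(2) by (auto simp: bounded_iff)
  have "integrable \<gamma> (\<lambda>x. indicator E x * g x)"
  proof (rule Conf_integrable[OF assms(1)])
    show "(\<lambda>x. indicator E x * g x) \<in> borel_measurable m"
      using g(1) ring_sets[OF assms(2)] by measurable
    show "bounded (range (\<lambda>x. indicator E x * g x))"
      using B order_trans[OF abs_ge_zero B] by (intro boundedI[where B = B]) (auto simp: indicator_def)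
  qed (auto simp: vanishing_outside_def intro!: bexI[OF _ assms(2)])
  then show ?thesis using integral_config_restrict(2)[OF assms(1) ring_sets[OF assms(2)] g(1)] by simp
qed

lemma integral_split:
  fixes g :: "'x \<Rightarrow> real"
  assumes "\<gamma> \<in> Conf" "A \<in> sets m" "g \<in> borel_measurable m" "integrable \<gamma> g"
  shows "(\<integral>x. g x \<partial>\<gamma>) = (\<integral>x. g x \<partial>config_restrict A \<gamma>) + (\<integral>x. g x \<partial>config_restrict (- A) \<gamma>)"
proof -
  have A: "A \<in> sets \<gamma>" "- A \<in> sets \<gamma>" using assms Conf_sets Compl_sets_m by auto
  have "(\<integral>x. g x \<partial>\<gamma>) = (\<integral>x. indicator A x * g x + indicator (- A) x * g x \<partial>\<gamma>)"
    by (intro Bochner_Integration.integral_cong) (auto simp: indicator_def)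
  also have "\<dots> = (\<integral>x. indicator A x * g x \<partial>\<gamma>) + (\<integral>x. indicator (- A) x * g x \<partial>\<gamma>)"
    using assms(4) A
    by (intro Bochner_Integration.integral_add) (auto intro!: integrable_real_mult_indicator simp: mult.commute[of "indicator _ _"])
  finally show ?thesis using assms Compl_sets_m by (simp add: integral_config_restrict)
qed

text \<open>
  Poisson configurations on \<open>E\<close> almost surely do not charge a given \<open>m\<close>-null set. Only null sets
  matter here, so that it is enough to know that image measures and measures given by
  \<^const>\<open>measure_of\<close> are bounded by the functions that define them.
\<close>

lemma poisson_null:
  assumes E: "E \<in> \<E>" and N: "N \<in> sets m" "emeasure m N = 0"
  shows "{\<gamma>\<in>Conf_on E. emeasure \<gamma> N \<noteq> 0} \<in> null_sets (poisson_measure m \<E> E)"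
proof -
  let ?B = "{\<gamma>\<in>Conf_on E. emeasure \<gamma> N \<noteq> 0}"
  let ?P = "\<lambda>n. PiM {..<n} (\<lambda>_. restrict_space m E)"
  have Es: "E \<in> sets m" by (rule ring_sets[OF E])
  have sB: "?B \<in> sets (CS_on E)"
  proof -
    have "(\<lambda>\<gamma>. emeasure \<gamma> N) -` (- {0}) \<inter> space (CS_on E) \<in> sets (CS_on E)"
      by (rule measurable_sets[OF measurable_CS_on[OF measurable_emeasure_CS[OF N(1)]]]) auto
    also have "(\<lambda>\<gamma>. emeasure \<gamma> N) -` (- {0}) \<inter> space (CS_on E) = ?B" by (auto simp: space_CS_on)
    finally show ?thesis .
  qed
  have null: "emeasure (?P n) (dirac_sum m {..<n} -` ?B \<inter> space (?P n)) = 0" for n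
  proof -
    interpret fin: finite_measure "restrict_space m E"
    proof
      have "emeasure (restrict_space m E) (space (restrict_space m E)) = emeasure m E"
        using Es by (subst emeasure_restrict_space) (auto simp: space_restrict_space)
      also have "\<dots> \<noteq> \<infinity>" using E ring_finite by force
      finally show "emeasure (restrict_space m E) (space (restrict_space m E)) \<noteq> \<infinity>" .
    qed
    interpret product_sigma_finite "\<lambda>_::nat. restrict_space m E"
      by (rule product_sigma_finite.intro) (rule fin.sigma_finite_measure_axioms)
    define R where "R i = PiE {..<n} (\<lambda>j. if j = i then N \<inter> E else E)" for i
    have NE: "N \<inter> E \<in> sets (restrict_space m E)" "E \<in> sets (restrict_space m E)"
      using N Es by (auto simp: sets_restrict_space)
    have "emeasure (restrict_space m E) (N \<inter> E) = 0"
      using N Es by (subst emeasure_restrict_space) (auto intro: emeasure_eq_0[of N])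
    then have "R i \<in> null_sets (?P n)" if "i < n" for i
      unfolding R_def using that NE
      by (intro null_setsI) (auto simp: emeasure_PiM intro!: prod_zero sets_PiM_I_finite)
    then have U: "(\<Union>i\<in>{..<n}. R i) \<in> null_sets (?P n)" by (intro null_sets_UN') auto
    have "dirac_sum m {..<n} -` ?B \<inter> space (?P n) \<subseteq> (\<Union>i\<in>{..<n}. R i)"
    proof
      fix w assume w: "w \<in> dirac_sum m {..<n} -` ?B \<inter> space (?P n)"
      then have "emeasure (dirac_sum m {..<n} w) N \<noteq> 0" by auto
      then have "{i\<in>{..<n}. w i \<in> N} \<noteq> {}"
        unfolding emeasure_dirac_sum[OF space_m N(1)] by (metis emeasure_empty)
      then obtain i where "i < n" "w i \<in> N" by auto
      then show "w \<in> (\<Union>i\<in>{..<n}. R i)"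
        using w Es by (auto simp: R_def space_PiM PiE_iff space_restrict_space)
    qed
    from emeasure_mono[OF this null_setsD2[OF U]] show ?thesis using null_setsD1[OF U] by simp
  qed
  have "emeasure (distr (?P n) (CS_on E) (dirac_sum m {..<n})) ?B = 0" for n
    unfolding distr_def emeasure_measure_of_conv using null[of n] by simp
  then have "emeasure (poisson_measure m \<E> E) ?B = 0"
    unfolding poisson_measure_def emeasure_measure_of_conv by simp
  moreover have "?B \<in> sets (poisson_measure m \<E> E)"
    unfolding poisson_measure_def using sB sets.space_closed[of "CS_on E"]
    by (subst sets_measure_of) (auto simp: space_CS_on intro: sigma_sets.Basic)
  ultimately show ?thesis by (simp add: null_sets_def)
qed

end

section \<open>Cylinder functions\<close>

subsection \<open>Operations on cylinder functions\<close>

text \<open>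
  For two cylinder functions, the arguments of the second one are placed behind those of the first one.
\<close>

fun cyl_add :: "'x cylinder \<Rightarrow> 'x cylinder \<Rightarrow> 'x cylinder" where
  "cyl_add (k, F, f) (l, G, g) =
     (k + l, \<lambda>x. F x + G (\<lambda>j. x (j + k)), \<lambda>i. if i < k then f i else g (i - k))"

fun cyl_mult :: "'x cylinder \<Rightarrow> 'x cylinder \<Rightarrow> 'x cylinder" where
  "cyl_mult (k, F, f) (l, G, g) =
     (k + l, \<lambda>x. F x * G (\<lambda>j. x (j + k)), \<lambda>i. if i < k then f i else g (i - k))"

fun cyl_scale :: "real \<Rightarrow> 'x cylinder \<Rightarrow> 'x cylinder" where
  "cyl_scale c (k, F, f) = (k, \<lambda>x. c * F x, f)"

fun cyl_soft_clip :: "real \<Rightarrow> 'x cylinder \<Rightarrow> 'x cylinder" where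
  "cyl_soft_clip \<epsilon> (k, F, f) = (k, \<lambda>x. soft_clip \<epsilon> (F x), f)"

text \<open>The cylinder function of the configuration inside \<open>A\<close>, given the configuration \<open>\<eta>\<close> outside \<open>A\<close>.\<close>

fun cyl_cond :: "'x set \<Rightarrow> 'x measure \<Rightarrow> 'x cylinder \<Rightarrow> 'x cylinder" where
  "cyl_cond A \<eta> (k, F, f) = (k, \<lambda>x. F (\<lambda>i. x i + (\<integral>y. f i y \<partial>config_restrict (- A) \<eta>)), f)"

definition cyl_diff :: "'x cylinder \<Rightarrow> 'x cylinder \<Rightarrow> 'x cylinder" where
  "cyl_diff a b = cyl_add a (cyl_scale (-1) b)"

lemma cylindersE:
  assumes "a \<in> cylinders \<D>"
  obtains k F f where "a = (k, F, f)" "F \<in> Cb_smooth k" "\<And>i. i < k \<Longrightarrow> f i \<in> \<D>"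
  using assms by (auto simp: cylinders_def)

lemma
  assumes "a \<in> cylinders \<D>" "b \<in> cylinders \<D>"
  shows cyl_add_in: "cyl_add a b \<in> cylinders \<D>" and cyl_mult_in: "cyl_mult a b \<in> cylinders \<D>"
proof -
  obtain k F f where a: "a = (k, F, f)" "F \<in> Cb_smooth k" "\<And>i. i < k \<Longrightarrow> f i \<in> \<D>"
    by (rule cylindersE[OF assms(1)]) blast
  obtain l G g where b: "b = (l, G, g)" "G \<in> Cb_smooth l" "\<And>i. i < l \<Longrightarrow> g i \<in> \<D>"
    by (rule cylindersE[OF assms(2)]) blast
  have F: "F \<in> Cb_smooth (k + l)" using a(2) by (rule Cb_smooth_mono) simp
  have G: "(\<lambda>x. G (\<lambda>j. x (j + k))) \<in> Cb_smooth (k + l)" using b(2) by (rule Cb_smooth_shift) simp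
  show "cyl_add a b \<in> cylinders \<D>" "cyl_mult a b \<in> cylinders \<D>"
    using Cb_smooth_add[OF F G] Cb_smooth_mult[OF F G] a(3) b(3)
    by (simp_all add: a(1) b(1) cylinders_def)
qed

lemma cyl_scale_in: "a \<in> cylinders \<D> \<Longrightarrow> cyl_scale c a \<in> cylinders \<D>"
  by (elim cylindersE) (auto simp: cylinders_def intro!: Cb_smooth_scale)

lemma cyl_diff_in: "a \<in> cylinders \<D> \<Longrightarrow> b \<in> cylinders \<D> \<Longrightarrow> cyl_diff a b \<in> cylinders \<D>"
  unfolding cyl_diff_def by (intro cyl_add_in cyl_scale_in)

lemma cyl_soft_clip_in: "a \<in> cylinders \<D> \<Longrightarrow> \<epsilon> > 0 \<Longrightarrow> cyl_soft_clip \<epsilon> a \<in> cylinders \<D>"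
  by (elim cylindersE) (auto simp: cylinders_def intro!: Cb_smooth_soft_clip)

lemma cyl_cond_in: "a \<in> cylinders \<D> \<Longrightarrow> cyl_cond A \<eta> a \<in> cylinders \<D>"
  by (elim cylindersE) (auto simp: cylinders_def intro!: Cb_smooth_translate)

lemma cyl_const_in: "(0, \<lambda>_. c, f) \<in> cylinders \<D>"
  by (auto simp: cylinders_def intro: Cb_smooth_const)

lemma cyl_fun_add:
  assumes "a \<in> cylinders \<D>" "b \<in> cylinders \<D>"
  shows "cyl_fun (cyl_add a b) \<gamma> = cyl_fun a \<gamma> + cyl_fun b \<gamma>"
    and "cyl_fun (cyl_mult a b) \<gamma> = cyl_fun a \<gamma> * cyl_fun b \<gamma>"
proof -
  obtain k F f where a: "a = (k, F, f)" "F \<in> Cb_smooth k" by (rule cylindersE[OF assms(1)])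
  obtain l G g where b: "b = (l, G, g)" by (rule cylindersE[OF assms(2)])
  have "F (\<lambda>i. \<integral>x. (if i < k then f i else g (i - k)) x \<partial>\<gamma>) = F (\<lambda>i. \<integral>x. f i x \<partial>\<gamma>)"
    by (rule Cb_smooth_dep[OF a(2)]) simp
  then show "cyl_fun (cyl_add a b) \<gamma> = cyl_fun a \<gamma> + cyl_fun b \<gamma>"
    "cyl_fun (cyl_mult a b) \<gamma> = cyl_fun a \<gamma> * cyl_fun b \<gamma>" by (simp_all add: a b)
qed

lemma cyl_fun_scale: "cyl_fun (cyl_scale c a) \<gamma> = c * cyl_fun a \<gamma>"
  by (cases a) simp

lemma cyl_fun_diff:
  "a \<in> cylinders \<D> \<Longrightarrow> b \<in> cylinders \<D> \<Longrightarrow> cyl_fun (cyl_diff a b) \<gamma> = cyl_fun a \<gamma> - cyl_fun b \<gamma>"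
  unfolding cyl_diff_def by (subst cyl_fun_add[OF _ cyl_scale_in]) (simp_all add: cyl_fun_scale)

lemma cyl_fun_soft_clip: "cyl_fun (cyl_soft_clip \<epsilon> a) \<gamma> = soft_clip \<epsilon> (cyl_fun a \<gamma>)"
  by (cases a) simp

lemma cyl_fun_bounded: "a \<in> cylinders \<D> \<Longrightarrow> \<exists>B. \<forall>\<gamma>. \<bar>cyl_fun a \<gamma>\<bar> \<le> B"
  by (elim cylindersE) (use Cb_smooth_bounded in \<open>fastforce simp: bounded_iff\<close>)

lemma sum_lessThan_split:
  fixes h :: "nat \<Rightarrow> 'a::comm_monoid_add"
  shows "(\<Sum>i<k + l. h i) = (\<Sum>i<k. h i) + (\<Sum>i<l. h (i + k))"
  by (induction l) (simp_all add: add.assoc add.commute[of k])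

lemma partial_deriv_add:
  assumes "\<phi> \<in> Cb_smooth n" "\<psi> \<in> Cb_smooth n" "i < n"
  shows "partial_deriv i (\<lambda>x. \<phi> x + \<psi> x) x = partial_deriv i \<phi> x + partial_deriv i \<psi> x"
  by (intro partial_deriv_eqI DERIV_add Cb_smooth_has_partial[OF assms(1,3)] Cb_smooth_has_partial[OF assms(2,3)])

lemma partial_deriv_scale:
  assumes "\<phi> \<in> Cb_smooth n" "i < n"
  shows "partial_deriv i (\<lambda>x. c * \<phi> x) x = c * partial_deriv i \<phi> x"
  by (intro partial_deriv_eqI DERIV_cmult Cb_smooth_has_partial[OF assms])

lemma partial_deriv_join:
  assumes F: "F \<in> Cb_smooth k" and G: "G \<in> Cb_smooth l"
  shows "i < k \<Longrightarrow> partial_deriv i (\<lambda>x. F x + G (\<lambda>j. x (j + k))) x = partial_deriv i F x"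
    and "i < l \<Longrightarrow> partial_deriv (i + k) (\<lambda>x. F x + G (\<lambda>j. x (j + k))) x = partial_deriv i G (\<lambda>j. x (j + k))"
proof -
  have F': "F \<in> Cb_smooth (k + l)" using F by (rule Cb_smooth_mono) simp
  have G': "(\<lambda>x. G (\<lambda>j. x (j + k))) \<in> Cb_smooth (k + l)" using G by (rule Cb_smooth_shift) simp
  note re = partial_deriv_reindex[of _ G k "\<lambda>_. 0", simplified]
  show "i < k \<Longrightarrow> partial_deriv i (\<lambda>x. F x + G (\<lambda>j. x (j + k))) x = partial_deriv i F x"
    by (subst partial_deriv_add[OF F' G']) (simp_all add: re)
  have "partial_deriv (i + k) F x = 0"
    by (intro partial_deriv_indep Cb_smooth_dep[OF F]) simp
  then show "i < l \<Longrightarrow> partial_deriv (i + k) (\<lambda>x. F x + G (\<lambda>j. x (j + k))) x = partial_deriv i G (\<lambda>j. x (j + k))"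
    by (subst partial_deriv_add[OF F' G']) (simp_all add: re)
qed

subsection \<open>The square field operator on cylinder functions\<close>

text \<open>A topological local diffusion space with a fixed strong lifting.\<close>

locale lifted_diffusion_space = topological_local_diffusion_space m \<E> \<D> \<Gamma>
  for m :: "'x::t2_space measure" and \<E> \<D> \<Gamma> +
  fixes lft :: "('x \<Rightarrow> real) \<Rightarrow> 'x \<Rightarrow> real"
  assumes lifting: "strong_lifting m lft"
begin

abbreviation Cyl where "Cyl \<equiv> cylinders \<D>"

lemma D_measurable: "f \<in> \<D> \<Longrightarrow> f \<in> borel_measurable m"
proof -
  assume "f \<in> \<D>"
  then have "continuous_on UNIV f" using D_subset by (auto simp: bounded_continuous_def)
  then have "f \<in> borel_measurable borel" by (rule borel_measurable_continuous_onI)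
  then show ?thesis
    using borel_subset space_m by (intro borel_measurable_subalgebra[of borel m]) auto
qed

lemma D_integrable: "f \<in> \<D> \<Longrightarrow> \<gamma> \<in> Conf \<Longrightarrow> integrable \<gamma> f"
  using D_subset by (intro Conf_integrable) (auto simp: bounded_continuous_def D_measurable)

lemma lft_Gamma_bounded: "f \<in> \<D> \<Longrightarrow> g \<in> \<D> \<Longrightarrow> lft (\<Gamma> f g) \<in> bounded_measurable m"
  using lifting[unfolded strong_lifting_def, THEN conjunct1] Gamma_Linf by blast

lemma lft_Gamma_measurable: "f \<in> \<D> \<Longrightarrow> g \<in> \<D> \<Longrightarrow> lft (\<Gamma> f g) \<in> borel_measurable m"
  using lft_Gamma_bounded by (auto simp: bounded_measurable_def)

lemma
  assumes "f \<in> bounded_measurable m" "g \<in> bounded_measurable m"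
  shows lft_cong: "(AE x in m. f x = g x) \<Longrightarrow> lft f = lft g"
    and lft_mono: "(AE x in m. f x \<le> g x) \<Longrightarrow> lft f x \<le> lft g x"
    and lft_add: "lft (\<lambda>x. f x + g x) = (\<lambda>x. lft f x + lft g x)"
proof -
  have "((AE x in m. f x = g x) \<longrightarrow> lft f = lft g) \<and>
        ((AE x in m. f x \<le> g x) \<longrightarrow> (\<forall>x. lft f x \<le> lft g x)) \<and>
        lft (\<lambda>x. f x + g x) = (\<lambda>x. lft f x + lft g x)"
    using lifting[unfolded strong_lifting_def, THEN conjunct2, THEN conjunct1, THEN bspec, OF assms(1),
      THEN bspec, OF assms(2)] by blast
  then show "(AE x in m. f x = g x) \<Longrightarrow> lft f = lft g" "(AE x in m. f x \<le> g x) \<Longrightarrow> lft f x \<le> lft g x"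
    "lft (\<lambda>x. f x + g x) = (\<lambda>x. lft f x + lft g x)" by simp_all
qed

lemma lft_scale: "f \<in> bounded_measurable m \<Longrightarrow> lft (\<lambda>x. c * f x) = (\<lambda>x. c * lft f x)"
  using lifting[unfolded strong_lifting_def, THEN conjunct2, THEN conjunct2, THEN conjunct1] by blast

lemma bounded_measurable_add:
  assumes "f \<in> bounded_measurable m" "g \<in> bounded_measurable m"
  shows "(\<lambda>x. f x + g x) \<in> bounded_measurable m"
proof -
  obtain B C where "\<And>x. \<bar>f x\<bar> \<le> B" "\<And>x. \<bar>g x\<bar> \<le> C"
    using assms by (auto simp: bounded_measurable_def bounded_iff)
  then have "\<bar>f x + g x\<bar> \<le> B + C" for x by (meson abs_triangle_ineq add_mono order_trans)
  then have "bounded (range (\<lambda>x. f x + g x))" by (intro boundedI[where B = "B + C"]) auto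
  then show ?thesis using assms by (auto simp: bounded_measurable_def)
qed

lemma bounded_measurable_scale:
  assumes "f \<in> bounded_measurable m" shows "(\<lambda>x. c * f x) \<in> bounded_measurable m"
proof -
  obtain B where "\<And>x. \<bar>f x\<bar> \<le> B" using assms by (auto simp: bounded_measurable_def bounded_iff)
  then have "\<bar>c * f x\<bar> \<le> \<bar>c\<bar> * B" for x by (simp add: abs_mult mult_left_mono)
  then have "bounded (range (\<lambda>x. c * f x))" by (intro boundedI[where B = "\<bar>c\<bar> * B"]) auto
  then show ?thesis using assms by (auto simp: bounded_measurable_def)
qed

lemma lft_Gamma_sym: "f \<in> \<D> \<Longrightarrow> g \<in> \<D> \<Longrightarrow> lft (\<Gamma> f g) = lft (\<Gamma> g f)"
  by (intro lft_cong Gamma_Linf Gamma_sym)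

lemma lft_Gamma_add:
  assumes "f \<in> \<D>" "g \<in> \<D>" "h \<in> \<D>"
  shows "lft (\<Gamma> (\<lambda>y. f y + g y) h) x = lft (\<Gamma> f h) x + lft (\<Gamma> g h) x"
proof -
  have "lft (\<Gamma> (\<lambda>y. f y + g y) h) = lft (\<lambda>x. \<Gamma> f h x + \<Gamma> g h x)"
    by (intro lft_cong Gamma_Linf Gamma_add D_add bounded_measurable_add assms)
  also have "\<dots> = (\<lambda>x. lft (\<Gamma> f h) x + lft (\<Gamma> g h) x)"
    by (intro lft_add Gamma_Linf assms)
  finally show ?thesis by simp
qed

lemma lft_Gamma_scale:
  assumes "f \<in> \<D>" "h \<in> \<D>"
  shows "lft (\<Gamma> (\<lambda>y. c * f y) h) x = c * lft (\<Gamma> f h) x"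
proof -
  have "lft (\<Gamma> (\<lambda>y. c * f y) h) = lft (\<lambda>x. c * \<Gamma> f h x)"
    by (intro lft_cong Gamma_Linf Gamma_scale D_scale bounded_measurable_scale assms)
  also have "\<dots> = (\<lambda>x. c * lft (\<Gamma> f h) x)"
    by (intro lft_scale Gamma_Linf assms)
  finally show ?thesis by simp
qed

lemma lft_Gamma_nonneg:
  assumes "f \<in> \<D>" shows "0 \<le> lft (\<Gamma> f f) x"
proof -
  have z: "(\<lambda>_. 0) \<in> bounded_measurable m" by (auto simp: bounded_measurable_def)
  have "lft (\<lambda>_. 0) x = 0" using lft_scale[OF z, of 0] by simp
  moreover have "lft (\<lambda>_. 0) x \<le> lft (\<Gamma> f f) x"
    by (intro lft_mono z Gamma_Linf Gamma_nonneg assms)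
  ultimately show ?thesis by simp
qed

lemma D_sum: "(\<And>i. i < k \<Longrightarrow> f i \<in> \<D>) \<Longrightarrow> (\<lambda>y. \<Sum>i<k. c i * f i y) \<in> \<D>" for k :: nat
  by (induction k) (auto intro!: D_zero D_add D_scale)

lemma lft_Gamma_sum:
  fixes k :: nat
  assumes "\<And>i. i < k \<Longrightarrow> f i \<in> \<D>" "h \<in> \<D>"
  shows "lft (\<Gamma> (\<lambda>y. \<Sum>i<k. c i * f i y) h) x = (\<Sum>i<k. c i * lft (\<Gamma> (f i) h) x)"
  using assms(1)
proof (induction k)
  case 0
  then show ?case using lft_Gamma_scale[OF D_zero assms(2), of 0] by simp
next
  case (Suc k)
  then show ?case by (simp add: lft_Gamma_add lft_Gamma_scale D_sum D_scale assms(2))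
qed

text \<open>The point of the lifting: the matrix of square fields is non-negative definite at every point.\<close>

lemma lft_Gamma_matrix_nonneg:
  fixes k :: nat
  assumes "\<And>i. i < k \<Longrightarrow> f i \<in> \<D>"
  shows "0 \<le> (\<Sum>i<k. \<Sum>j<k. c i * c j * lft (\<Gamma> (f i) (f j)) x)"
proof -
  let ?u = "\<lambda>y. \<Sum>i<k. c i * f i y"
  have u: "?u \<in> \<D>" by (intro D_sum assms)
  have "lft (\<Gamma> ?u ?u) x = (\<Sum>i<k. c i * lft (\<Gamma> ?u (f i)) x)"
    by (subst lft_Gamma_sum) (auto intro!: sum.cong simp: assms u lft_Gamma_sym[OF u])
  also have "\<dots> = (\<Sum>i<k. c i * (\<Sum>j<k. c j * lft (\<Gamma> (f j) (f i)) x))"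
    by (intro sum.cong refl arg_cong2[where f = "(*)"] lft_Gamma_sum assms) auto
  also have "\<dots> = (\<Sum>i<k. \<Sum>j<k. c i * c j * lft (\<Gamma> (f i) (f j)) x)"
    by (auto simp: sum_distrib_left mult.assoc assms lft_Gamma_sym intro!: sum.cong)
  finally show ?thesis using lft_Gamma_nonneg[OF u, of x] by simp
qed

text \<open>
  The square field of cylinder functions, where the configuration \<open>\<gamma>\<close> at which the outer functions are
  differentiated is separated from the configuration \<open>\<rho>\<close> against which the lifted square fields are
  integrated. For \<open>\<rho> = \<gamma>\<close> this is the square field at \<open>\<gamma>\<close>, for \<open>\<rho> = \<gamma>\<^bsub>E\<^esub>\<close> the part of it that comes from
  the points in \<open>E\<close>. It is bilinear without any integrability assumption.
\<close>

fun gam :: "'x cylinder \<Rightarrow> 'x cylinder \<Rightarrow> 'x measure \<Rightarrow> 'x measure \<Rightarrow> real" where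
  "gam (k, F, f) (l, G, g) \<gamma> \<rho> =
     (\<Sum>i<k. \<Sum>j<l. partial_deriv i F (\<lambda>i. \<integral>x. f i x \<partial>\<gamma>) * partial_deriv j G (\<lambda>j. \<integral>x. g j x \<partial>\<gamma>) *
        (\<integral>x. lft (\<Gamma> (f i) (g j)) x \<partial>\<rho>))"

lemma cyl_Gamma_gam: "cyl_Gamma \<Gamma> lft a b \<gamma> = gam a b \<gamma> \<gamma>"
  by (cases a; cases b) simp

lemma gam_sym:
  assumes "a \<in> Cyl" "b \<in> Cyl" shows "gam a b \<gamma> \<rho> = gam b a \<gamma> \<rho>"
proof -
  obtain k F f where a: "a = (k, F, f)" "\<And>i. i < k \<Longrightarrow> f i \<in> \<D>" by (rule cylindersE[OF assms(1)]) blast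
  obtain l G g where b: "b = (l, G, g)" "\<And>i. i < l \<Longrightarrow> g i \<in> \<D>" by (rule cylindersE[OF assms(2)]) blast
  have "gam b a \<gamma> \<rho> = (\<Sum>i<k. \<Sum>j<l. partial_deriv j G (\<lambda>j. \<integral>x. g j x \<partial>\<gamma>) * partial_deriv i F (\<lambda>i. \<integral>x. f i x \<partial>\<gamma>) *
        (\<integral>x. lft (\<Gamma> (g j) (f i)) x \<partial>\<rho>))"
    unfolding a b gam.simps by (rule sum.swap)
  also have "\<dots> = gam a b \<gamma> \<rho>"
    unfolding a b gam.simps
    by (intro sum.cong refl) (simp add: lft_Gamma_sym a(2) b(2) mult.commute)
  finally show ?thesis by simp
qed

lemma gam_add:
  assumes "a \<in> Cyl" "a' \<in> Cyl"
  shows "gam (cyl_add a a') b \<gamma> \<rho> = gam a b \<gamma> \<rho> + gam a' b \<gamma> \<rho>"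
proof -
  obtain k F f where a: "a = (k, F, f)" "F \<in> Cb_smooth k" by (rule cylindersE[OF assms(1)])
  obtain k' F' f' where a': "a' = (k', F', f')" "F' \<in> Cb_smooth k'" by (rule cylindersE[OF assms(2)])
  obtain l G g where b: "b = (l, G, g)" by (cases b)
  let ?h = "\<lambda>i. if i < k then f i else f' (i - k)"
  let ?H = "\<lambda>x. F x + F' (\<lambda>j. x (j + k))"
  have 1: "partial_deriv i ?H (\<lambda>i. \<integral>x. ?h i x \<partial>\<gamma>) = partial_deriv i F (\<lambda>i. \<integral>x. f i x \<partial>\<gamma>)" if "i < k" for i
    unfolding partial_deriv_join(1)[OF a(2) a'(2) that]
    by (rule Cb_smooth_dep[OF Cb_smooth_partial[OF a(2) that]]) simp
  have 2: "partial_deriv (i + k) ?H (\<lambda>i. \<integral>x. ?h i x \<partial>\<gamma>) = partial_deriv i F' (\<lambda>i. \<integral>x. f' i x \<partial>\<gamma>)" if "i < k'" for i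
    unfolding partial_deriv_join(2)[OF a(2) a'(2) that] by simp
  show ?thesis
    unfolding a a' b cyl_add.simps gam.simps sum_lessThan_split
    by (intro arg_cong2[where f = "(+)"] sum.cong refl) (simp_all only: 1 2 lessThan_iff, simp_all)
qed

lemma gam_scale:
  assumes "a \<in> Cyl" shows "gam (cyl_scale c a) b \<gamma> \<rho> = c * gam a b \<gamma> \<rho>"
proof -
  obtain k F f where a: "a = (k, F, f)" "F \<in> Cb_smooth k" by (rule cylindersE[OF assms(1)])
  obtain l G g where b: "b = (l, G, g)" by (cases b)
  show ?thesis unfolding a b cyl_scale.simps gam.simps sum_distrib_left
    by (intro sum.cong refl) (simp add: partial_deriv_scale[OF a(2)] mult.assoc)
qed

lemma gam_diff:
  assumes "a \<in> Cyl" "a' \<in> Cyl"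
  shows "gam (cyl_diff a a') b \<gamma> \<rho> = gam a b \<gamma> \<rho> - gam a' b \<gamma> \<rho>"
  unfolding cyl_diff_def by (simp add: gam_add[OF _ cyl_scale_in] gam_scale assms)

lemma gam_diff_diff:
  assumes "a \<in> Cyl" "b \<in> Cyl"
  shows "gam (cyl_diff a b) (cyl_diff a b) \<gamma> \<rho> = gam a a \<gamma> \<rho> - 2 * gam a b \<gamma> \<rho> + gam b b \<gamma> \<rho>"
  using gam_sym[OF cyl_diff_in[OF assms] assms(1)] gam_sym[OF cyl_diff_in[OF assms] assms(2)] gam_sym[OF assms]
  by (simp add: gam_diff assms gam_sym[OF _ cyl_diff_in[OF assms]])

lemma gam_soft_clip:
  assumes "a \<in> Cyl" "\<epsilon> > 0"
  shows "gam (cyl_soft_clip \<epsilon> a) (cyl_soft_clip \<epsilon> a) \<gamma> \<rho> = (soft_clip' \<epsilon> (cyl_fun a \<gamma>))\<^sup>2 * gam a a \<gamma> \<rho>"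
proof -
  obtain k F f where a: "a = (k, F, f)" "F \<in> Cb_smooth k" by (rule cylindersE[OF assms(1)])
  show ?thesis unfolding a cyl_soft_clip.simps gam.simps sum_distrib_left
    by (intro sum.cong refl) (simp add: Cb_smooth_soft_clip(2)[OF a(2) assms(2)] power2_eq_square mult_ac)
qed

text \<open>Integrability of all lifted square fields that occur in the square field of a cylinder function.\<close>

fun carre_integrable :: "'x cylinder \<Rightarrow> 'x measure \<Rightarrow> bool" where
  "carre_integrable (k, F, f) \<rho> \<longleftrightarrow> (\<forall>i<k. \<forall>j<k. integrable \<rho> (lft (\<Gamma> (f i) (f j))))"

lemma gam_nonneg:
  assumes "a \<in> Cyl" "carre_integrable a \<rho>" shows "0 \<le> gam a a \<gamma> \<rho>"
proof -
  obtain k F f where a: "a = (k, F, f)" "\<And>i. i < k \<Longrightarrow> f i \<in> \<D>" by (rule cylindersE[OF assms(1)]) blast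
  let ?c = "\<lambda>i. partial_deriv i F (\<lambda>i. \<integral>x. f i x \<partial>\<gamma>)"
  have int: "integrable \<rho> (lft (\<Gamma> (f i) (f j)))" if "i < k" "j < k" for i j
    using assms(2) that by (simp add: a(1))
  have "gam a a \<gamma> \<rho> = (\<Sum>i<k. \<Sum>j<k. \<integral>x. ?c i * ?c j * lft (\<Gamma> (f i) (f j)) x \<partial>\<rho>)"
    unfolding a(1) gam.simps by simp
  also have "\<dots> = (\<Sum>i<k. \<integral>x. (\<Sum>j<k. ?c i * ?c j * lft (\<Gamma> (f i) (f j)) x) \<partial>\<rho>)"
    by (intro sum.cong refl Bochner_Integration.integral_sum[symmetric]) (auto intro!: integrable_mult_right int)
  also have "\<dots> = (\<integral>x. (\<Sum>i<k. \<Sum>j<k. ?c i * ?c j * lft (\<Gamma> (f i) (f j)) x) \<partial>\<rho>)"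
    by (intro Bochner_Integration.integral_sum[symmetric])
      (auto intro!: integrable_mult_right int Bochner_Integration.integrable_sum)
  also have "\<dots> \<ge> 0" by (intro Bochner_Integration.integral_nonneg lft_Gamma_matrix_nonneg a(2))
  finally show ?thesis .
qed

text \<open>
  Since the lifted square fields are bounded, all of them are integrable with respect to finite
  configurations; with respect to infinite ones this will only hold almost surely.
\<close>

lemma carre_integrable_restrict:
  "a \<in> Cyl \<Longrightarrow> \<gamma> \<in> Conf \<Longrightarrow> E \<in> \<E> \<Longrightarrow> carre_integrable a (config_restrict E \<gamma>)"
  by (elim cylindersE) (auto intro!: restrict_integrable lft_Gamma_bounded)

lemma carre_integrable_on:
  assumes "a \<in> Cyl" "\<gamma> \<in> Conf_on E" "E \<in> \<E>"
  shows "carre_integrable a \<gamma>"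
proof -
  have \<gamma>: "\<gamma> \<in> Conf" "emeasure \<gamma> (- E) = 0" using assms(2) by (auto simp: configurations_on_def)
  have E: "E \<in> sets \<gamma>" "- E \<in> sets \<gamma>"
    using ring_sets[OF assms(3)] Compl_sets_m Conf_sets[OF \<gamma>(1)] by auto
  have "space \<gamma> = E \<union> - E" using Conf_space[OF \<gamma>(1)] by simp
  then have "emeasure \<gamma> (space \<gamma>) = emeasure \<gamma> E + emeasure \<gamma> (- E)"
    using E by (simp only:) (rule plus_emeasure[symmetric], auto)
  then have "emeasure \<gamma> (space \<gamma>) \<noteq> \<infinity>" using \<gamma> Conf_finite[OF \<gamma>(1) assms(3)] by simp
  then interpret finite_measure \<gamma> by (rule finite_measureI)
  have "integrable \<gamma> g" if g: "g \<in> bounded_measurable m" for g :: "'x \<Rightarrow> real"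
  proof -
    obtain B where B: "\<And>x. \<bar>g x\<bar> \<le> B" using g by (auto simp: bounded_measurable_def bounded_iff)
    have "g \<in> borel_measurable \<gamma>"
      using g Conf_sets[OF \<gamma>(1)] by (simp add: bounded_measurable_def cong: measurable_cong_sets)
    then show ?thesis using B by (intro integrable_const_bound[of _ B]) auto
  qed
  then show ?thesis using assms(1) by (elim cylindersE) (auto intro!: lft_Gamma_bounded)
qed

lemma gam_add_le:
  assumes "a \<in> Cyl" "b \<in> Cyl" "\<gamma> \<in> Conf" "E \<in> \<E>"
  defines "\<rho> \<equiv> config_restrict E \<gamma>"
  shows "gam (cyl_add a b) (cyl_add a b) \<gamma> \<rho> \<le> 2 * gam a a \<gamma> \<rho> + 2 * gam b b \<gamma> \<rho>"
proof -
  have "gam (cyl_add a b) (cyl_add a b) \<gamma> \<rho> = gam a a \<gamma> \<rho> + 2 * gam a b \<gamma> \<rho> + gam b b \<gamma> \<rho>"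
    using gam_sym[OF assms(1) cyl_add_in[OF assms(1,2)]] gam_sym[OF assms(2) cyl_add_in[OF assms(1,2)]]
      gam_sym[OF assms(1,2)] by (simp add: gam_add assms)
  moreover have "0 \<le> gam (cyl_diff a b) (cyl_diff a b) \<gamma> \<rho>"
    unfolding \<rho>_def by (intro gam_nonneg carre_integrable_restrict cyl_diff_in assms)
  ultimately show ?thesis using gam_diff_diff[OF assms(1,2), of \<gamma> \<rho>] by simp
qed

lemma gam_triangle:
  assumes "a \<in> Cyl" "b \<in> Cyl" "c \<in> Cyl" "\<gamma> \<in> Conf" "E \<in> \<E>"
  defines "\<rho> \<equiv> config_restrict E \<gamma>"
  shows "gam (cyl_diff a c) (cyl_diff a c) \<gamma> \<rho> \<le>
    2 * gam (cyl_diff a b) (cyl_diff a b) \<gamma> \<rho> + 2 * gam (cyl_diff b c) (cyl_diff b c) \<gamma> \<rho>"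
proof -
  let ?s = "cyl_add (cyl_diff a b) (cyl_diff b c)"
  have "gam ?s e \<gamma> \<rho> = gam (cyl_diff a c) e \<gamma> \<rho>" for e
    by (subst gam_add) (simp_all add: gam_diff cyl_diff_in assms)
  moreover have "?s \<in> Cyl" by (intro cyl_add_in cyl_diff_in assms)
  ultimately have "gam ?s ?s \<gamma> \<rho> = gam (cyl_diff a c) (cyl_diff a c) \<gamma> \<rho>"
    using gam_sym cyl_diff_in[OF assms(1,3)] by metis
  then show ?thesis
    using gam_add_le[OF cyl_diff_in[OF assms(1,2)] cyl_diff_in[OF assms(2,3)] assms(4,5)] unfolding \<rho>_def by simp
qed

lemma gam_diff_commute:
  assumes "a \<in> Cyl" "b \<in> Cyl"
  shows "gam (cyl_diff a b) (cyl_diff a b) \<gamma> \<rho> = gam (cyl_diff b a) (cyl_diff b a) \<gamma> \<rho>"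
  using assms gam_sym[OF assms] by (simp add: gam_diff_diff)

lemma gam_diff_le:
  assumes "a \<in> Cyl" "b \<in> Cyl" "\<gamma> \<in> Conf" "E \<in> \<E>"
  defines "\<rho> \<equiv> config_restrict E \<gamma>"
  shows "gam a a \<gamma> \<rho> \<le> 2 * gam (cyl_diff a b) (cyl_diff a b) \<gamma> \<rho> + 2 * gam b b \<gamma> \<rho>"
proof -
  let ?d = "cyl_diff a b" and ?e = "cyl_diff (cyl_diff a b) b"
  note d = cyl_diff_in[OF assms(1,2)]
  have "gam ?e ?e \<gamma> \<rho> = gam ?d ?d \<gamma> \<rho> - 2 * gam ?d b \<gamma> \<rho> + gam b b \<gamma> \<rho>"
    by (rule gam_diff_diff[OF d assms(2)])
  moreover have "gam ?d b \<gamma> \<rho> = gam a b \<gamma> \<rho> - gam b b \<gamma> \<rho>" by (rule gam_diff[OF assms(1,2)])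
  moreover have "0 \<le> gam ?e ?e \<gamma> \<rho>"
    unfolding \<rho>_def by (intro gam_nonneg carre_integrable_restrict cyl_diff_in assms)
  moreover have "gam ?d ?d \<gamma> \<rho> = gam a a \<gamma> \<rho> - 2 * gam a b \<gamma> \<rho> + gam b b \<gamma> \<rho>"
    by (rule gam_diff_diff[OF assms(1,2)])
  ultimately show ?thesis by (simp add: algebra_simps)
qed


subsection \<open>Measurability\<close>

lemma coordinates_measurable:
  assumes "F \<in> Cb_smooth k" "\<And>i. i < k \<Longrightarrow> f i \<in> \<D>"
  shows "(\<lambda>\<gamma>. F (\<lambda>i. \<integral>x. f i x \<partial>\<gamma>)) \<in> borel_measurable CS"
proof -
  have "F \<in> borel_measurable borel"
    by (rule borel_measurable_continuous_onI[OF Cb_smooth_continuous[OF assms(1)]])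
  moreover have "(\<lambda>\<gamma> i. if i < k then \<integral>x. f i x \<partial>\<gamma> else 0) \<in> borel_measurable CS"
  proof (rule measurable_coordinatewise_then_product)
    show "(\<lambda>\<gamma>. if i < k then \<integral>x. f i x \<partial>\<gamma> else 0) \<in> borel_measurable CS" for i
      by (cases "i < k") (auto intro!: measurable_integral_CS D_measurable assms(2))
  qed
  ultimately have "(\<lambda>\<gamma>. F (\<lambda>i. if i < k then \<integral>x. f i x \<partial>\<gamma> else 0)) \<in> borel_measurable CS"
    by (rule measurable_compose[rotated])
  moreover have "F (\<lambda>i. if i < k then \<integral>x. f i x \<partial>\<gamma> else 0) = F (\<lambda>i. \<integral>x. f i x \<partial>\<gamma>)" for \<gamma>
    by (rule Cb_smooth_dep[OF assms(1)]) simp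
  ultimately show ?thesis by simp
qed

lemma cyl_fun_measurable: "a \<in> Cyl \<Longrightarrow> cyl_fun a \<in> borel_measurable CS"
  by (elim cylindersE) (use coordinates_measurable in \<open>auto simp: fun_eq_iff cong: measurable_cong\<close>)

lemma gam_measurable:
  assumes "a \<in> Cyl" "b \<in> Cyl"
    and "\<And>g :: 'x \<Rightarrow> real. g \<in> borel_measurable m \<Longrightarrow> (\<lambda>\<gamma>. \<integral>x. g x \<partial>(R \<gamma>)) \<in> borel_measurable CS"
  shows "(\<lambda>\<gamma>. gam a b \<gamma> (R \<gamma>)) \<in> borel_measurable CS"
proof -
  obtain k F f where a: "a = (k, F, f)" "F \<in> Cb_smooth k" "\<And>i. i < k \<Longrightarrow> f i \<in> \<D>"
    by (rule cylindersE[OF assms(1)]) blast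
  obtain l G g where b: "b = (l, G, g)" "G \<in> Cb_smooth l" "\<And>i. i < l \<Longrightarrow> g i \<in> \<D>"
    by (rule cylindersE[OF assms(2)]) blast
  show ?thesis unfolding a(1) b(1) gam.simps
    by (intro borel_measurable_sum borel_measurable_times coordinates_measurable[OF Cb_smooth_partial[OF a(2)]]
       coordinates_measurable[OF Cb_smooth_partial[OF b(2)]] assms(3) lft_Gamma_measurable)
      (auto intro: a(3) b(3))
qed

lemma cyl_Gamma_measurable:
  "a \<in> Cyl \<Longrightarrow> b \<in> Cyl \<Longrightarrow> cyl_Gamma \<Gamma> lft a b \<in> borel_measurable CS"
  unfolding cyl_Gamma_gam[abs_def] by (intro gam_measurable measurable_integral_CS)

lemma gam_restrict_measurable:
  assumes "a \<in> Cyl" "b \<in> Cyl" "E \<in> sets m"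
  shows "(\<lambda>\<gamma>. gam a b \<gamma> (config_restrict E \<gamma>)) \<in> borel_measurable CS"
proof (rule gam_measurable[OF assms(1,2)])
  note [measurable] = assms(3)
  fix g :: "'x \<Rightarrow> real" assume g [measurable]: "g \<in> borel_measurable m"
  have "(\<lambda>\<gamma>. \<integral>x. indicator E x * g x \<partial>\<gamma>) \<in> borel_measurable CS"
    by (intro measurable_integral_CS) measurable
  then show "(\<lambda>\<gamma>. \<integral>x. g x \<partial>config_restrict E \<gamma>) \<in> borel_measurable CS"
    by (rule measurable_cong[THEN iffD1, rotated])
      (use g assms(3) in \<open>simp add: space_CS integral_config_restrict(1)\<close>)
qed

subsection \<open>Conditioning\<close>

lemma cyl_cond_arg:
  assumes "\<gamma> \<in> Conf" "E \<in> sets m" "config_restrict (- E) \<gamma> = config_restrict (- E) \<eta>" "f \<in> \<D>"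
  shows "(\<integral>x. f x \<partial>config_restrict E \<gamma>) + (\<integral>x. f x \<partial>config_restrict (- E) \<eta>) = (\<integral>x. f x \<partial>\<gamma>)"
  using integral_split[OF assms(1,2) D_measurable[OF assms(4)] D_integrable[OF assms(4,1)]] assms(3) by simp

lemma cyl_fun_cond:
  assumes "\<gamma> \<in> Conf" "E \<in> sets m" "config_restrict (- E) \<gamma> = config_restrict (- E) \<eta>" "a \<in> Cyl"
  shows "cyl_fun (cyl_cond E \<eta> a) (config_restrict E \<gamma>) = cyl_fun a \<gamma>"
proof -
  obtain k F f where a: "a = (k, F, f)" "F \<in> Cb_smooth k" "\<And>i. i < k \<Longrightarrow> f i \<in> \<D>"
    by (rule cylindersE[OF assms(4)]) blast
  show ?thesis unfolding a cyl_cond.simps cyl_fun.simps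
    by (rule Cb_smooth_dep[OF a(2)]) (rule cyl_cond_arg[OF assms(1-3) a(3)])
qed

lemma cyl_Gamma_cond:
  assumes "\<gamma> \<in> Conf" "E \<in> sets m" "config_restrict (- E) \<gamma> = config_restrict (- E) \<eta>"
    "a \<in> Cyl" "b \<in> Cyl"
  shows "cyl_Gamma \<Gamma> lft (cyl_cond E \<eta> a) (cyl_cond E \<eta> b) (config_restrict E \<gamma>) =
    gam a b \<gamma> (config_restrict E \<gamma>)"
proof -
  obtain k F f where a: "a = (k, F, f)" "F \<in> Cb_smooth k" "\<And>i. i < k \<Longrightarrow> f i \<in> \<D>"
    by (rule cylindersE[OF assms(4)]) blast
  obtain l G g where b: "b = (l, G, g)" "G \<in> Cb_smooth l" "\<And>i. i < l \<Longrightarrow> g i \<in> \<D>"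
    by (rule cylindersE[OF assms(5)]) blast
  have *: "partial_deriv i (\<lambda>x. F (\<lambda>i. x i + c i)) x = partial_deriv i F (\<lambda>i. x i + c i)"
    for i c x and F :: "(nat \<Rightarrow> real) \<Rightarrow> real"
    using partial_deriv_reindex[of i F 0 c x] by simp
  note tr_F = *[of _ F "\<lambda>i. \<integral>y. f i y \<partial>config_restrict (- E) \<eta>"]
  note tr_G = *[of _ G "\<lambda>i. \<integral>y. g i y \<partial>config_restrict (- E) \<eta>"]
  have 1: "partial_deriv i F (\<lambda>i. (\<integral>x. f i x \<partial>config_restrict E \<gamma>) + (\<integral>x. f i x \<partial>config_restrict (- E) \<eta>)) =
    partial_deriv i F (\<lambda>i. \<integral>x. f i x \<partial>\<gamma>)" if "i < k" for i
    by (rule Cb_smooth_dep[OF Cb_smooth_partial[OF a(2) that]]) (rule cyl_cond_arg[OF assms(1-3) a(3)])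
  have 2: "partial_deriv i G (\<lambda>i. (\<integral>x. g i x \<partial>config_restrict E \<gamma>) + (\<integral>x. g i x \<partial>config_restrict (- E) \<eta>)) =
    partial_deriv i G (\<lambda>i. \<integral>x. g i x \<partial>\<gamma>)" if "i < l" for i
    by (rule Cb_smooth_dep[OF Cb_smooth_partial[OF b(2) that]]) (rule cyl_cond_arg[OF assms(1-3) b(3)])
  show ?thesis unfolding a(1) b(1) cyl_cond.simps cyl_Gamma.simps gam.simps tr_F tr_G
    by (intro sum.cong refl) (simp add: 1 2)
qed

lemma cyl_cond_diff:
  assumes "a \<in> Cyl" "b \<in> Cyl"
  shows "cyl_cond E \<eta> (cyl_diff a b) = cyl_diff (cyl_cond E \<eta> a) (cyl_cond E \<eta> b)"
proof -
  obtain k F f where a: "a = (k, F, f)" "F \<in> Cb_smooth k" by (rule cylindersE[OF assms(1)])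
  obtain l G g where b: "b = (l, G, g)" by (cases b)
  have "F (\<lambda>i. x i + (\<integral>y. (if i < k then f i else g (i - k)) y \<partial>config_restrict (- E) \<eta>)) =
    F (\<lambda>i. x i + (\<integral>y. f i y \<partial>config_restrict (- E) \<eta>))" for x
    by (rule Cb_smooth_dep[OF a(2)]) simp
  then show ?thesis by (simp add: a(1) b cyl_diff_def)
qed

end

subsection \<open>Forms on classes of cylinder functions\<close>

lemma cyl_form_eq:
  assumes wd: "cyl_form_well_defined \<D> \<Gamma> lft \<nu>" and ab: "a \<in> cylinders \<D>" "b \<in> cylinders \<D>"
    and "AE \<gamma> in \<nu>. u \<gamma> = cyl_fun a \<gamma>" "AE \<gamma> in \<nu>. v \<gamma> = cyl_fun b \<gamma>"
  shows "cyl_form \<D> \<Gamma> lft \<nu> u v = (\<integral>\<gamma>. cyl_Gamma \<Gamma> lft a b \<gamma> \<partial>\<nu>)"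
  unfolding cyl_form_def
proof (rule the_equality)
  fix c
  assume "\<exists>a\<in>cylinders \<D>. \<exists>b\<in>cylinders \<D>. (AE \<gamma> in \<nu>. u \<gamma> = cyl_fun a \<gamma>) \<and>
    (AE \<gamma> in \<nu>. v \<gamma> = cyl_fun b \<gamma>) \<and> c = (\<integral>\<gamma>. cyl_Gamma \<Gamma> lft a b \<gamma> \<partial>\<nu>)"
  then obtain a' b' where ab': "a' \<in> cylinders \<D>" "b' \<in> cylinders \<D>"
    "AE \<gamma> in \<nu>. u \<gamma> = cyl_fun a' \<gamma>" "AE \<gamma> in \<nu>. v \<gamma> = cyl_fun b' \<gamma>"
    "c = (\<integral>\<gamma>. cyl_Gamma \<Gamma> lft a' b' \<gamma> \<partial>\<nu>)" by blast
  have "AE \<gamma> in \<nu>. cyl_fun a' \<gamma> = cyl_fun a \<gamma>" using assms(4) ab'(3) by eventually_elim simp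
  moreover have "AE \<gamma> in \<nu>. cyl_fun b' \<gamma> = cyl_fun b \<gamma>" using assms(5) ab'(4) by eventually_elim simp
  ultimately show "c = (\<integral>\<gamma>. cyl_Gamma \<Gamma> lft a b \<gamma> \<partial>\<nu>)"
    using wd ab ab' unfolding cyl_form_well_defined_def by blast
qed (use assms in blast)

section \<open>Closability\<close>

text \<open>
  A probability measure on configurations with regular conditional probabilities that satisfies the
  conditional closability assumption, which includes conditional absolute continuity.
\<close>

locale cond_closable_measure = lifted_diffusion_space m \<E> \<D> \<Gamma> lft + mu: prob_space \<mu>
  for m :: "'x::t2_space measure" and \<E> \<D> \<Gamma> lft and \<mu> :: "'x measure measure" +
  fixes \<kappa> :: "'x set \<Rightarrow> 'x measure \<Rightarrow> 'x measure measure"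
  assumes space_mu: "space \<mu> = configurations m \<E>"
    and sets_mu: "sets \<mu> = sets (config_space m \<E>)"
    and regular_cond: "\<And>E. E \<in> \<E> \<Longrightarrow> regular_cond_prob m \<E> \<mu> E (\<kappa> E)"
    and cond_closable: "cond_closability m \<E> \<D> \<Gamma> lft \<kappa> \<mu>"
begin

lemma measurable_mu: "f \<in> CS \<rightarrow>\<^sub>M N \<Longrightarrow> f \<in> \<mu> \<rightarrow>\<^sub>M N"
  using sets_mu by (simp cong: measurable_cong_sets)

subsection \<open>Disintegration\<close>

text \<open>The conditional probability given \<open>\<eta>\<close> outside \<open>E\<close>, on configurations on the whole space.\<close>

definition K :: "'x set \<Rightarrow> 'x measure \<Rightarrow> 'x measure measure" where
  "K E \<eta> = \<kappa> E (config_restrict (- E) \<eta>)"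

abbreviation proj where "proj \<equiv> projected_cond_prob m \<E> \<kappa>"

lemma proj_K: "proj E \<eta> = distr (K E \<eta>) (CS_on E) (config_restrict E)"
  by (simp add: projected_cond_prob_def K_def)

lemma restrict_Compl_measurable: "E \<in> \<E> \<Longrightarrow> config_restrict (- E) \<in> \<mu> \<rightarrow>\<^sub>M CS_on (- E)"
  by (intro measurable_mu measurable_config_restrict Compl_sets_m ring_sets)

lemma K_measurable_prob: "E \<in> \<E> \<Longrightarrow> K E \<in> \<mu> \<rightarrow>\<^sub>M prob_algebra CS"
  unfolding K_def
  using regular_cond[of E] restrict_Compl_measurable[of E]
  by (auto simp: regular_cond_prob_def intro: measurable_compose[of "config_restrict (- E)"])

lemma K_measurable: "E \<in> \<E> \<Longrightarrow> K E \<in> \<mu> \<rightarrow>\<^sub>M subprob_algebra CS"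
  using K_measurable_prob measurable_prob_algebraD by blast

lemma K_prob:
  assumes "E \<in> \<E>" "\<eta> \<in> Conf" shows "prob_space (K E \<eta>)" "sets (K E \<eta>) = sets CS" "space (K E \<eta>) = Conf"
proof -
  have "K E \<eta> \<in> space (prob_algebra CS)"
    using measurable_space[OF K_measurable_prob[OF assms(1)]] assms(2) space_mu by simp
  then show "prob_space (K E \<eta>)" "sets (K E \<eta>) = sets CS" by (auto simp: space_prob_algebra)
  then show "space (K E \<eta>) = Conf" using sets_eq_imp_space_eq space_CS by metis
qed

lemma measurable_K: "E \<in> \<E> \<Longrightarrow> \<eta> \<in> Conf \<Longrightarrow> f \<in> CS \<rightarrow>\<^sub>M N \<Longrightarrow> f \<in> K E \<eta> \<rightarrow>\<^sub>M N"
  using K_prob(2) by (simp cong: measurable_cong_sets)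

lemma Conf_nonempty: "Conf \<noteq> {}"
  using mu.not_empty space_mu by simp

lemma disintegration: "E \<in> \<E> \<Longrightarrow> \<mu> = \<mu> \<bind> K E"
proof (rule measure_eqI)
  assume E: "E \<in> \<E>"
  show "sets \<mu> = sets (\<mu> \<bind> K E)"
    using sets_mu K_prob(2)[OF E] Conf_nonempty by (subst sets_bind[where N = CS]) (auto simp: space_mu)
  fix A assume "A \<in> sets \<mu>"
  then have A: "A \<in> sets CS" by (simp add: sets_mu)
  let ?r = "config_restrict (- E)" and ?N = "CS_on (- E)"
  have r: "?r \<in> \<mu> \<rightarrow>\<^sub>M ?N" by (rule restrict_Compl_measurable[OF E])
  have A_sub: "A \<subseteq> Conf" using sets.sets_into_space[OF A] by (simp add: space_CS)
  have k: "\<kappa> E \<in> ?N \<rightarrow>\<^sub>M subprob_algebra CS"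
    using regular_cond[OF E] measurable_prob_algebraD by (auto simp: regular_cond_prob_def)
  have "{\<gamma> \<in> A. ?r \<gamma> \<in> space ?N} = A"
    using A_sub measurable_space[OF r] by (auto simp: space_mu)
  then have "emeasure \<mu> A = (\<integral>\<^sup>+\<zeta>\<in>space ?N. emeasure (\<kappa> E \<zeta>) A \<partial>distr \<mu> ?N ?r)"
    using regular_cond[OF E, unfolded regular_cond_prob_def, THEN conjunct2, THEN conjunct1, THEN bspec, OF A,
      THEN bspec, OF sets.top] by simp
  also have "\<dots> = (\<integral>\<^sup>+\<zeta>. emeasure (\<kappa> E \<zeta>) A \<partial>distr \<mu> ?N ?r)"
    by (intro nn_integral_cong) auto
  also have "\<dots> = (\<integral>\<^sup>+\<eta>. emeasure (K E \<eta>) A \<partial>\<mu>)"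
    unfolding K_def using r measurable_emeasure_subprob_algebra[OF A] k
    by (subst nn_integral_distr) (auto intro: measurable_compose[of "\<kappa> E"])
  also have "\<dots> = emeasure (\<mu> \<bind> K E) A"
    using mu.not_empty K_measurable[OF E] A by (simp add: emeasure_bind)
  finally show "emeasure \<mu> A = emeasure (\<mu> \<bind> K E) A" .
qed

lemma nn_integral_disintegration:
  assumes "E \<in> \<E>" "f \<in> borel_measurable CS"
  shows "(\<integral>\<^sup>+\<gamma>. f \<gamma> \<partial>\<mu>) = (\<integral>\<^sup>+\<eta>. \<integral>\<^sup>+\<gamma>. f \<gamma> \<partial>K E \<eta> \<partial>\<mu>)"
  by (simp only: nn_integral_bind[OF assms(2) K_measurable[OF assms(1)], symmetric]
      disintegration[OF assms(1), symmetric])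

lemma inner_integral_measurable:
  assumes "E \<in> \<E>" "f \<in> borel_measurable CS"
  shows "(\<lambda>\<eta>. \<integral>\<^sup>+\<gamma>. f \<gamma> \<partial>K E \<eta>) \<in> borel_measurable \<mu>"
  by (rule measurable_compose[OF K_measurable[OF assms(1)] nn_integral_measurable_subprob_algebra[OF assms(2)]])

lemma AE_consistent:
  assumes E: "E \<in> \<E>"
  shows "AE \<eta> in \<mu>. AE \<gamma> in K E \<eta>. config_restrict (- E) \<gamma> = config_restrict (- E) \<eta>"
  using regular_cond[OF E] AE_distrD[OF restrict_Compl_measurable[OF E]]
  unfolding regular_cond_prob_def K_def by blast

subsection \<open>Null sets of the base space\<close>

text \<open>A localizing sequence as in the conditional closability assumption.\<close>

definition L :: "nat \<Rightarrow> 'x set" where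
  "L = (SOME E. cond_abs_continuous_along m \<E> \<kappa> \<mu> E \<and>
        (\<forall>h. AE \<eta> in \<mu>. cyl_form_well_defined \<D> \<Gamma> lft (proj (E h) \<eta>) \<and>
           form_closable (proj (E h) \<eta>) (cyl_classes \<D> (proj (E h) \<eta>)) (cyl_form \<D> \<Gamma> lft (proj (E h) \<eta>))))"

lemma L_props: "cond_abs_continuous_along m \<E> \<kappa> \<mu> L"
    "AE \<eta> in \<mu>. cyl_form_well_defined \<D> \<Gamma> lft (proj (L h) \<eta>) \<and>
       form_closable (proj (L h) \<eta>) (cyl_classes \<D> (proj (L h) \<eta>)) (cyl_form \<D> \<Gamma> lft (proj (L h) \<eta>))"
  using someI_ex[OF conjunct2[OF cond_closable[unfolded cond_closability_def Let_def]], folded L_def]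
  by blast+

lemma L_loc: "localizing_sequence m \<E> L"
  using L_props(1) by (simp add: cond_abs_continuous_along_def)

lemmas L = localizing_sequenceD[OF L_loc]

lemma AE_null:
  assumes N: "N \<in> sets m" "emeasure m N = 0"
  shows "AE \<gamma> in \<mu>. emeasure \<gamma> N = 0"
proof -
  have "AE \<gamma> in \<mu>. emeasure \<gamma> (L h \<inter> N) = 0" for h
  proof -
    let ?E = "L h"
    let ?B = "{\<gamma>\<in>Conf_on ?E. emeasure \<gamma> N \<noteq> 0}"
    have EN: "?E \<inter> N \<in> sets m" using L(2) N by blast
    have ac: "AE \<eta> in \<mu>. absolutely_continuous (poisson_measure m \<E> ?E) (proj ?E \<eta>)"
      using L_props(1) by (auto simp: cond_abs_continuous_along_def elim: AE_mp)
    have "AE \<eta> in \<mu>. AE \<gamma> in K ?E \<eta>. emeasure \<gamma> (?E \<inter> N) = 0"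
      using ac AE_space
    proof eventually_elim
      case (elim \<eta>)
      then have \<eta>: "\<eta> \<in> Conf" by (simp add: space_mu)
      have r: "config_restrict ?E \<in> K ?E \<eta> \<rightarrow>\<^sub>M CS_on ?E"
        by (intro measurable_K L(1) \<eta> measurable_config_restrict L(2))
      have "?B \<in> null_sets (proj ?E \<eta>)"
        using elim(1) poisson_null[OF L(1) N] by (auto simp: absolutely_continuous_def)
      then have "config_restrict ?E -` ?B \<inter> space (K ?E \<eta>) \<in> null_sets (K ?E \<eta>)"
        unfolding proj_K using r by (simp add: null_sets_distr_iff)
      then have "AE \<gamma> in K ?E \<eta>. \<gamma> \<notin> config_restrict ?E -` ?B \<inter> space (K ?E \<eta>)" by (rule AE_not_in)
      with AE_space show ?case
      proof eventually_elim
        case (elim \<gamma>)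
        then have \<gamma>: "\<gamma> \<in> Conf" using K_prob(3)[OF L(1) \<eta>] by simp
        then have "emeasure (config_restrict ?E \<gamma>) N = 0"
          using elim Conf_restrict(1)[OF \<gamma> L(2)] by simp
        then show ?case using \<gamma> L(2) N by (simp add: emeasure_config_restrict Conf_sets)
      qed
    qed
    moreover have "Measurable.pred CS (\<lambda>\<gamma>. emeasure \<gamma> (?E \<inter> N) = 0)"
      using measurable_emeasure_CS[OF EN] by measurable
    ultimately have "AE \<gamma> in \<mu> \<bind> K ?E. emeasure \<gamma> (?E \<inter> N) = 0"
      by (subst AE_bind[OF K_measurable[OF L(1)]]) auto
    then show ?thesis by (simp only: disintegration[OF L(1), symmetric])
  qed
  then have "AE \<gamma> in \<mu>. \<forall>h. emeasure \<gamma> (L h \<inter> N) = 0" by (simp add: AE_all_countable)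
  with AE_space show ?thesis
  proof eventually_elim
    case (elim \<gamma>)
    then have \<gamma>: "\<gamma> \<in> Conf" by (simp add: space_mu)
    have "(\<Union>h. L h \<inter> N) = N" using L(4) by auto
    moreover have "emeasure \<gamma> (\<Union>h. L h \<inter> N) = 0"
      using elim L(2) N Conf_sets[OF \<gamma>] by (intro emeasure_UN_eq_0) auto
    ultimately show ?case by simp
  qed
qed

subsection \<open>Integrability of the square field\<close>

text \<open>
  Almost surely, \<open>\<gamma>\<close> does not see the null set on which the lifting of \<open>\<Gamma>(f, g)\<close> differs from a
  representative supported in the localizing ring.
\<close>

lemma lft_Gamma_AE_bound:
  assumes "f \<in> \<D>" "g \<in> \<D>"
  shows "\<exists>E\<in>\<E>. \<exists>B\<ge>0. AE \<gamma> in \<mu>. integrable \<gamma> (lft (\<Gamma> f g)) \<and>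
    \<bar>\<integral>x. lft (\<Gamma> f g) x \<partial>\<gamma>\<bar> \<le> B * enn2real (emeasure \<gamma> E)"
proof -
  obtain h where h: "h \<in> bounded_measurable m" "h \<in> vanishing_outside \<E>" "AE x in m. \<Gamma> f g x = h x"
    using Gamma_local[OF assms] by blast
  obtain E where E: "E \<in> \<E>" "\<And>x. x \<notin> E \<Longrightarrow> h x = 0" using h(2) by (auto simp: vanishing_outside_def)
  obtain B where B: "\<And>x. \<bar>h x\<bar> \<le> B" using h(1) by (auto simp: bounded_measurable_def bounded_iff)
  have hm: "h \<in> borel_measurable m" "bounded (range h)" using h(1) by (auto simp: bounded_measurable_def)
  note lm = lft_Gamma_measurable[OF assms]
  define N where "N = {x. lft (\<Gamma> f g) x \<noteq> h x}"
  have "{x\<in>space m. lft (\<Gamma> f g) x \<noteq> h x} \<in> sets m" using lm hm by measurable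
  then have N: "N \<in> sets m" by (simp add: N_def space_m)
  have "AE x in m. lft (\<Gamma> f g) x = \<Gamma> f g x"
    using lifting[unfolded strong_lifting_def, THEN conjunct1] Gamma_Linf[OF assms] by blast
  with h(3) have "AE x in m. lft (\<Gamma> f g) x = h x" by eventually_elim simp
  then have "emeasure m N = 0" using N by (subst (asm) AE_iff_measurable[OF N]) (auto simp: N_def space_m)
  then have "AE \<gamma> in \<mu>. emeasure \<gamma> N = 0" by (rule AE_null[OF N])
  with AE_space have "AE \<gamma> in \<mu>. integrable \<gamma> (lft (\<Gamma> f g)) \<and>
    \<bar>\<integral>x. lft (\<Gamma> f g) x \<partial>\<gamma>\<bar> \<le> B * enn2real (emeasure \<gamma> E)"
  proof eventually_elim
    case (elim \<gamma>)
    then have \<gamma>: "\<gamma> \<in> Conf" by (simp add: space_mu)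
    note [simp] = Conf_sets[OF \<gamma>]
    have me: "lft (\<Gamma> f g) \<in> borel_measurable \<gamma>" "h \<in> borel_measurable \<gamma>"
      using lm hm by (simp_all cong: measurable_cong_sets)
    have ae: "AE x in \<gamma>. h x = lft (\<Gamma> f g) x"
      using elim(2) N by (intro AE_I[where N = N]) (auto simp: N_def)
    have ih: "integrable \<gamma> h" by (rule Conf_integrable[OF \<gamma> hm h(2)])
    have Es: "E \<in> sets \<gamma>" using ring_sets[OF E(1)] by simp
    have fin: "emeasure \<gamma> E < \<infinity>" by (rule Conf_finite[OF \<gamma> E(1)])
    have "\<bar>\<integral>x. h x \<partial>\<gamma>\<bar> \<le> (\<integral>x. \<bar>h x\<bar> \<partial>\<gamma>)" by (rule integral_abs_bound)
    also have "\<dots> \<le> (\<integral>x. B * indicator E x \<partial>\<gamma>)"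
    proof (rule integral_mono)
      show "integrable \<gamma> (\<lambda>x. B * indicator E x)" using Es fin by (auto simp: less_top)
      show "\<bar>h x\<bar> \<le> B * indicator E x" for x using E(2)[of x] B[of x] by (auto simp: indicator_def)
    qed (use ih in simp)
    also have "\<dots> = B * enn2real (emeasure \<gamma> E)" using Es by (simp add: measure_def)
    finally have "\<bar>\<integral>x. h x \<partial>\<gamma>\<bar> \<le> B * enn2real (emeasure \<gamma> E)" .
    then show ?case
      using integrable_cong_AE_imp[OF ih me(1) ae] integral_cong_AE[OF me(2,1) ae] by simp
  qed
  moreover have "B \<ge> 0" using B[of undefined] by (rule order_trans[OF abs_ge_zero])
  ultimately show ?thesis using E(1) by blast
qed

lemma AE_carre_integrable:
  assumes "a \<in> Cyl" shows "AE \<gamma> in \<mu>. carre_integrable a \<gamma>"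
proof -
  obtain k F f where a: "a = (k, F, f)" "F \<in> Cb_smooth k" "\<And>i. i < k \<Longrightarrow> f i \<in> \<D>"
    by (rule cylindersE[OF assms]) blast
  have "AE \<gamma> in \<mu>. integrable \<gamma> (lft (\<Gamma> (f i) (f j)))" if "i < k" "j < k" for i j
    using lft_Gamma_AE_bound[OF a(3) a(3), OF that] by (auto elim: AE_mp)
  then have "AE \<gamma> in \<mu>. \<forall>i\<in>{..<k}. \<forall>j\<in>{..<k}. integrable \<gamma> (lft (\<Gamma> (f i) (f j)))"
    by (intro AE_ball_countable[THEN iffD2] ballI) auto
  then show ?thesis by (rule AE_mp) (simp add: a(1))
qed

lemma AE_gam_nonneg: "a \<in> Cyl \<Longrightarrow> AE \<gamma> in \<mu>. 0 \<le> gam a a \<gamma> \<gamma>"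
  using AE_carre_integrable[of a] by (auto intro: gam_nonneg elim: eventually_mono)

lemma integral_lft_Gamma_integrable:
  assumes "f \<in> \<D>" "g \<in> \<D>"
  shows "integrable \<mu> (\<lambda>\<gamma>. \<integral>x. lft (\<Gamma> f g) x \<partial>\<gamma>)"
proof -
  obtain E B where E: "E \<in> \<E>" and B: "B \<ge> 0"
    and bd: "AE \<gamma> in \<mu>. \<bar>\<integral>x. lft (\<Gamma> f g) x \<partial>\<gamma>\<bar> \<le> B * enn2real (emeasure \<gamma> E)"
    using lft_Gamma_AE_bound[OF assms] by (auto elim!: AE_mp)
  have me: "(\<lambda>\<gamma>. emeasure \<gamma> E) \<in> borel_measurable \<mu>"
    by (intro measurable_mu measurable_emeasure_ring E)
  have "integrable \<mu> (\<lambda>\<gamma>. enn2real (emeasure \<gamma> E))"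
  proof (rule integrableI_nonneg)
    have "(\<integral>\<^sup>+\<gamma>. ennreal (enn2real (emeasure \<gamma> E)) \<partial>\<mu>) = (\<integral>\<^sup>+\<gamma>. emeasure \<gamma> E \<partial>\<mu>)"
      using Conf_finite[OF _ E] by (intro nn_integral_cong) (auto simp: space_mu)
    also have "\<dots> < \<infinity>" using cond_closable E by (auto simp: cond_closability_def)
    finally show "(\<integral>\<^sup>+\<gamma>. ennreal (enn2real (emeasure \<gamma> E)) \<partial>\<mu>) < \<infinity>" .
  qed (use me in auto)
  then have "integrable \<mu> (\<lambda>\<gamma>. B * enn2real (emeasure \<gamma> E))" by simp
  then show ?thesis
  proof (rule Bochner_Integration.integrable_bound)
    show "(\<lambda>\<gamma>. \<integral>x. lft (\<Gamma> f g) x \<partial>\<gamma>) \<in> borel_measurable \<mu>"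
      by (intro measurable_mu measurable_integral_CS lft_Gamma_measurable assms)
    show "AE \<gamma> in \<mu>. norm (\<integral>x. lft (\<Gamma> f g) x \<partial>\<gamma>) \<le> norm (B * enn2real (emeasure \<gamma> E))"
      using bd by (rule AE_mp) auto
  qed
qed

lemma cyl_Gamma_integrable:
  assumes "a \<in> Cyl" "b \<in> Cyl"
  shows "integrable \<mu> (cyl_Gamma \<Gamma> lft a b)"
proof -
  obtain k F f where a: "a = (k, F, f)" "F \<in> Cb_smooth k" "\<And>i. i < k \<Longrightarrow> f i \<in> \<D>"
    by (rule cylindersE[OF assms(1)]) blast
  obtain l G g where b: "b = (l, G, g)" "G \<in> Cb_smooth l" "\<And>i. i < l \<Longrightarrow> g i \<in> \<D>"
    by (rule cylindersE[OF assms(2)]) blast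
  have "integrable \<mu> (\<lambda>\<gamma>. partial_deriv i F (\<lambda>i. \<integral>x. f i x \<partial>\<gamma>) * partial_deriv j G (\<lambda>j. \<integral>x. g j x \<partial>\<gamma>) *
        (\<integral>x. lft (\<Gamma> (f i) (g j)) x \<partial>\<gamma>))" if "i < k" "j < l" for i j
  proof -
    note pF = Cb_smooth_partial[OF a(2) that(1)] and pG = Cb_smooth_partial[OF b(2) that(2)]
    obtain B C where B: "\<And>x. \<bar>partial_deriv i F x\<bar> \<le> B" and C: "\<And>x. \<bar>partial_deriv j G x\<bar> \<le> C"
      using Cb_smooth_bounded[OF pF] Cb_smooth_bounded[OF pG] by (auto simp: bounded_iff)
    have int: "integrable \<mu> (\<lambda>\<gamma>. B * C * (\<integral>x. lft (\<Gamma> (f i) (g j)) x \<partial>\<gamma>))"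
      by (intro integrable_mult_right integral_lft_Gamma_integrable a(3) b(3) that)
    show ?thesis
    proof (rule Bochner_Integration.integrable_bound[OF int])
      show "(\<lambda>\<gamma>. partial_deriv i F (\<lambda>i. \<integral>x. f i x \<partial>\<gamma>) * partial_deriv j G (\<lambda>j. \<integral>x. g j x \<partial>\<gamma>) *
        (\<integral>x. lft (\<Gamma> (f i) (g j)) x \<partial>\<gamma>)) \<in> borel_measurable \<mu>"
        by (intro borel_measurable_times measurable_mu coordinates_measurable[OF pF a(3)]
            coordinates_measurable[OF pG b(3)] measurable_integral_CS lft_Gamma_measurable a(3) b(3) that)
      have "\<bar>partial_deriv i F x * partial_deriv j G y\<bar> \<le> \<bar>B * C\<bar>" for x y
        using mult_mono[OF B[of x] C[of y]] B[of x] C[of y] by (simp add: abs_mult)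
      then show "AE \<gamma> in \<mu>. norm (partial_deriv i F (\<lambda>i. \<integral>x. f i x \<partial>\<gamma>) * partial_deriv j G (\<lambda>j. \<integral>x. g j x \<partial>\<gamma>) *
        (\<integral>x. lft (\<Gamma> (f i) (g j)) x \<partial>\<gamma>)) \<le> norm (B * C * (\<integral>x. lft (\<Gamma> (f i) (g j)) x \<partial>\<gamma>))"
        unfolding norm_mult[of "_ * _" "integral\<^sup>L _ _"] by (intro AE_I2 mult_right_mono) auto
    qed
  qed
  then show ?thesis
    unfolding a(1) b(1) cyl_Gamma.simps[abs_def] by (intro Bochner_Integration.integrable_sum) auto
qed

subsection \<open>Conditional energies\<close>

text \<open>
  Energies and squared norms are taken in \<^typ>\<open>ennreal\<close>, so that they can be disintegrated and Fatou's
  lemma applies without integrability assumptions.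
\<close>

abbreviation energy :: "'x cylinder \<Rightarrow> ennreal" where
  "energy a \<equiv> \<integral>\<^sup>+\<gamma>. ennreal (gam a a \<gamma> \<gamma>) \<partial>\<mu>"

text \<open>The energy of \<open>a\<close> in the directions of the points inside \<open>E\<close>, given the points outside.\<close>

definition cond_energy :: "'x set \<Rightarrow> 'x cylinder \<Rightarrow> 'x measure \<Rightarrow> ennreal" where
  "cond_energy E a \<eta> = (\<integral>\<^sup>+\<gamma>. ennreal (gam a a \<gamma> (config_restrict E \<gamma>)) \<partial>K E \<eta>)"

text \<open>The conditional squared \<open>L\<^sup>2\<close>-norm.\<close>

definition cond_norm :: "'x set \<Rightarrow> 'x cylinder \<Rightarrow> 'x measure \<Rightarrow> ennreal" where
  "cond_norm E a \<eta> = (\<integral>\<^sup>+\<gamma>. ennreal ((cyl_fun a \<gamma>)\<^sup>2) \<partial>K E \<eta>)"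

lemma gam_restrict_ennreal_measurable:
  "E \<in> \<E> \<Longrightarrow> a \<in> Cyl \<Longrightarrow> (\<lambda>\<gamma>. ennreal (gam a a \<gamma> (config_restrict E \<gamma>))) \<in> borel_measurable CS"
  using gam_restrict_measurable[of a a E] ring_sets by auto

lemma cyl_fun_square_measurable:
  "a \<in> Cyl \<Longrightarrow> (\<lambda>\<gamma>. ennreal ((cyl_fun a \<gamma>)\<^sup>2)) \<in> borel_measurable CS"
  using cyl_fun_measurable[of a] by measurable

lemma cond_energy_measurable: "E \<in> \<E> \<Longrightarrow> a \<in> Cyl \<Longrightarrow> cond_energy E a \<in> borel_measurable \<mu>"
  unfolding cond_energy_def[abs_def] by (intro inner_integral_measurable gam_restrict_ennreal_measurable)

lemma cond_norm_measurable: "E \<in> \<E> \<Longrightarrow> a \<in> Cyl \<Longrightarrow> cond_norm E a \<in> borel_measurable \<mu>"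
  unfolding cond_norm_def[abs_def] by (intro inner_integral_measurable cyl_fun_square_measurable)

lemma integral_cond_norm:
  "E \<in> \<E> \<Longrightarrow> a \<in> Cyl \<Longrightarrow> (\<integral>\<^sup>+\<eta>. cond_norm E a \<eta> \<partial>\<mu>) = (\<integral>\<^sup>+\<gamma>. ennreal ((cyl_fun a \<gamma>)\<^sup>2) \<partial>\<mu>)"
  unfolding cond_norm_def by (rule nn_integral_disintegration[symmetric, OF _ cyl_fun_square_measurable])

lemma gam_split:
  assumes "a \<in> Cyl" "\<gamma> \<in> Conf" "A \<in> sets m" "carre_integrable a \<gamma>"
  shows "gam a a \<gamma> \<gamma> = gam a a \<gamma> (config_restrict A \<gamma>) + gam a a \<gamma> (config_restrict (- A) \<gamma>)"
    and "carre_integrable a (config_restrict A \<gamma>)"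
proof -
  obtain k F f where a: "a = (k, F, f)" "F \<in> Cb_smooth k" "\<And>i. i < k \<Longrightarrow> f i \<in> \<D>"
    by (rule cylindersE[OF assms(1)]) blast
  have int: "integrable \<gamma> (lft (\<Gamma> (f i) (f j)))" if "i < k" "j < k" for i j
    using assms(4) that by (simp add: a(1))
  have *: "(\<integral>x. lft (\<Gamma> (f i) (f j)) x \<partial>\<gamma>) = (\<integral>x. lft (\<Gamma> (f i) (f j)) x \<partial>config_restrict A \<gamma>) +
     (\<integral>x. lft (\<Gamma> (f i) (f j)) x \<partial>config_restrict (- A) \<gamma>)" if "i < k" "j < k" for i j
    by (intro integral_split assms lft_Gamma_measurable a(3) int that)
  show "gam a a \<gamma> \<gamma> = gam a a \<gamma> (config_restrict A \<gamma>) + gam a a \<gamma> (config_restrict (- A) \<gamma>)"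
    unfolding a(1) gam.simps sum.distrib[symmetric]
    by (intro sum.cong refl) (simp add: * distrib_left)
  have "integrable (config_restrict A \<gamma>) (lft (\<Gamma> (f i) (f j)))" if "i < k" "j < k" for i j
    using integrable_real_mult_indicator[OF _ int[OF that], of A] assms that Conf_sets
    by (subst integral_config_restrict(2)) (auto simp: lft_Gamma_measurable a(3) mult.commute)
  then show "carre_integrable a (config_restrict A \<gamma>)" by (simp add: a(1))
qed

text \<open>The part of the energy that comes from the points outside \<open>E\<close> is non-negative.\<close>

lemma integral_cond_energy:
  assumes E: "E \<in> \<E>" and a: "a \<in> Cyl"
  shows "(\<integral>\<^sup>+\<eta>. cond_energy E a \<eta> \<partial>\<mu>) = (\<integral>\<^sup>+\<gamma>. ennreal (gam a a \<gamma> (config_restrict E \<gamma>)) \<partial>\<mu>)"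
    and "(\<integral>\<^sup>+\<eta>. cond_energy E a \<eta> \<partial>\<mu>) \<le> energy a"
proof -
  show *: "(\<integral>\<^sup>+\<eta>. cond_energy E a \<eta> \<partial>\<mu>) = (\<integral>\<^sup>+\<gamma>. ennreal (gam a a \<gamma> (config_restrict E \<gamma>)) \<partial>\<mu>)"
    unfolding cond_energy_def
    by (rule nn_integral_disintegration[symmetric, OF E gam_restrict_ennreal_measurable[OF E a]])
  show "(\<integral>\<^sup>+\<eta>. cond_energy E a \<eta> \<partial>\<mu>) \<le> energy a"
    unfolding * 
  proof (rule nn_integral_mono_AE)
    show "AE \<gamma> in \<mu>. ennreal (gam a a \<gamma> (config_restrict E \<gamma>)) \<le> ennreal (gam a a \<gamma> \<gamma>)"
      using AE_carre_integrable[OF a] AE_space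
    proof eventually_elim
      case (elim \<gamma>)
      then have \<gamma>: "\<gamma> \<in> Conf" by (simp add: space_mu)
      have "0 \<le> gam a a \<gamma> (config_restrict (- E) \<gamma>)"
        by (intro gam_nonneg a gam_split(2)[OF a \<gamma> Compl_sets_m[OF ring_sets[OF E]] elim(1)])
      then show ?case using gam_split(1)[OF a \<gamma> ring_sets[OF E] elim(1)] by (intro ennreal_leI) simp
    qed
  qed
qed

lemma cond_energy_triangle:
  assumes E: "E \<in> \<E>" and abc: "a \<in> Cyl" "b \<in> Cyl" "c \<in> Cyl" and \<eta>: "\<eta> \<in> Conf"
  shows "cond_energy E (cyl_diff a c) \<eta> \<le> 2 * cond_energy E (cyl_diff a b) \<eta> + 2 * cond_energy E (cyl_diff b c) \<eta>"
    and "cond_energy E a \<eta> \<le> 2 * cond_energy E (cyl_diff a b) \<eta> + 2 * cond_energy E b \<eta>"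
proof -
  have 2: "2 = ennreal 2" by simp
  have nn: "0 \<le> gam d d \<gamma> (config_restrict E \<gamma>)" if "\<gamma> \<in> space (K E \<eta>)" "d \<in> Cyl" for \<gamma> d
    using that K_prob(3)[OF E \<eta>] by (intro gam_nonneg carre_integrable_restrict E) auto
  have comb: "(\<integral>\<^sup>+\<gamma>. ennreal (2 * gam d d \<gamma> (config_restrict E \<gamma>) + 2 * gam e e \<gamma> (config_restrict E \<gamma>)) \<partial>K E \<eta>) =
    2 * cond_energy E d \<eta> + 2 * cond_energy E e \<eta>" if de: "d \<in> Cyl" "e \<in> Cyl" for d e
  proof -
    have "(\<integral>\<^sup>+\<gamma>. ennreal (2 * gam d d \<gamma> (config_restrict E \<gamma>) + 2 * gam e e \<gamma> (config_restrict E \<gamma>)) \<partial>K E \<eta>) =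
      (\<integral>\<^sup>+\<gamma>. 2 * ennreal (gam d d \<gamma> (config_restrict E \<gamma>)) + 2 * ennreal (gam e e \<gamma> (config_restrict E \<gamma>)) \<partial>K E \<eta>)"
      using nn de by (intro nn_integral_cong) (simp add: ennreal_plus ennreal_mult)
    also have "\<dots> = 2 * cond_energy E d \<eta> + 2 * cond_energy E e \<eta>"
      using measurable_K[OF E \<eta> gam_restrict_ennreal_measurable[OF E]] de
      by (simp add: nn_integral_add nn_integral_cmult cond_energy_def)
    finally show ?thesis .
  qed
  show "cond_energy E (cyl_diff a c) \<eta> \<le> 2 * cond_energy E (cyl_diff a b) \<eta> + 2 * cond_energy E (cyl_diff b c) \<eta>"
    unfolding comb[OF cyl_diff_in[OF abc(1,2)] cyl_diff_in[OF abc(2,3)], symmetric]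
    unfolding cond_energy_def using gam_triangle[OF abc _ E] K_prob(3)[OF E \<eta>]
    by (intro nn_integral_mono ennreal_leI) simp
  show "cond_energy E a \<eta> \<le> 2 * cond_energy E (cyl_diff a b) \<eta> + 2 * cond_energy E b \<eta>"
    unfolding comb[OF cyl_diff_in[OF abc(1,2)] abc(2), symmetric]
    unfolding cond_energy_def using gam_diff_le[OF abc(1,2) _ E] K_prob(3)[OF E \<eta>]
    by (intro nn_integral_mono ennreal_leI) simp
qed

lemma cond_energy_commute:
  "a \<in> Cyl \<Longrightarrow> b \<in> Cyl \<Longrightarrow> cond_energy E (cyl_diff a b) \<eta> = cond_energy E (cyl_diff b a) \<eta>"
  unfolding cond_energy_def by (simp only: gam_diff_commute)

text \<open>Identification of the conditional energies with the forms on the projected probabilities.\<close>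

lemma cond_energy_proj:
  assumes E: "E \<in> \<E>" and \<eta>: "\<eta> \<in> Conf"
    and con: "AE \<gamma> in K E \<eta>. config_restrict (- E) \<gamma> = config_restrict (- E) \<eta>"
    and wd: "cyl_form_well_defined \<D> \<Gamma> lft (proj E \<eta>)" and a: "a \<in> Cyl"
  shows "ennreal (\<integral>\<gamma>. cyl_Gamma \<Gamma> lft (cyl_cond E \<eta> a) (cyl_cond E \<eta> a) \<gamma> \<partial>proj E \<eta>) = cond_energy E a \<eta>"
    and "ennreal (\<integral>\<gamma>. (cyl_fun (cyl_cond E \<eta> a) \<gamma>)\<^sup>2 \<partial>proj E \<eta>) = cond_norm E a \<eta>"
proof -
  let ?a = "cyl_cond E \<eta> a" and ?\<nu> = "proj E \<eta>"
  interpret K: prob_space "K E \<eta>" by (rule K_prob(1)[OF E \<eta>])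
  have a': "?a \<in> Cyl" by (rule cyl_cond_in[OF a])
  have r: "config_restrict E \<in> K E \<eta> \<rightarrow>\<^sub>M CS_on E"
    by (intro measurable_K E \<eta> measurable_config_restrict ring_sets)
  interpret \<nu>: prob_space ?\<nu> unfolding proj_K by (rule K.prob_space_distr[OF r])
  have space_\<nu>: "space ?\<nu> = Conf_on E" unfolding proj_K by (simp add: space_CS_on)
  have m1: "cyl_Gamma \<Gamma> lft ?a ?a \<in> borel_measurable (CS_on E)"
    by (intro measurable_CS_on cyl_Gamma_measurable a')
  have m2: "cyl_fun ?a \<in> borel_measurable (CS_on E)"
    by (intro measurable_CS_on cyl_fun_measurable a')
  have "ennreal (\<integral>\<gamma>. cyl_Gamma \<Gamma> lft ?a ?a \<gamma> \<partial>?\<nu>) = (\<integral>\<^sup>+\<gamma>. ennreal (cyl_Gamma \<Gamma> lft ?a ?a \<gamma>) \<partial>?\<nu>)"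
  proof (rule nn_integral_eq_integral[symmetric])
    show "integrable ?\<nu> (cyl_Gamma \<Gamma> lft ?a ?a)"
      using wd a' by (auto simp: cyl_form_well_defined_def)
    show "AE \<gamma> in ?\<nu>. 0 \<le> cyl_Gamma \<Gamma> lft ?a ?a \<gamma>"
      unfolding cyl_Gamma_gam by (intro AE_I2 gam_nonneg a' carre_integrable_on[OF a' _ E]) (simp add: space_\<nu>)
  qed
  also have "\<dots> = (\<integral>\<^sup>+\<gamma>. ennreal (cyl_Gamma \<Gamma> lft ?a ?a (config_restrict E \<gamma>)) \<partial>K E \<eta>)"
    unfolding proj_K using r m1 by (subst nn_integral_distr) auto
  also have "\<dots> = cond_energy E a \<eta>"
    unfolding cond_energy_def
  proof (rule nn_integral_cong_AE)
    show "AE \<gamma> in K E \<eta>. ennreal (cyl_Gamma \<Gamma> lft ?a ?a (config_restrict E \<gamma>)) =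
        ennreal (gam a a \<gamma> (config_restrict E \<gamma>))"
      using con AE_space
      by eventually_elim (simp add: K_prob(3)[OF E \<eta>] cyl_Gamma_cond ring_sets[OF E] a)
  qed
  finally show "ennreal (\<integral>\<gamma>. cyl_Gamma \<Gamma> lft ?a ?a \<gamma> \<partial>?\<nu>) = cond_energy E a \<eta>" .
  obtain B where "\<And>\<gamma>. \<bar>cyl_fun ?a \<gamma>\<bar> \<le> B" using cyl_fun_bounded[OF a'] by blast
  moreover have "cyl_fun ?a \<in> borel_measurable ?\<nu>" using m2 by (simp add: proj_K)
  ultimately have "cyl_fun ?a \<in> sq_integrable ?\<nu>" by (intro \<nu>.bounded_sq_integrable[of _ B]) auto
  then have "ennreal (\<integral>\<gamma>. (cyl_fun ?a \<gamma>)\<^sup>2 \<partial>?\<nu>) = (\<integral>\<^sup>+\<gamma>. ennreal ((cyl_fun ?a \<gamma>)\<^sup>2) \<partial>?\<nu>)"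
    by (intro nn_integral_eq_integral[symmetric] sq_integrableD(2)) auto
  also have "\<dots> = (\<integral>\<^sup>+\<gamma>. ennreal ((cyl_fun ?a (config_restrict E \<gamma>))\<^sup>2) \<partial>K E \<eta>)"
    unfolding proj_K using r m2 by (subst nn_integral_distr) auto
  also have "\<dots> = cond_norm E a \<eta>"
    unfolding cond_norm_def
  proof (rule nn_integral_cong_AE)
    show "AE \<gamma> in K E \<eta>. ennreal ((cyl_fun ?a (config_restrict E \<gamma>))\<^sup>2) = ennreal ((cyl_fun a \<gamma>)\<^sup>2)"
      using con AE_space
      by eventually_elim (simp add: K_prob(3)[OF E \<eta>] cyl_fun_cond ring_sets[OF E] a)
  qed
  finally show "ennreal (\<integral>\<gamma>. (cyl_fun ?a \<gamma>)\<^sup>2 \<partial>?\<nu>) = cond_norm E a \<eta>" .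
qed

lemma AE_cond_closable:
  "AE \<eta> in \<mu>. \<forall>b. (\<forall>n. b n \<in> Cyl) \<longrightarrow>
     (\<forall>\<delta>>0. \<exists>N. \<forall>i\<ge>N. \<forall>j\<ge>N. cond_energy (L h) (cyl_diff (b i) (b j)) \<eta> < ennreal \<delta>) \<longrightarrow>
     (\<lambda>n. cond_norm (L h) (b n) \<eta>) \<longlonglongrightarrow> 0 \<longrightarrow> (\<lambda>n. cond_energy (L h) (b n) \<eta>) \<longlonglongrightarrow> 0"
  using L_props(2)[of h] AE_consistent[OF L(1), of h] AE_space
proof eventually_elim
  case (elim \<eta>)
  let ?E = "L h"
  let ?\<nu> = "proj ?E \<eta>"
  have \<eta>: "\<eta> \<in> Conf" using elim by (simp add: space_mu)
  have wd: "cyl_form_well_defined \<D> \<Gamma> lft ?\<nu>" using elim by blast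
  note proj = cond_energy_proj[OF L(1) \<eta> elim(2) wd]
  show ?case
  proof (intro allI impI)
    fix b assume b: "\<forall>n. b n \<in> Cyl"
      and C: "\<forall>\<delta>>0. \<exists>N. \<forall>i\<ge>N. \<forall>j\<ge>N. cond_energy ?E (cyl_diff (b i) (b j)) \<eta> < ennreal \<delta>"
      and Z: "(\<lambda>n. cond_norm ?E (b n) \<eta>) \<longlonglongrightarrow> 0"
    define s where "s n = cyl_fun (cyl_cond ?E \<eta> (b n))" for n
    note b' = cyl_cond_in[OF b[rule_format], of ?E \<eta>]
    have "s n \<in> cyl_classes \<D> ?\<nu>" for n
      unfolding cyl_classes_def s_def using b'[of n] measurable_CS_on[OF cyl_fun_measurable[OF b'[of n]], of ?E]
      by (auto simp: proj_K)
    moreover have "form_Cauchy (cyl_form \<D> \<Gamma> lft ?\<nu>) s"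
      unfolding form_Cauchy_def
    proof (intro allI impI)
      fix \<delta> :: real assume \<delta>: "\<delta> > 0"
      then obtain N where N: "\<forall>i\<ge>N. \<forall>j\<ge>N. cond_energy ?E (cyl_diff (b i) (b j)) \<eta> < ennreal \<delta>" using C by blast
      show "\<exists>N. \<forall>i\<ge>N. \<forall>j\<ge>N. cyl_form \<D> \<Gamma> lft ?\<nu> (\<lambda>x. s i x - s j x) (\<lambda>x. s i x - s j x) < \<delta>"
      proof (intro exI allI impI)
        fix i j assume ij: "i \<ge> N" "j \<ge> N"
        let ?d = "cyl_diff (b i) (b j)"
        have d: "?d \<in> Cyl" using b cyl_diff_in by blast
        have "s i x - s j x = cyl_fun (cyl_cond ?E \<eta> ?d) x" for x
          unfolding s_def using cyl_fun_diff[OF b'[of i] b'[of j]] b by (simp add: cyl_cond_diff)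
        then have "cyl_form \<D> \<Gamma> lft ?\<nu> (\<lambda>x. s i x - s j x) (\<lambda>x. s i x - s j x) =
          (\<integral>\<gamma>. cyl_Gamma \<Gamma> lft (cyl_cond ?E \<eta> ?d) (cyl_cond ?E \<eta> ?d) \<gamma> \<partial>?\<nu>)"
          by (intro cyl_form_eq wd cyl_cond_in d) auto
        moreover have "ennreal (\<integral>\<gamma>. cyl_Gamma \<Gamma> lft (cyl_cond ?E \<eta> ?d) (cyl_cond ?E \<eta> ?d) \<gamma> \<partial>?\<nu>) < ennreal \<delta>"
          using N ij by (simp add: proj(1)[OF d])
        ultimately show "cyl_form \<D> \<Gamma> lft ?\<nu> (\<lambda>x. s i x - s j x) (\<lambda>x. s i x - s j x) < \<delta>"
          using ennreal_leI linorder_not_less by metis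
      qed
    qed
    moreover have "(\<lambda>n. \<integral>x. (s n x)\<^sup>2 \<partial>?\<nu>) \<longlonglongrightarrow> 0"
    proof -
      have "(\<lambda>n. ennreal (\<integral>x. (s n x)\<^sup>2 \<partial>?\<nu>)) \<longlonglongrightarrow> ennreal 0"
        using Z b by (simp add: s_def proj(2))
      then show ?thesis by (subst (asm) tendsto_ennreal_iff) auto
    qed
    ultimately have "(\<lambda>n. cyl_form \<D> \<Gamma> lft ?\<nu> (s n) (s n)) \<longlonglongrightarrow> 0"
      using elim(1) unfolding form_closable_def by blast
    moreover have "cyl_form \<D> \<Gamma> lft ?\<nu> (s n) (s n) =
        (\<integral>\<gamma>. cyl_Gamma \<Gamma> lft (cyl_cond ?E \<eta> (b n)) (cyl_cond ?E \<eta> (b n)) \<gamma> \<partial>?\<nu>)" for n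
      unfolding s_def by (intro cyl_form_eq wd b') auto
    ultimately have "(\<lambda>n. ennreal (\<integral>\<gamma>. cyl_Gamma \<Gamma> lft (cyl_cond ?E \<eta> (b n)) (cyl_cond ?E \<eta> (b n)) \<gamma> \<partial>?\<nu>)) \<longlonglongrightarrow> ennreal 0"
      by (intro tendsto_ennrealI) simp
    then show "(\<lambda>n. cond_energy ?E (b n) \<eta>) \<longlonglongrightarrow> 0" using b by (simp add: proj(1))
  qed
qed

subsection \<open>From conditional closability to closability\<close>

text \<open>
  The iterated inequality \<open>w(i, j) \<le> 2 w(i, i + 1) + 2 w(i + 1, j)\<close> replaces the triangle
  inequality for the square root of \<open>w\<close>.
\<close>

lemma geometric_chain:
  fixes w :: "nat \<Rightarrow> nat \<Rightarrow> ennreal" and C :: real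
  assumes tri: "\<And>i j k. w i k \<le> 2 * w i j + 2 * w j k"
    and step: "\<And>i. w i (Suc i) \<le> ennreal (C * (1/4) ^ i)"
    and diag: "\<And>i. w i i = 0" and C: "C \<ge> 0"
  shows "w i (i + n) \<le> ennreal (4 * C * (1/4) ^ i)"
proof (induction n arbitrary: i)
  case 0
  then show ?case by (simp add: diag)
next
  case (Suc n)
  have "w i (i + Suc n) \<le> 2 * w i (Suc i) + 2 * w (Suc i) (Suc i + n)"
    using tri[of i "Suc i + n" "Suc i"] by simp
  also have "\<dots> \<le> 2 * ennreal (C * (1/4) ^ i) + 2 * ennreal (4 * C * (1/4) ^ Suc i)"
    by (intro add_mono mult_left_mono step Suc.IH) auto
  also have "\<dots> = ennreal (2 * (C * (1/4) ^ i) + 2 * (4 * C * (1/4) ^ Suc i))"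
  proof -
    have "2 * ennreal x + 2 * ennreal y = ennreal (2 * x + 2 * y)" if "x \<ge> 0" "y \<ge> 0" for x y
      using that by (simp add: ennreal_mult)
    from this[of "C * (1/4) ^ i" "4 * C * (1/4) ^ Suc i"] show ?thesis using C by fastforce
  qed
  also have "2 * (C * (1/4) ^ i) + 2 * (4 * C * (1/4) ^ Suc i) = 4 * C * (1/4) ^ i" by simp
  finally show ?case .
qed

lemma cond_energy_diff_self: "a \<in> Cyl \<Longrightarrow> cond_energy E (cyl_diff a a) \<eta> = 0"
  by (simp add: cond_energy_def gam_diff_diff)

text \<open>
  The heart of the argument. Along the subsequence \<open>r\<close> the conditional energies of the increments and
  the conditional norms decay geometrically for almost every \<open>\<eta>\<close>, so that the conditional energies
  of \<open>b (r k)\<close> tend to \<open>0\<close> by conditional closability.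
\<close>

lemma energy_le_of_tail:
  assumes b: "\<And>n. b n \<in> Cyl"
    and N: "\<And>i j. i \<ge> N \<Longrightarrow> j \<ge> N \<Longrightarrow> energy (cyl_diff (b i) (b j)) \<le> \<delta>"
    and C: "\<And>\<epsilon>. \<epsilon> > 0 \<Longrightarrow> \<exists>M. \<forall>i\<ge>M. \<forall>j\<ge>M. energy (cyl_diff (b i) (b j)) \<le> ennreal \<epsilon>"
    and Z: "(\<lambda>n. \<integral>\<^sup>+\<gamma>. ennreal ((cyl_fun (b n) \<gamma>)\<^sup>2) \<partial>\<mu>) \<longlonglongrightarrow> 0"
    and n: "n \<ge> N"
  shows "(\<integral>\<^sup>+\<eta>. cond_energy (L h) (b n) \<eta> \<partial>\<mu>) \<le> 2 * \<delta>"
proof -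
  let ?E = "L h"
  let ?W = "\<lambda>i j. cond_energy ?E (cyl_diff (b i) (b j))" and ?z = "\<lambda>i. cond_norm ?E (b i)"
  note E = L(1)[of h]
  have d: "cyl_diff (b i) (b j) \<in> Cyl" for i j by (intro cyl_diff_in b)
  have [measurable]: "?W i j \<in> borel_measurable \<mu>" "?z i \<in> borel_measurable \<mu>" for i j
    by (intro cond_energy_measurable cond_norm_measurable E d b)+
  have W_le: "(\<integral>\<^sup>+\<eta>. ?W i j \<eta> \<partial>\<mu>) \<le> energy (cyl_diff (b i) (b j))" for i j
    by (rule integral_cond_energy(2)[OF E d])
  have "\<exists>M. \<forall>i\<ge>M. \<forall>j\<ge>M. (\<integral>\<^sup>+\<eta>. ?W i j \<eta> \<partial>\<mu>) \<le> ennreal ((1/8) ^ k) \<and> (\<integral>\<^sup>+\<eta>. ?z i \<eta> \<partial>\<mu>) \<le> ennreal ((1/8) ^ k)" for k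
  proof -
    obtain M1 where M1: "\<forall>i\<ge>M1. \<forall>j\<ge>M1. energy (cyl_diff (b i) (b j)) \<le> ennreal ((1/8) ^ k)"
      using C[of "(1/8) ^ k"] by auto
    have "\<forall>\<^sub>F n in sequentially. (\<integral>\<^sup>+\<gamma>. ennreal ((cyl_fun (b n) \<gamma>)\<^sup>2) \<partial>\<mu>) < ennreal ((1/8) ^ k)"
      by (rule order_tendstoD(2)[OF Z]) simp
    then obtain M2 where M2: "\<And>i. i \<ge> M2 \<Longrightarrow> (\<integral>\<^sup>+\<gamma>. ennreal ((cyl_fun (b i) \<gamma>)\<^sup>2) \<partial>\<mu>) < ennreal ((1/8) ^ k)"
      unfolding eventually_sequentially by blast
    show ?thesis
    proof (intro exI allI impI conjI)
      fix i j assume ij: "i \<ge> max M1 M2" "j \<ge> max M1 M2"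
      show "(\<integral>\<^sup>+\<eta>. ?W i j \<eta> \<partial>\<mu>) \<le> ennreal ((1/8) ^ k)"
        using order_trans[OF W_le] M1 ij by simp
      show "(\<integral>\<^sup>+\<eta>. ?z i \<eta> \<partial>\<mu>) \<le> ennreal ((1/8) ^ k)"
        using M2[of i] ij by (simp add: integral_cond_norm[OF E b])
    qed
  qed
  then obtain M where M: "\<And>k i j. i \<ge> M k \<Longrightarrow> j \<ge> M k \<Longrightarrow>
      (\<integral>\<^sup>+\<eta>. ?W i j \<eta> \<partial>\<mu>) \<le> ennreal ((1/8) ^ k) \<and> (\<integral>\<^sup>+\<eta>. ?z i \<eta> \<partial>\<mu>) \<le> ennreal ((1/8) ^ k)"
    by metis
  \<comment> \<open>a monotone choice of indices that dominates both \<open>N\<close> and \<open>M\<close>\<close>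
  define r where "r k = N + (\<Sum>l\<le>k. M l)" for k
  have rM: "M k \<le> r k" "M k \<le> r (Suc k)" "N \<le> r k" for k
  proof -
    have "M k \<le> (\<Sum>l\<le>k. M l)" by (rule member_le_sum) auto
    then show "M k \<le> r k" "M k \<le> r (Suc k)" "N \<le> r k" by (auto simp: r_def)
  qed
  \<comment> \<open>the weights \<open>4 ^ k\<close> still leave an integrable series, since the terms are bounded by \<open>(1/8) ^ k\<close>\<close>
  define S where "S \<eta> = (\<Sum>k. ennreal (4 ^ k) * (?W (r k) (r (Suc k)) \<eta> + ?z (r k) \<eta>))" for \<eta>
  have "(\<integral>\<^sup>+\<eta>. S \<eta> \<partial>\<mu>) = (\<Sum>k. ennreal (4 ^ k) * ((\<integral>\<^sup>+\<eta>. ?W (r k) (r (Suc k)) \<eta> \<partial>\<mu>) + (\<integral>\<^sup>+\<eta>. ?z (r k) \<eta> \<partial>\<mu>)))"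
    unfolding S_def by (simp add: nn_integral_suminf nn_integral_cmult nn_integral_add)
  also have "\<dots> \<le> (\<Sum>k. ennreal (2 * (1/2) ^ k))"
  proof (rule suminf_le)
    fix k
    have "ennreal (4 ^ k) * ((\<integral>\<^sup>+\<eta>. ?W (r k) (r (Suc k)) \<eta> \<partial>\<mu>) + (\<integral>\<^sup>+\<eta>. ?z (r k) \<eta> \<partial>\<mu>)) \<le>
      ennreal (4 ^ k) * (ennreal ((1/8) ^ k) + ennreal ((1/8) ^ k))"
      using M[OF rM(1,2)] M[OF rM(1,1)] by (intro mult_left_mono add_mono) auto
    also have "\<dots> = ennreal (4 ^ k * ((1/8) ^ k + (1/8) ^ k))"
      by (simp add: ennreal_mult flip: ennreal_plus)
    also have "(4::real) ^ k * ((1/8) ^ k + (1/8) ^ k) = 2 * (4 * (1/8)) ^ k"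
      unfolding power_mult_distrib by simp
    finally show "ennreal (4 ^ k) * ((\<integral>\<^sup>+\<eta>. ?W (r k) (r (Suc k)) \<eta> \<partial>\<mu>) + (\<integral>\<^sup>+\<eta>. ?z (r k) \<eta> \<partial>\<mu>)) \<le> ennreal (2 * (1/2) ^ k)"
      by simp
  qed auto
  also have "\<dots> = ennreal (\<Sum>k. 2 * (1/2) ^ k)"
    by (intro suminf_ennreal2 summable_mult summable_geometric) auto
  finally have "(\<integral>\<^sup>+\<eta>. S \<eta> \<partial>\<mu>) \<noteq> \<infinity>" by (auto simp: top_unique)
  then have "AE \<eta> in \<mu>. S \<eta> \<noteq> \<infinity>"
    by (intro nn_integral_PInf_AE) (auto simp: S_def)
  then have "AE \<eta> in \<mu>. (\<lambda>k. cond_energy ?E (b (r k)) \<eta>) \<longlonglongrightarrow> 0"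
    using AE_cond_closable[of h] AE_space
  proof eventually_elim
    case (elim \<eta>)
    then have \<eta>: "\<eta> \<in> Conf" by (simp add: space_mu)
    obtain c where c: "S \<eta> = ennreal c" "c \<ge> 0" using elim(1) by (cases "S \<eta>") auto
    have le: "?W (r k) (r (Suc k)) \<eta> \<le> ennreal (c * (1/4) ^ k)" "?z (r k) \<eta> \<le> ennreal (c * (1/4) ^ k)" for k
    proof -
      let ?x = "?W (r k) (r (Suc k)) \<eta> + ?z (r k) \<eta>"
      have "ennreal (4 ^ k) * ?x \<le> S \<eta>"
        unfolding S_def using sum_le_suminf[of "\<lambda>k. ennreal (4 ^ k) * (?W (r k) (r (Suc k)) \<eta> + ?z (r k) \<eta>)" "{k}"] by simp
      then have "ennreal ((1/4) ^ k) * (ennreal (4 ^ k) * ?x) \<le> ennreal ((1/4) ^ k) * ennreal c"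
        unfolding c by (intro mult_left_mono) auto
      moreover have "ennreal ((1/4) ^ k) * (ennreal (4 ^ k) * ?x) = ?x"
        unfolding mult.assoc[symmetric] ennreal_mult[symmetric, OF zero_le_power zero_le_power, of "1/4" 4, simplified]
        by (simp flip: ennreal_mult add: power_one_over)
      ultimately have "?x \<le> ennreal (c * (1/4) ^ k)" using c by (simp add: ennreal_mult mult.commute)
      then show "?W (r k) (r (Suc k)) \<eta> \<le> ennreal (c * (1/4) ^ k)" "?z (r k) \<eta> \<le> ennreal (c * (1/4) ^ k)"
        by (auto intro: order_trans[rotated])
    qed
    have lim: "(\<lambda>k. 4 * c * (1/4) ^ k) \<longlonglongrightarrow> 4 * c * 0"
      by (intro tendsto_intros LIMSEQ_power_zero) auto
    have chain: "?W (r i) (r j) \<eta> \<le> ennreal (4 * c * (1/4) ^ i)" if "i \<le> j" for i j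
      using geometric_chain[of "\<lambda>i j. ?W (r i) (r j) \<eta>" c i "j - i"] that le(1) c(2)
        cond_energy_triangle(1)[OF E b b b \<eta>] cond_energy_diff_self[OF b] by simp
    have "\<exists>N. \<forall>i\<ge>N. \<forall>j\<ge>N. ?W (r i) (r j) \<eta> < ennreal e" if "e > 0" for e
    proof -
      have "\<forall>\<^sub>F k in sequentially. 4 * c * (1/4) ^ k < e"
        by (rule order_tendstoD(2)[OF lim]) (use that in simp)
      then obtain K where K: "\<And>k. k \<ge> K \<Longrightarrow> 4 * c * (1/4) ^ k < e" unfolding eventually_sequentially by blast
      have *: "?W (r i) (r j) \<eta> < ennreal e" if "i \<ge> K" "i \<le> j" for i j
        using chain[OF that(2)] K[OF that(1)] c(2) by (intro le_less_trans[OF chain[OF that(2)]]) (simp add: ennreal_less_iff)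
      show ?thesis
      proof (intro exI allI impI)
        fix i j assume "i \<ge> K" "j \<ge> K"
        then show "?W (r i) (r j) \<eta> < ennreal e"
          using *[of i j] *[of j i] cond_energy_commute[OF b b, of ?E "r i" "r j" \<eta>] linear[of i j] by metis
      qed
    qed
    moreover have "(\<lambda>k. ?z (r k) \<eta>) \<longlonglongrightarrow> 0"
    proof (rule tendsto_sandwich[OF _ _ tendsto_const])
      show "\<forall>\<^sub>F k in sequentially. ?z (r k) \<eta> \<le> ennreal (c * (1/4) ^ k)"
        using le(2) by simp
      have "(\<lambda>k. ennreal (c * (1/4) ^ k)) \<longlonglongrightarrow> ennreal (c * 0)"
        by (intro tendsto_intros tendsto_ennrealI LIMSEQ_power_zero) auto
      then show "(\<lambda>k. ennreal (c * (1/4) ^ k)) \<longlonglongrightarrow> 0" by simp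
    qed simp
    ultimately show ?case
      using elim(2)[rule_format, of "\<lambda>k. b (r k)"] b by blast
  qed
  then have "AE \<eta> in \<mu>. cond_energy ?E (b n) \<eta> \<le> liminf (\<lambda>k. 2 * ?W n (r k) \<eta>)"
    using AE_space
  proof eventually_elim
    case (elim \<eta>)
    then have \<eta>: "\<eta> \<in> Conf" by (simp add: space_mu)
    let ?g = "cond_energy ?E (b n) \<eta>"
    have "(\<lambda>k. 2 * cond_energy ?E (b (r k)) \<eta>) \<longlonglongrightarrow> 2 * 0"
      by (intro ennreal_tendsto_cmult elim(1)) simp
    then have "(\<lambda>k. ?g - 2 * cond_energy ?E (b (r k)) \<eta>) \<longlonglongrightarrow> ?g - 2 * 0"
      by (intro tendsto_diff_ennreal_general tendsto_const) auto
    then have "liminf (\<lambda>k. ?g - 2 * cond_energy ?E (b (r k)) \<eta>) = ?g"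
      by (simp add: lim_imp_Liminf)
    moreover have "liminf (\<lambda>k. ?g - 2 * cond_energy ?E (b (r k)) \<eta>) \<le> liminf (\<lambda>k. 2 * ?W n (r k) \<eta>)"
    proof (rule Liminf_mono)
      have "\<forall>\<^sub>F k in sequentially. 2 * cond_energy ?E (b (r k)) \<eta> < 1"
        by (rule order_tendstoD(2)[OF \<open>(\<lambda>k. 2 * cond_energy ?E (b (r k)) \<eta>) \<longlonglongrightarrow> 2 * 0\<close>]) simp
      then show "\<forall>\<^sub>F k in sequentially. ?g - 2 * cond_energy ?E (b (r k)) \<eta> \<le> 2 * ?W n (r k) \<eta>"
      proof eventually_elim
        case (elim k)
        then have "2 * cond_energy ?E (b (r k)) \<eta> \<noteq> \<top>" by auto
        then show ?case
          using cond_energy_triangle(2)[OF E b b b \<eta>, of n "r k"] by (simp add: ennreal_minus_le_iff add.commute)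
      qed
    qed
    ultimately show ?case by simp
  qed
  then have "(\<integral>\<^sup>+\<eta>. cond_energy ?E (b n) \<eta> \<partial>\<mu>) \<le> (\<integral>\<^sup>+\<eta>. liminf (\<lambda>k. 2 * ?W n (r k) \<eta>) \<partial>\<mu>)"
    by (rule nn_integral_mono_AE)
  also have "\<dots> \<le> liminf (\<lambda>k. \<integral>\<^sup>+\<eta>. 2 * ?W n (r k) \<eta> \<partial>\<mu>)"
    by (rule nn_integral_liminf) measurable
  also have "\<dots> \<le> liminf (\<lambda>k. 2 * \<delta>)"
  proof (intro Liminf_mono always_eventually allI)
    fix k
    have "(\<integral>\<^sup>+\<eta>. 2 * ?W n (r k) \<eta> \<partial>\<mu>) = 2 * (\<integral>\<^sup>+\<eta>. ?W n (r k) \<eta> \<partial>\<mu>)"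
      by (rule nn_integral_cmult) measurable
    also have "\<dots> \<le> 2 * \<delta>"
      by (intro mult_left_mono order_trans[OF W_le N] n rM) auto
    finally show "(\<integral>\<^sup>+\<eta>. 2 * ?W n (r k) \<eta> \<partial>\<mu>) \<le> 2 * \<delta>" .
  qed
  also have "\<dots> = 2 * \<delta>" by (simp add: Liminf_const)
  finally show ?thesis .
qed

text \<open>The energies in the directions of the points in \<open>L h\<close> exhaust the full energy.\<close>

lemma gam_tendsto:
  assumes a: "a \<in> Cyl" and \<gamma>: "\<gamma> \<in> Conf" and ci: "carre_integrable a \<gamma>"
  shows "(\<lambda>h. gam a a \<gamma> (config_restrict (L h) \<gamma>)) \<longlonglongrightarrow> gam a a \<gamma> \<gamma>"
proof -
  obtain k F f where a': "a = (k, F, f)" "F \<in> Cb_smooth k" "\<And>i. i < k \<Longrightarrow> f i \<in> \<D>"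
    by (rule cylindersE[OF a]) blast
  have "(\<lambda>h. \<integral>x. lft (\<Gamma> (f i) (f j)) x \<partial>config_restrict (L h) \<gamma>) \<longlonglongrightarrow> (\<integral>x. lft (\<Gamma> (f i) (f j)) x \<partial>\<gamma>)"
    if ij: "i < k" "j < k" for i j
  proof -
    let ?g = "lft (\<Gamma> (f i) (f j))"
    have gm: "?g \<in> borel_measurable m" by (intro lft_Gamma_measurable a'(3) ij)
    have g: "?g \<in> borel_measurable \<gamma>" using gm by (simp add: Conf_sets[OF \<gamma>] cong: measurable_cong_sets)
    have int: "integrable \<gamma> ?g" using ci ij by (simp add: a'(1))
    have Ls: "L h \<in> sets \<gamma>" for h using L(2) Conf_sets[OF \<gamma>] by simp
    have "(\<lambda>h. \<integral>x. indicator (L h) x * ?g x \<partial>\<gamma>) \<longlonglongrightarrow> (\<integral>x. ?g x \<partial>\<gamma>)"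
    proof (rule integral_dominated_convergence[where w = "\<lambda>x. \<bar>?g x\<bar>"])
      show "AE x in \<gamma>. (\<lambda>h. indicator (L h) x * ?g x) \<longlonglongrightarrow> ?g x"
      proof (rule AE_I2)
        fix x
        obtain h0 where "x \<in> L h0" using L(4) by blast
        then have "\<forall>h\<ge>h0. x \<in> L h" using L(3) by (auto simp: incseq_def)
        then have "\<forall>\<^sub>F h in sequentially. indicator (L h) x * ?g x = ?g x"
          unfolding eventually_sequentially by (intro exI[of _ h0]) auto
        then show "(\<lambda>h. indicator (L h) x * ?g x) \<longlonglongrightarrow> ?g x" by (rule tendsto_eventually)
      qed
      show "AE x in \<gamma>. norm (indicator (L h) x * ?g x) \<le> \<bar>?g x\<bar>" for h
        by (intro AE_I2) (auto simp: indicator_def)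
    qed (use g Ls int in auto)
    then show ?thesis by (simp add: integral_config_restrict(1)[OF \<gamma> L(2) gm])
  qed
  then show ?thesis unfolding a'(1) gam.simps by (intro tendsto_sum tendsto_mult tendsto_const) auto
qed

lemma energy_le_SUP:
  assumes a: "a \<in> Cyl" and le: "\<And>h. (\<integral>\<^sup>+\<eta>. cond_energy (L h) a \<eta> \<partial>\<mu>) \<le> c"
  shows "energy a \<le> c"
proof -
  have "energy a = (\<integral>\<^sup>+\<gamma>. liminf (\<lambda>h. ennreal (gam a a \<gamma> (config_restrict (L h) \<gamma>))) \<partial>\<mu>)"
  proof (rule nn_integral_cong_AE)
    show "AE \<gamma> in \<mu>. ennreal (gam a a \<gamma> \<gamma>) = liminf (\<lambda>h. ennreal (gam a a \<gamma> (config_restrict (L h) \<gamma>)))"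
      using AE_carre_integrable[OF a] AE_space
    proof eventually_elim
      case (elim \<gamma>)
      then have "(\<lambda>h. ennreal (gam a a \<gamma> (config_restrict (L h) \<gamma>))) \<longlonglongrightarrow> ennreal (gam a a \<gamma> \<gamma>)"
        by (intro tendsto_ennrealI gam_tendsto a) (simp_all add: space_mu)
      from lim_imp_Liminf[OF _ this] show ?case by simp
    qed
  qed
  also have "\<dots> \<le> liminf (\<lambda>h. \<integral>\<^sup>+\<gamma>. ennreal (gam a a \<gamma> (config_restrict (L h) \<gamma>)) \<partial>\<mu>)"
    by (intro nn_integral_liminf measurable_mu gam_restrict_ennreal_measurable L(1) a)
  also have "\<dots> \<le> liminf (\<lambda>h. c)"
    using le by (intro Liminf_mono always_eventually allI) (simp add: integral_cond_energy(1)[OF L(1) a])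
  also have "\<dots> = c" by (simp add: Liminf_const)
  finally show ?thesis .
qed

theorem cylinder_closable:
  assumes b: "\<And>n. b n \<in> Cyl"
    and C: "\<And>\<epsilon>. \<epsilon> > 0 \<Longrightarrow> \<exists>M. \<forall>i\<ge>M. \<forall>j\<ge>M. energy (cyl_diff (b i) (b j)) \<le> ennreal \<epsilon>"
    and Z: "(\<lambda>n. \<integral>\<^sup>+\<gamma>. ennreal ((cyl_fun (b n) \<gamma>)\<^sup>2) \<partial>\<mu>) \<longlonglongrightarrow> 0"
  shows "(\<lambda>n. energy (b n)) \<longlonglongrightarrow> 0"
proof (rule order_tendstoI)
  fix e :: ennreal assume "0 < e"
  then obtain \<epsilon> where \<epsilon>: "\<epsilon> > 0" "ennreal \<epsilon> < e"
    using ennreal_rat_dense[of 0 e] by (metis ennreal_eq_0_iff less_le_not_le linorder_not_le)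
  obtain N where N: "\<And>i j. i \<ge> N \<Longrightarrow> j \<ge> N \<Longrightarrow> energy (cyl_diff (b i) (b j)) \<le> ennreal (\<epsilon> / 2)"
    using C[of "\<epsilon> / 2"] \<epsilon> by auto
  have "energy (b n) < e" if "n \<ge> N" for n
  proof -
    have "energy (b n) \<le> 2 * ennreal (\<epsilon> / 2)"
      by (intro energy_le_SUP b energy_le_of_tail[OF b N C Z that]) auto
    also have "\<dots> = ennreal \<epsilon>" using \<epsilon> ennreal_mult[of 2 "\<epsilon> / 2"] by simp
    also note \<epsilon>(2)
    finally show ?thesis .
  qed
  then show "\<forall>\<^sub>F n in sequentially. energy (b n) < e" unfolding eventually_sequentially by blast
qed simp

subsection \<open>The form on classes\<close>

lemma energy_eq_integral:
  assumes "a \<in> Cyl"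
  shows "energy a = ennreal (\<integral>\<gamma>. cyl_Gamma \<Gamma> lft a a \<gamma> \<partial>\<mu>)" "0 \<le> (\<integral>\<gamma>. cyl_Gamma \<Gamma> lft a a \<gamma> \<partial>\<mu>)"
proof -
  have int: "integrable \<mu> (\<lambda>\<gamma>. gam a a \<gamma> \<gamma>)"
    using cyl_Gamma_integrable[OF assms assms] by (simp add: cyl_Gamma_gam[abs_def])
  show "energy a = ennreal (\<integral>\<gamma>. cyl_Gamma \<Gamma> lft a a \<gamma> \<partial>\<mu>)"
    unfolding cyl_Gamma_gam by (rule nn_integral_eq_integral[OF int AE_gam_nonneg[OF assms]])
  show "0 \<le> (\<integral>\<gamma>. cyl_Gamma \<Gamma> lft a a \<gamma> \<partial>\<mu>)"
    unfolding cyl_Gamma_gam by (rule integral_nonneg_AE[OF AE_gam_nonneg[OF assms]])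
qed

text \<open>The form on representatives of cylinder functions.\<close>

abbreviation EE where "EE a b \<equiv> \<integral>\<gamma>. cyl_Gamma \<Gamma> lft a b \<gamma> \<partial>\<mu>"

lemma EE_add:
  assumes "a \<in> Cyl" "a' \<in> Cyl" "b \<in> Cyl"
  shows "EE (cyl_add a a') b = EE a b + EE a' b"
  using cyl_Gamma_integrable[OF assms(1,3)] cyl_Gamma_integrable[OF assms(2,3)]
  by (simp add: cyl_Gamma_gam[abs_def] gam_add assms)

lemma EE_scale: "a \<in> Cyl \<Longrightarrow> EE (cyl_scale c a) b = c * EE a b"
  by (simp add: cyl_Gamma_gam[abs_def] gam_scale)

lemma EE_sym: "a \<in> Cyl \<Longrightarrow> b \<in> Cyl \<Longrightarrow> EE a b = EE b a"
  using gam_sym[of a b] by (simp add: cyl_Gamma_gam[abs_def])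

lemma EE_null:
  assumes d: "d \<in> Cyl" and zero: "AE \<gamma> in \<mu>. cyl_fun d \<gamma> = 0" and b: "b \<in> Cyl"
  shows "EE d b = 0"
proof -
  have "(\<lambda>n::nat. energy d) \<longlonglongrightarrow> 0"
  proof (rule cylinder_closable[OF d])
    have "energy (cyl_diff d d) = 0" by (simp add: gam_diff_diff d)
    then show "\<exists>M. \<forall>i\<ge>M. \<forall>j\<ge>M. energy (cyl_diff d d) \<le> ennreal \<epsilon>" for \<epsilon> by simp
    have "(\<integral>\<^sup>+\<gamma>. ennreal ((cyl_fun d \<gamma>)\<^sup>2) \<partial>\<mu>) = (\<integral>\<^sup>+\<gamma>. 0 \<partial>\<mu>)"
      by (rule nn_integral_cong_AE) (use zero in \<open>auto elim: eventually_mono\<close>)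
    then show "(\<lambda>n. \<integral>\<^sup>+\<gamma>. ennreal ((cyl_fun d \<gamma>)\<^sup>2) \<partial>\<mu>) \<longlonglongrightarrow> 0" by simp
  qed
  then have "energy d = 0" by (simp add: LIMSEQ_const_iff)
  then have d0: "EE d d = 0" using energy_eq_integral[OF d] by simp
  \<comment> \<open>non-negativity of the form at \<open>b + t d\<close> for all \<open>t\<close> forces the mixed term to vanish\<close>
  have pos: "0 \<le> EE b b + 2 * t * EE d b" for t
  proof -
    note td = cyl_scale_in[OF d, of t]
    let ?c = "cyl_add (cyl_scale t d) b"
    have c: "?c \<in> Cyl" by (intro cyl_add_in td b)
    have "EE ?c ?c = t * EE d ?c + EE b ?c" by (simp add: EE_add[OF td b c] EE_scale[OF d])
    also have "\<dots> = t * (t * EE d d + EE b d) + (t * EE d b + EE b b)"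
      by (simp add: EE_sym[OF d c] EE_sym[OF b c] EE_add[OF td b] EE_scale d b)
    finally show ?thesis using energy_eq_integral(2)[OF c] d0 EE_sym[OF b d] by simp
  qed
  show ?thesis
  proof (rule ccontr)
    assume "EE d b \<noteq> 0"
    then have "2 * (- (EE b b + 1) / (2 * EE d b)) * EE d b = - (EE b b + 1)" by simp
    then show False using pos[of "- (EE b b + 1) / (2 * EE d b)"] by simp
  qed
qed

lemma EE_cong:
  assumes "a \<in> Cyl" "a' \<in> Cyl" "b \<in> Cyl"
    and "AE \<gamma> in \<mu>. cyl_fun a \<gamma> = cyl_fun a' \<gamma>"
  shows "EE a b = EE a' b"
proof -
  have "AE \<gamma> in \<mu>. cyl_fun (cyl_diff a a') \<gamma> = 0"
    using assms(4) by eventually_elim (simp add: cyl_fun_diff[OF assms(1,2)])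
  from EE_null[OF cyl_diff_in[OF assms(1,2)] this assms(3)]
  have "EE (cyl_diff a a') b = 0" .
  then show ?thesis
    unfolding cyl_diff_def by (simp add: EE_add[OF assms(1) cyl_scale_in[OF assms(2)] assms(3)] EE_scale assms)
qed

theorem well_defined: "cyl_form_well_defined \<D> \<Gamma> lft \<mu>"
  unfolding cyl_form_well_defined_def
proof (intro conjI ballI impI)
  fix a a' b b'
  assume in_cyl: "a \<in> Cyl" "a' \<in> Cyl" "b \<in> Cyl" "b' \<in> Cyl"
    and eq: "AE \<gamma> in \<mu>. cyl_fun a \<gamma> = cyl_fun a' \<gamma>" "AE \<gamma> in \<mu>. cyl_fun b \<gamma> = cyl_fun b' \<gamma>"
  have "EE a b = EE a' b" by (rule EE_cong[OF in_cyl(1-3) eq(1)])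
  also have "\<dots> = EE b a'" by (rule EE_sym[OF in_cyl(2,3)])
  also have "\<dots> = EE b' a'" by (rule EE_cong[OF in_cyl(3,4,2) eq(2)])
  also have "\<dots> = EE a' b'" by (rule EE_sym[OF in_cyl(4,2)])
  finally show "EE a b = EE a' b'" .
qed (rule cyl_Gamma_integrable)

text \<open>The form on classes and its domain.\<close>

abbreviation V where "V \<equiv> cyl_classes \<D> \<mu>"
abbreviation Q where "Q \<equiv> cyl_form \<D> \<Gamma> lft \<mu>"

lemma V_E: "u \<in> V \<Longrightarrow> (\<And>a. u \<in> borel_measurable \<mu> \<Longrightarrow> a \<in> Cyl \<Longrightarrow> AE \<gamma> in \<mu>. u \<gamma> = cyl_fun a \<gamma> \<Longrightarrow> thesis) \<Longrightarrow> thesis"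
  unfolding cyl_classes_def by blast

lemma V_I: "u \<in> borel_measurable \<mu> \<Longrightarrow> a \<in> Cyl \<Longrightarrow> AE \<gamma> in \<mu>. u \<gamma> = cyl_fun a \<gamma> \<Longrightarrow> u \<in> V"
  unfolding cyl_classes_def by blast

lemma Q_eq: "a \<in> Cyl \<Longrightarrow> b \<in> Cyl \<Longrightarrow> AE \<gamma> in \<mu>. u \<gamma> = cyl_fun a \<gamma> \<Longrightarrow>
    AE \<gamma> in \<mu>. v \<gamma> = cyl_fun b \<gamma> \<Longrightarrow> Q u v = EE a b"
  by (rule cyl_form_eq[OF well_defined])

lemma cyl_fun_V: "a \<in> Cyl \<Longrightarrow> cyl_fun a \<in> V"
  by (rule V_I) (auto intro: measurable_mu cyl_fun_measurable)

lemma V_sq_integrable: "V \<subseteq> sq_integrable \<mu>"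
proof
  fix u assume "u \<in> V"
  then obtain a where u: "u \<in> borel_measurable \<mu>" "a \<in> Cyl" "AE \<gamma> in \<mu>. u \<gamma> = cyl_fun a \<gamma>" by (rule V_E)
  obtain B where "\<And>\<gamma>. \<bar>cyl_fun a \<gamma>\<bar> \<le> B" using cyl_fun_bounded[OF u(2)] by blast
  then show "u \<in> sq_integrable \<mu>"
    using u by (intro mu.bounded_sq_integrable[of _ B]) (auto elim: eventually_mono)
qed

lemma V_nonneg_form: "nonneg_form V Q"
proof
  have c0: "(0, \<lambda>_. 0, f) \<in> Cyl" for f by (rule cyl_const_in)
  show "(\<lambda>x. 0) \<in> V" by (rule V_I[OF _ c0]) auto
  fix u v w and c :: real
  assume "u \<in> V" then obtain a where u: "u \<in> borel_measurable \<mu>" "a \<in> Cyl" "AE \<gamma> in \<mu>. u \<gamma> = cyl_fun a \<gamma>" by (rule V_E)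
  have cu: "AE \<gamma> in \<mu>. c * u \<gamma> = cyl_fun (cyl_scale c a) \<gamma>"
    using u(3) by eventually_elim (simp add: cyl_fun_scale)
  show "(\<lambda>x. c * u x) \<in> V" by (rule V_I[OF _ cyl_scale_in[OF u(2)] cu]) (use u in simp)
  show "0 \<le> Q u u" unfolding Q_eq[OF u(2,2,3,3)] by (rule energy_eq_integral(2)[OF u(2)])
  assume "w \<in> V" then obtain d where w: "w \<in> borel_measurable \<mu>" "d \<in> Cyl" "AE \<gamma> in \<mu>. w \<gamma> = cyl_fun d \<gamma>" by (rule V_E)
  show "Q u w = Q w u" unfolding Q_eq[OF u(2) w(2) u(3) w(3)] Q_eq[OF w(2) u(2) w(3) u(3)] by (rule EE_sym[OF u(2) w(2)])
  show "Q (\<lambda>x. c * u x) w = c * Q u w"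
    unfolding Q_eq[OF u(2) w(2) u(3) w(3)] Q_eq[OF cyl_scale_in[OF u(2)] w(2) cu w(3)] by (rule EE_scale[OF u(2)])
  assume "v \<in> V" then obtain b where v: "v \<in> borel_measurable \<mu>" "b \<in> Cyl" "AE \<gamma> in \<mu>. v \<gamma> = cyl_fun b \<gamma>" by (rule V_E)
  note ab = cyl_add_in[OF u(2) v(2)]
  have uv: "AE \<gamma> in \<mu>. u \<gamma> + v \<gamma> = cyl_fun (cyl_add a b) \<gamma>"
    using u(3) v(3) by eventually_elim (simp add: cyl_fun_add(1)[OF u(2) v(2)])
  show "(\<lambda>x. u x + v x) \<in> V" by (rule V_I[OF _ ab uv]) (use u v in simp)
  show "Q (\<lambda>x. u x + v x) w = Q u w + Q v w"
    unfolding Q_eq[OF u(2) w(2) u(3) w(3)] Q_eq[OF v(2) w(2) v(3) w(3)] Q_eq[OF ab w(2) uv w(3)]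
    by (rule EE_add[OF u(2) v(2) w(2)])
qed

theorem V_closable: "form_closable \<mu> V Q"
  unfolding form_closable_def
proof (intro allI impI, elim conjE)
  fix s assume s: "\<forall>n. s n \<in> V" and C: "form_Cauchy Q s" and Z: "(\<lambda>n. \<integral>x. (s n x)\<^sup>2 \<partial>\<mu>) \<longlonglongrightarrow> 0"
  have "\<forall>n. \<exists>a. s n \<in> borel_measurable \<mu> \<and> a \<in> Cyl \<and> (AE \<gamma> in \<mu>. s n \<gamma> = cyl_fun a \<gamma>)"
    using s unfolding cyl_classes_def by blast
  from choice[OF this] obtain b where sm: "\<And>n. s n \<in> borel_measurable \<mu>" and b: "\<And>n. b n \<in> Cyl"
    and sb: "\<And>n. AE \<gamma> in \<mu>. s n \<gamma> = cyl_fun (b n) \<gamma>" by blast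
  have "(\<lambda>n. energy (b n)) \<longlonglongrightarrow> 0"
  proof (rule cylinder_closable[OF b])
    fix \<epsilon> :: real assume "\<epsilon> > 0"
    then obtain N where N: "\<forall>i\<ge>N. \<forall>j\<ge>N. sqdist Q (s i) (s j) < \<epsilon>"
      using C unfolding form_Cauchy_def by blast
    have "energy (cyl_diff (b i) (b j)) = ennreal (sqdist Q (s i) (s j))" for i j
    proof -
      note d = cyl_diff_in[OF b[of i] b[of j]]
      have eq: "AE \<gamma> in \<mu>. s i \<gamma> - s j \<gamma> = cyl_fun (cyl_diff (b i) (b j)) \<gamma>"
        using sb[of i] sb[of j] by eventually_elim (simp add: cyl_fun_diff[OF b b])
      show ?thesis unfolding Q_eq[OF d d eq eq] by (rule energy_eq_integral(1)[OF d])
    qed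
    note * = this
    show "\<exists>M. \<forall>i\<ge>M. \<forall>j\<ge>M. energy (cyl_diff (b i) (b j)) \<le> ennreal \<epsilon>"
      unfolding * by (intro exI[of _ N] allI impI ennreal_leI less_imp_le) (use N in blast)
  next
    have "(\<integral>\<^sup>+\<gamma>. ennreal ((cyl_fun (b n) \<gamma>)\<^sup>2) \<partial>\<mu>) = ennreal (\<integral>x. (s n x)\<^sup>2 \<partial>\<mu>)" for n
    proof -
      have "(\<integral>\<^sup>+\<gamma>. ennreal ((cyl_fun (b n) \<gamma>)\<^sup>2) \<partial>\<mu>) = (\<integral>\<^sup>+\<gamma>. ennreal ((s n \<gamma>)\<^sup>2) \<partial>\<mu>)"
        by (rule nn_integral_cong_AE) (use sb[of n] in \<open>auto elim: eventually_mono\<close>)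
      also have "\<dots> = ennreal (\<integral>x. (s n x)\<^sup>2 \<partial>\<mu>)"
        using s V_sq_integrable by (intro nn_integral_eq_integral sq_integrableD(2)) auto
      finally show ?thesis .
    qed
    then show "(\<lambda>n. \<integral>\<^sup>+\<gamma>. ennreal ((cyl_fun (b n) \<gamma>)\<^sup>2) \<partial>\<mu>) \<longlonglongrightarrow> 0"
      using tendsto_ennrealI[OF Z] by simp
  qed
  then have "(\<lambda>n. ennreal (Q (s n) (s n))) \<longlonglongrightarrow> ennreal 0"
    using energy_eq_integral(1)[OF b] Q_eq[OF b b sb sb] by simp
  then show "(\<lambda>n. Q (s n) (s n)) \<longlonglongrightarrow> 0"
    using energy_eq_integral(2)[OF b] Q_eq[OF b b sb sb] by (subst (asm) tendsto_ennreal_iff) auto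
qed

lemma V_markov:
  assumes "u \<in> V" "\<epsilon> > 0"
  shows "\<exists>v\<in>V. Q v v \<le> Q u u \<and> (AE x in \<mu>. \<bar>v x - min 1 (max 0 (u x))\<bar> \<le> \<epsilon>)"
proof -
  obtain a where u: "u \<in> borel_measurable \<mu>" "a \<in> Cyl" "AE \<gamma> in \<mu>. u \<gamma> = cyl_fun a \<gamma>"
    by (rule V_E[OF assms(1)])
  let ?b = "cyl_soft_clip \<epsilon> a"
  have b: "?b \<in> Cyl" by (rule cyl_soft_clip_in[OF u(2) assms(2)])
  have "Q (cyl_fun ?b) (cyl_fun ?b) = EE ?b ?b" by (rule Q_eq[OF b b]) auto
  also have "\<dots> \<le> EE a a"
  proof (rule integral_mono_AE)
    show "AE \<gamma> in \<mu>. cyl_Gamma \<Gamma> lft ?b ?b \<gamma> \<le> cyl_Gamma \<Gamma> lft a a \<gamma>"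
      using AE_gam_nonneg[OF u(2)]
    proof eventually_elim
      case (elim \<gamma>)
      have "(soft_clip' \<epsilon> (cyl_fun a \<gamma>))\<^sup>2 \<le> 1"
        using soft_clip'_bounds[OF assms(2)] by (simp add: power_le_one)
      then show ?case
        using elim by (simp add: cyl_Gamma_gam gam_soft_clip[OF u(2) assms(2)] mult_left_le_one_le)
    qed
  qed (intro cyl_Gamma_integrable b u)+
  also have "\<dots> = Q u u" by (rule Q_eq[symmetric, OF u(2,2,3,3)])
  finally have "Q (cyl_fun ?b) (cyl_fun ?b) \<le> Q u u" .
  moreover have "AE \<gamma> in \<mu>. \<bar>cyl_fun ?b \<gamma> - min 1 (max 0 (u \<gamma>))\<bar> \<le> \<epsilon>"
    using u(3) by eventually_elim (simp add: cyl_fun_soft_clip soft_clip_approx[OF assms(2)])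
  ultimately show ?thesis using cyl_fun_V[OF b] by blast
qed

end

section \<open>Density\<close>

subsection \<open>Generators of the Borel sets\<close>

text \<open>Luzin spaces are hereditarily Lindelof.\<close>

lemma Luzin_Lindelof:
  fixes \<U> :: "'x::topological_space set set"
  assumes "Luzin_type TYPE('x)" "\<And>U. U \<in> \<U> \<Longrightarrow> open U"
  shows "\<exists>\<V>\<subseteq>\<U>. countable \<V> \<and> \<Union>\<V> = \<Union>\<U>"
proof -
  obtain P :: "'x topology" and f where P: "second_countable P" "continuous_map P (euclidean :: 'x topology) f"
    "f ` topspace P = UNIV"
    using assms(1) by (auto simp: Luzin_type_def bij_betw_def)
  obtain \<B> where \<B>: "countable \<B>" "\<forall>U x. openin P U \<and> x \<in> U \<longrightarrow> (\<exists>V\<in>\<B>. x \<in> V \<and> V \<subseteq> U)"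
    using P(1) unfolding second_countable_def by (elim exE conjE) (rule that)
  define \<B>' where "\<B>' = {b\<in>\<B>. \<exists>U\<in>\<U>. f ` b \<subseteq> U}"
  have "\<forall>b\<in>\<B>'. \<exists>U. U \<in> \<U> \<and> f ` b \<subseteq> U" unfolding \<B>'_def by blast
  from bchoice[OF this] obtain u where u: "\<forall>b\<in>\<B>'. u b \<in> \<U> \<and> f ` b \<subseteq> u b" by blast
  have "\<Union>\<U> \<subseteq> \<Union>(u ` \<B>')"
  proof
    fix y assume "y \<in> \<Union>\<U>"
    then obtain U where U: "U \<in> \<U>" "y \<in> U" by blast
    obtain x where x: "x \<in> topspace P" "y = f x" using P(3) by blast
    have "openin P {x\<in>topspace P. f x \<in> U}"
      using openin_continuous_map_preimage[OF P(2)] assms(2)[OF U(1)] by simp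
    moreover have "x \<in> {x\<in>topspace P. f x \<in> U}" using x U(2) by simp
    ultimately have "\<exists>V\<in>\<B>. x \<in> V \<and> V \<subseteq> {x\<in>topspace P. f x \<in> U}"
      by (intro \<B>(2)[rule_format] conjI)
    then obtain b where "b \<in> \<B>" "x \<in> b" "b \<subseteq> {x\<in>topspace P. f x \<in> U}" by blast
    then have b: "b \<in> \<B>" "x \<in> b" "f ` b \<subseteq> U" by auto
    then have "b \<in> \<B>'" using U(1) by (auto simp: \<B>'_def)
    then show "y \<in> \<Union>(u ` \<B>')" using u b(2) x(2) by blast
  qed
  moreover have "countable \<B>'" using \<B>(1) unfolding \<B>'_def by (rule countable_subset[rotated]) auto
  ultimately show ?thesis using u by (intro exI[of _ "u ` \<B>'"]) blast
qed

context topological_local_diffusion_space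
begin

text \<open>The finite intersections of sets \<open>{f > c}\<close>, \<open>f \<in> \<D>\<close>.\<close>

definition cells :: "'x set set" where
  "cells = {{x. \<forall>(f, c)\<in>set l. c < f x} | l. fst ` set l \<subseteq> \<D>}"

lemma cells_Int: "A \<in> cells \<Longrightarrow> B \<in> cells \<Longrightarrow> A \<inter> B \<in> cells"
proof -
  assume "A \<in> cells" "B \<in> cells"
  then obtain l l' where l: "A = {x. \<forall>(f, c)\<in>set l. c < f x}" "fst ` set l \<subseteq> \<D>"
    "B = {x. \<forall>(f, c)\<in>set l'. c < f x}" "fst ` set l' \<subseteq> \<D>" by (auto simp: cells_def)
  then have "A \<inter> B = {x. \<forall>(f, c)\<in>set (l @ l'). c < f x}" "fst ` set (l @ l') \<subseteq> \<D>" by auto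
  then show ?thesis unfolding cells_def by blast
qed

lemma cells_single: "f \<in> \<D> \<Longrightarrow> {x. c < f x} \<in> cells"
  unfolding cells_def mem_Collect_eq by (rule exI[of _ "[(f, c)]"]) simp

lemma D_continuous: "f \<in> \<D> \<Longrightarrow> continuous_on UNIV f"
  using D_subset by (auto simp: bounded_continuous_def)

text \<open>
  The open sets that are generated by \<^const>\<open>cells\<close> form a basis of the topology, and an open set is a
  countable union of basic ones by the Lindelof property.
\<close>

lemma sigma_cells: "sigma_sets UNIV cells = sets borel"
proof
  have "A \<in> sets borel" if cell: "A \<in> cells" for A
  proof -
    obtain l where l: "A = {x. \<forall>(f, c)\<in>set l. c < f x}" "fst ` set l \<subseteq> \<D>"
      using cell by (auto simp: cells_def)
    have "A = (\<Inter>p\<in>set l. {x. snd p < fst p x})" unfolding l by force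
    moreover have "open {x. snd p < fst p x}" if "p \<in> set l" for p
      using D_continuous[of "fst p"] l(2) that by (intro open_Collect_less continuous_on_const) auto
    ultimately have "open A" by (auto intro!: open_INT)
    then show ?thesis by simp
  qed
  then show "sigma_sets UNIV cells \<subseteq> sets borel"
    using sets.sigma_sets_subset[of cells borel] by auto
next
  let ?S = "sigma UNIV cells"
  have sS: "sets ?S = sigma_sets UNIV cells" by (rule sets_measure_of) simp
  have meas: "f \<in> borel_measurable ?S" if "f \<in> \<D>" for f
    unfolding borel_measurable_iff_greater using cells_single[OF that] by (auto simp: sS)
  let ?\<B> = "{b. open b \<and> b \<in> sets ?S}"
  have base: "\<forall>x\<in>U. \<exists>b\<in>?\<B>. x \<in> b \<and> b \<subseteq> U" if "open U" for U
  proof -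
    have "generate_topology {f -` U | f U. f \<in> \<D> \<and> open U} U"
      using that by (rule iffD1[OF fun_cong[OF D_generates]])
    then show ?thesis
    proof induction
      case UNIV
      have "UNIV \<in> ?\<B>" using sets.top[of ?S] by simp
      then show ?case by blast
    next
      case (Int a b)
      show ?case
      proof
        fix x assume "x \<in> a \<inter> b"
        then have x: "x \<in> a" "x \<in> b" by auto
        from bspec[OF Int.IH(1) x(1)] obtain A where "open A" "A \<in> sets ?S" "x \<in> A" "A \<subseteq> a" by auto
        moreover from bspec[OF Int.IH(2) x(2)] obtain B where "open B" "B \<in> sets ?S" "x \<in> B" "B \<subseteq> b" by auto
        ultimately show "\<exists>c\<in>?\<B>. x \<in> c \<and> c \<subseteq> a \<inter> b"
          by (intro bexI[of _ "A \<inter> B"] conjI CollectI open_Int sets.Int) auto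
      qed
    next
      case (UN K)
      show ?case
      proof
        fix x assume "x \<in> \<Union>K"
        then obtain k where k: "k \<in> K" "x \<in> k" by blast
        from bspec[OF UN.IH[OF k(1)] k(2)] obtain A where "A \<in> ?\<B>" "x \<in> A" "A \<subseteq> k" by auto
        then show "\<exists>b\<in>?\<B>. x \<in> b \<and> b \<subseteq> \<Union>K" using k(1) by (intro bexI[of _ A]) auto
      qed
    next
      case (Basis s)
      then obtain f U where s: "s = f -` U" "f \<in> \<D>" "open U" by blast
      have "f -` U \<inter> space ?S \<in> sets ?S" by (rule measurable_sets[OF meas[OF s(2)]]) (simp add: s(3))
      moreover have "open (f -` U)" using D_continuous[OF s(2)] s(3) by (intro open_vimage)
      ultimately have "s \<in> ?\<B>" using s by (simp add: space_measure_of_conv)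
      then show ?case by (intro ballI bexI[of _ s] conjI order_refl)
    qed
  qed
  have "U \<in> sigma_sets UNIV cells" if U: "open U" for U
  proof -
    let ?\<U> = "{b\<in>?\<B>. b \<subseteq> U}"
    have "open b" if "b \<in> ?\<U>" for b using that by blast
    then have "\<exists>\<V>\<subseteq>?\<U>. countable \<V> \<and> \<Union>\<V> = \<Union>?\<U>" by (rule Luzin_Lindelof[OF Luzin])
    then obtain \<V> where \<V>: "\<V> \<subseteq> ?\<U>" "countable \<V>" "\<Union>\<V> = \<Union>?\<U>" by blast
    have "\<Union>?\<U> = U" using base[OF U] by blast
    then have "U = \<Union>\<V>" using \<V>(3) by simp
    also have "\<dots> \<in> sets ?S" using \<V> by (intro sets.countable_Union) auto
    finally show ?thesis by (simp add: sS)
  qed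
  then show "sets borel \<subseteq> sigma_sets UNIV cells"
    unfolding sets_borel by (intro sigma_sets_mono) auto
qed

text \<open>
  The functions in the domain separate points; hence they vanish simultaneously at one point at
  most, and this point has measure zero because \<open>m\<close> is atomless.
\<close>

definition zero_set :: "'x set" where
  "zero_set = {x. \<forall>f\<in>\<D>. f x = 0}"

lemma zero_set_null: "zero_set \<in> sets m" "emeasure m zero_set = 0" "zero_set \<in> sets borel"
proof -
  have sub: "x = y" if xy: "x \<in> zero_set" "y \<in> zero_set" for x y
  proof (rule ccontr)
    assume "x \<noteq> y"
    then obtain U V where UV: "open U" "x \<in> U" "y \<notin> U"
      using t1_space_class.t1_space by blast
    have "generate_topology {f -` U | f U. f \<in> \<D> \<and> open U} U"
      using UV(1) by (rule iffD1[OF fun_cong[OF D_generates]])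
    then have "x \<in> U \<longleftrightarrow> y \<in> U"
    proof induction
      case (Basis s)
      then obtain f O' where "s = f -` O'" "f \<in> \<D>" by blast
      moreover from this xy have "f x = 0" "f y = 0" by (auto simp: zero_set_def)
      ultimately show ?case by simp
    qed auto
    then show False using UV by simp
  qed
  then have "zero_set = {} \<or> (\<exists>x. zero_set = {x})" by blast
  moreover have "emeasure m {x} = 0" for x
  proof -
    have "emeasure m B = 0 \<or> emeasure m ({x} - B) = 0" if "B \<subseteq> {x}" for B
      using that by (auto simp: subset_singleton_iff)
    then show ?thesis
      using atomless[of "{x}"] singletons[of x] by (auto simp: measure_atom_def zero_less_iff_neq_zero)
  qed
  ultimately show "zero_set \<in> sets m" "emeasure m zero_set = 0" "zero_set \<in> sets borel"
    using singletons by auto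
qed

lemma countable_cover:
  "\<exists>f :: nat \<Rightarrow> 'x \<Rightarrow> real. (\<forall>n. f n \<in> \<D>) \<and> (\<Union>n. {x. 0 < f n x}) = - zero_set"
proof -
  let ?\<U> = "(\<lambda>f. {x. 0 < f x}) ` \<D>"
  have "open {x. 0 < f x}" if "f \<in> \<D>" for f :: "'x \<Rightarrow> real"
    using that D_subset by (intro open_Collect_less continuous_on_const) (auto simp: bounded_continuous_def)
  then have "open U" if "U \<in> ?\<U>" for U using that by blast
  then have "\<exists>\<V>\<subseteq>?\<U>. countable \<V> \<and> \<Union>\<V> = \<Union>?\<U>" by (rule Luzin_Lindelof[OF Luzin])
  then obtain \<V> where \<V>: "\<V> \<subseteq> ?\<U>" "countable \<V>" "\<Union>\<V> = \<Union>?\<U>" by blast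
  obtain C where C: "C \<subseteq> \<D>" "countable C" "\<V> = (\<lambda>f. {x. 0 < f x}) ` C"
    using \<V>(1,2) by (metis countable_subset_image)
  let ?C = "insert (\<lambda>_. 0) C"
  let ?f = "from_nat_into ?C"
  have r: "range ?f = ?C" using C(2) by (intro range_from_nat_into) auto
  have "(\<Union>n. {x. 0 < ?f n x}) = (\<Union>f\<in>range ?f. {x. 0 < f x})" by blast
  also have "\<dots> = \<Union>\<V>" unfolding r C(3) by simp
  also have "\<dots> = - zero_set"
  proof -
    have "\<exists>f\<in>\<D>. 0 < f x" if "f \<in> \<D>" "f x \<noteq> 0" for f x
    proof (cases "0 < f x")
      case False
      then show ?thesis using that D_scale[OF that(1), of "-1"] by (intro bexI[of _ "\<lambda>x. - 1 * f x"]) auto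
    qed (use that in blast)
    then show ?thesis unfolding \<V>(3) by (force simp: zero_set_def)
  qed
  finally have "(\<Union>n. {x. 0 < ?f n x}) = - zero_set" .
  moreover have "?f n \<in> \<D>" for n using rangeI[of ?f n] C(1) D_zero unfolding r by auto
  ultimately show ?thesis by (intro exI[of _ ?f]) simp
qed

text \<open>Measurable sets are Borel up to null sets.\<close>

lemma borel_approx:
  assumes "A \<in> sets m"
  shows "\<exists>B\<in>sets borel. \<exists>N\<in>sets m. emeasure m N = 0 \<and> A - N = B - N"
proof -
  have sub: "subalgebra m borel" using borel_subset space_m by (simp add: subalgebra_def)
  have "A \<in> sets (completion (restr_to_subalg m borel))" using assms subset_completion by blast
  then obtain B N N' where B: "A = B \<union> N" "N \<subseteq> N'" "N' \<in> null_sets (restr_to_subalg m borel)"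
    "B \<in> sets (restr_to_subalg m borel)" by (rule sets_completionE) auto
  have N': "N' \<in> sets borel" "emeasure m N' = 0"
    using B(3) sub by (auto simp: null_sets_def sets_restr_to_subalg emeasure_restr_to_subalg)
  have "A - N' = B - N'" using B by auto
  moreover have "B \<in> sets borel" using B(4) sub by (simp add: sets_restr_to_subalg)
  ultimately show ?thesis using N' borel_subset by blast
qed

end

lemma logistic_at_top: "(logistic \<longlongrightarrow> 1) at_top"
  and logistic_at_bot: "(logistic \<longlongrightarrow> 0) at_bot"
proof -
  have "((\<lambda>t::real. 1 / (1 + exp (- t))) \<longlongrightarrow> 1 / (1 + 0)) at_top"
    by (intro tendsto_intros filterlim_compose[OF exp_at_bot] filterlim_uminus_at_bot_at_top) auto
  then show "(logistic \<longlongrightarrow> 1) at_top" by (simp add: logistic_def[abs_def])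
  have "filterlim (\<lambda>t::real. 1 + exp (- t)) at_top at_bot"
    by (intro filterlim_tendsto_add_at_top[OF tendsto_const] filterlim_compose[OF exp_at_top] filterlim_uminus_at_top_at_bot)
  then have "((\<lambda>t::real. inverse (1 + exp (- t))) \<longlongrightarrow> 0) at_bot"
    by (rule tendsto_inverse_0_at_top)
  then show "(logistic \<longlongrightarrow> 0) at_bot" by (simp add: logistic_def[abs_def] inverse_eq_divide)
qed

text \<open>Smooth approximations of the indicator of \<open>{c<..}\<close>, converging also at \<open>c\<close>.\<close>

definition soft_step :: "real \<Rightarrow> nat \<Rightarrow> real \<Rightarrow> real" where
  "soft_step c n t = logistic ((real n)\<^sup>2 * t + (- (real n)\<^sup>2 * c - real n))"

lemma soft_step_bounds: "0 \<le> soft_step c n t" "soft_step c n t \<le> 1"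
  by (simp_all add: soft_step_def logistic_gt_0 logistic_lt_1 less_imp_le)

lemma soft_step_tendsto: "(\<lambda>n. soft_step c n t) \<longlonglongrightarrow> indicator {c<..} t"
proof (cases "c < t")
  case True
  have "filterlim (\<lambda>n. real n * (real n * (t - c) - 1)) at_top sequentially"
  proof (rule filterlim_at_top_mult_at_top[OF filterlim_real_sequentially])
    have "filterlim (\<lambda>n. (t - c) * real n) at_top sequentially"
      using True by (intro filterlim_tendsto_pos_mult_at_top[OF tendsto_const] filterlim_real_sequentially) auto
    then have "filterlim (\<lambda>n. -1 + (t - c) * real n) at_top sequentially"
      by (rule filterlim_tendsto_add_at_top[OF tendsto_const])
    then show "filterlim (\<lambda>n. real n * (t - c) - 1) at_top sequentially" by (simp add: mult.commute)
  qed
  also have "(\<lambda>n. real n * (real n * (t - c) - 1)) = (\<lambda>n. (real n)\<^sup>2 * t + (- (real n)\<^sup>2 * c - real n))"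
    by (auto simp: algebra_simps power2_eq_square)
  finally have "(\<lambda>n. soft_step c n t) \<longlonglongrightarrow> 1"
    unfolding soft_step_def by (rule filterlim_compose[OF logistic_at_top])
  then show ?thesis using True by simp
next
  case False
  have "filterlim (\<lambda>n. (real n)\<^sup>2 * t + (- (real n)\<^sup>2 * c - real n)) at_bot sequentially"
  proof (rule filterlim_at_bot_mono)
    show "filterlim (\<lambda>n. - real n) at_bot sequentially"
      by (rule filterlim_compose[OF filterlim_uminus_at_bot_at_top filterlim_real_sequentially])
    show "\<forall>\<^sub>F n in sequentially. (real n)\<^sup>2 * t + (- (real n)\<^sup>2 * c - real n) \<le> - real n"
      using False by (intro always_eventually allI) (simp add: mult_left_mono)
  qed
  then have "(\<lambda>n. soft_step c n t) \<longlonglongrightarrow> 0"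
    unfolding soft_step_def by (rule filterlim_compose[OF logistic_at_bot])
  then show ?thesis using False by simp
qed

lemma Cb_smooth_soft_step: "(\<lambda>x. soft_step c n (x 0)) \<in> Cb_smooth 1"
  unfolding soft_step_def by (rule Cb_smooth_logistic_coord)

subsection \<open>Events approximable by cylinder functions\<close>

context cond_closable_measure
begin

abbreviation unit_valued :: "'x cylinder \<Rightarrow> bool" where
  "unit_valued a \<equiv> \<forall>\<gamma>. 0 \<le> cyl_fun a \<gamma> \<and> cyl_fun a \<gamma> \<le> 1"

abbreviation ind_dist :: "'x measure set \<Rightarrow> 'x cylinder \<Rightarrow> real" where
  "ind_dist A a \<equiv> \<integral>\<gamma>. \<bar>indicator A \<gamma> - cyl_fun a \<gamma>\<bar> \<partial>\<mu>"

text \<open>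
  Events whose indicator is an \<open>L\<^sup>1\<close>-limit of cylinder functions with values in \<open>[0, 1]\<close>. The bounds
  make products of approximating functions approximate intersections, so that these events form a
  \<open>\<sigma>\<close>-algebra.
\<close>

definition approximable :: "'x measure set set" where
  "approximable = {A \<in> sets \<mu>. \<forall>\<epsilon>>0. \<exists>a\<in>Cyl. unit_valued a \<and> ind_dist A a < \<epsilon>}"

lemma indicator_integrable: "A \<in> sets \<mu> \<Longrightarrow> integrable \<mu> (indicator A :: _ \<Rightarrow> real)"
  by (rule integrable_real_indicator) (simp_all add: less_top[symmetric])

lemma indicator_diff_integrable:
  assumes "A \<in> sets \<mu>" "a \<in> Cyl"
  shows "integrable \<mu> (\<lambda>\<gamma>. \<bar>indicator A \<gamma> - cyl_fun a \<gamma>\<bar>)"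
proof -
  have "integrable \<mu> (cyl_fun a)"
    using mu.integral_abs_le_sqrt(1) V_sq_integrable cyl_fun_V[OF assms(2)] by blast
  then show ?thesis using assms(1) by (intro integrable_abs Bochner_Integration.integrable_diff indicator_integrable)
qed

lemma approximableD:
  assumes "A \<in> approximable" "\<epsilon> > 0"
  obtains a where "a \<in> Cyl" "\<And>\<gamma>. 0 \<le> cyl_fun a \<gamma>" "\<And>\<gamma>. cyl_fun a \<gamma> \<le> 1"
    "ind_dist A a < \<epsilon>"
  using assms unfolding approximable_def by blast

lemma approximable_cong:
  assumes "A \<in> approximable" "B \<in> sets \<mu>" "AE \<gamma> in \<mu>. \<gamma> \<in> A \<longleftrightarrow> \<gamma> \<in> B"
  shows "B \<in> approximable"
proof -
  have A: "A \<in> sets \<mu>" using assms(1) by (simp add: approximable_def)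
  have eq: "ind_dist A a = ind_dist B a"
    if "a \<in> Cyl" for a
  proof (rule integral_cong_AE)
    show "AE \<gamma> in \<mu>. \<bar>indicator A \<gamma> - cyl_fun a \<gamma>\<bar> = \<bar>indicator B \<gamma> - cyl_fun a \<gamma>\<bar>"
      using assms(3) by eventually_elim (simp add: indicator_def)
  qed (rule borel_measurable_integrable[OF indicator_diff_integrable[OF _ that]], rule A assms(2))+
  have "\<exists>a\<in>Cyl. unit_valued a \<and> ind_dist B a < \<epsilon>" if \<epsilon>: "\<epsilon> > 0" for \<epsilon>
  proof -
    obtain a where a: "a \<in> Cyl" "\<And>\<gamma>. 0 \<le> cyl_fun a \<gamma>" "\<And>\<gamma>. cyl_fun a \<gamma> \<le> 1"
      "ind_dist A a < \<epsilon>" by (rule approximableD[OF assms(1) \<epsilon>]) blast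
    then show ?thesis by (intro bexI[OF _ a(1)]) (simp add: eq[OF a(1)])
  qed
  then show ?thesis using assms(2) unfolding approximable_def by simp
qed

lemma approximable_empty: "{} \<in> approximable"
proof -
  have "\<exists>a\<in>Cyl. unit_valued a \<and> ind_dist {} a < \<epsilon>" if "\<epsilon> > 0" for \<epsilon>
    by (rule bexI[OF _ cyl_const_in[of 0 undefined]]) (use that in simp)
  then show ?thesis unfolding approximable_def by simp
qed

lemma approximable_Compl:
  assumes "A \<in> approximable" shows "space \<mu> - A \<in> approximable"
proof -
  have A: "A \<in> sets \<mu>" using assms by (simp add: approximable_def)
  have "\<exists>b\<in>Cyl. unit_valued b \<and> ind_dist (space \<mu> - A) b < \<epsilon>" if \<epsilon>: "\<epsilon> > 0" for \<epsilon>
  proof -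
    obtain a where a: "a \<in> Cyl" "\<And>\<gamma>. 0 \<le> cyl_fun a \<gamma>" "\<And>\<gamma>. cyl_fun a \<gamma> \<le> 1"
      "ind_dist A a < \<epsilon>" by (rule approximableD[OF assms \<epsilon>]) blast
    let ?one = "(0, \<lambda>_. 1, undefined) :: 'x cylinder"
    have one: "?one \<in> Cyl" by (rule cyl_const_in)
    let ?b = "cyl_diff ?one a"
    have b: "cyl_fun ?b \<gamma> = 1 - cyl_fun a \<gamma>" for \<gamma> by (simp add: cyl_fun_diff[OF one a(1)])
    have "ind_dist (space \<mu> - A) ?b = ind_dist A a"
      unfolding b by (intro Bochner_Integration.integral_cong) (auto simp: indicator_def)
    then show ?thesis using a cyl_diff_in[OF one a(1)] by (intro bexI[of _ ?b]) (auto simp: b)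
  qed
  then show ?thesis using A unfolding approximable_def by auto
qed

lemma approximable_Int:
  assumes "A \<in> approximable" "B \<in> approximable" shows "A \<inter> B \<in> approximable"
proof -
  have AB: "A \<in> sets \<mu>" "B \<in> sets \<mu>" using assms by (simp_all add: approximable_def)
  have "\<exists>c\<in>Cyl. unit_valued c \<and>
     (\<integral>\<gamma>. \<bar>indicator (A \<inter> B) \<gamma> - cyl_fun c \<gamma>\<bar> \<partial>\<mu>) < \<epsilon>" if "\<epsilon> > 0" for \<epsilon>
  proof -
    have \<epsilon>: "\<epsilon> / 2 > 0" using that by simp
    obtain a where a: "a \<in> Cyl" "\<And>\<gamma>. 0 \<le> cyl_fun a \<gamma>" "\<And>\<gamma>. cyl_fun a \<gamma> \<le> 1"
      "ind_dist A a < \<epsilon> / 2" by (rule approximableD[OF assms(1) \<epsilon>]) blast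
    obtain b where b: "b \<in> Cyl" "\<And>\<gamma>. 0 \<le> cyl_fun b \<gamma>" "\<And>\<gamma>. cyl_fun b \<gamma> \<le> 1"
      "ind_dist B b < \<epsilon> / 2" by (rule approximableD[OF assms(2) \<epsilon>]) blast
    let ?c = "cyl_mult a b"
    have c: "?c \<in> Cyl" by (rule cyl_mult_in[OF a(1) b(1)])
    have cf: "cyl_fun ?c \<gamma> = cyl_fun a \<gamma> * cyl_fun b \<gamma>" for \<gamma> by (rule cyl_fun_add(2)[OF a(1) b(1)])
    note ia = indicator_diff_integrable[OF AB(1) a(1)] and ib = indicator_diff_integrable[OF AB(2) b(1)]
    have "ind_dist (A \<inter> B) ?c \<le>
      (\<integral>\<gamma>. \<bar>indicator A \<gamma> - cyl_fun a \<gamma>\<bar> + \<bar>indicator B \<gamma> - cyl_fun b \<gamma>\<bar> \<partial>\<mu>)"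
    proof (rule integral_mono)
      show "integrable \<mu> (\<lambda>\<gamma>. \<bar>indicator (A \<inter> B) \<gamma> - cyl_fun ?c \<gamma>\<bar>)"
        by (rule indicator_diff_integrable[OF _ c]) (use AB in auto)
      fix \<gamma>
      have "\<bar>p * q - u * v\<bar> \<le> \<bar>p - u\<bar> + \<bar>q - v\<bar>" if "0 \<le> q" "q \<le> 1" "0 \<le> u" "u \<le> 1" for p q u v :: real
      proof -
        have "p * q - u * v = (p - u) * q + u * (q - v)" by (simp add: algebra_simps)
        then have "\<bar>p * q - u * v\<bar> \<le> \<bar>p - u\<bar> * q + u * \<bar>q - v\<bar>"
          using abs_triangle_ineq[of "(p - u) * q" "u * (q - v)"] that by (simp add: abs_mult)
        also have "\<dots> \<le> \<bar>p - u\<bar> * 1 + 1 * \<bar>q - v\<bar>"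
          using that by (intro add_mono mult_left_mono mult_right_mono) auto
        finally show ?thesis by simp
      qed
      from this[of "indicator B \<gamma>" "cyl_fun a \<gamma>" "indicator A \<gamma>" "cyl_fun b \<gamma>"]
      show "\<bar>indicator (A \<inter> B) \<gamma> - cyl_fun ?c \<gamma>\<bar> \<le> \<bar>indicator A \<gamma> - cyl_fun a \<gamma>\<bar> + \<bar>indicator B \<gamma> - cyl_fun b \<gamma>\<bar>"
        using a(2,3) by (simp add: cf indicator_inter_arith)
    qed (use ia ib in auto)
    also have "\<dots> < \<epsilon>" using a(4) b(4) ia ib by simp
    finally show ?thesis using c a b by (intro bexI[of _ ?c]) (auto simp: cf mult_le_one)
  qed
  then show ?thesis using AB unfolding approximable_def by auto
qed

lemma approximable_Un:
  assumes "A \<in> approximable" "B \<in> approximable" shows "A \<union> B \<in> approximable"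
proof -
  have "A \<subseteq> space \<mu>" "B \<subseteq> space \<mu>" using assms sets.sets_into_space by (auto simp: approximable_def)
  then have "A \<union> B = space \<mu> - ((space \<mu> - A) \<inter> (space \<mu> - B))" by auto
  then show ?thesis using assms by (simp only: approximable_Compl approximable_Int)
qed

text \<open>Pointwise convergence of indicators implies convergence in \<open>L\<^sup>1\<close>.\<close>

lemma approximable_limit:
  assumes A: "A \<in> sets \<mu>" and B: "\<And>n. B n \<in> approximable"
    and lim: "\<And>\<gamma>. \<gamma> \<in> space \<mu> \<Longrightarrow> (\<lambda>n. indicator (B n) \<gamma> :: real) \<longlonglongrightarrow> indicator A \<gamma>"
  shows "A \<in> approximable"
proof -
  have Bs: "B n \<in> sets \<mu>" for n using B by (simp add: approximable_def)
  have "(\<lambda>n. \<integral>\<gamma>. \<bar>indicator A \<gamma> - indicator (B n) \<gamma>\<bar> \<partial>\<mu>) \<longlonglongrightarrow> (\<integral>\<gamma>. (0::real) \<partial>\<mu>)"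
  proof (rule integral_dominated_convergence[where w = "\<lambda>_. 1"])
    show "AE \<gamma> in \<mu>. (\<lambda>n. \<bar>indicator A \<gamma> - indicator (B n) \<gamma>\<bar> :: real) \<longlonglongrightarrow> 0"
    proof (rule AE_I2)
      fix \<gamma> assume "\<gamma> \<in> space \<mu>"
      from tendsto_rabs[OF tendsto_diff[OF tendsto_const lim[OF this], of "indicator A \<gamma>"]]
      show "(\<lambda>n. \<bar>indicator A \<gamma> - indicator (B n) \<gamma>\<bar> :: real) \<longlonglongrightarrow> 0" by simp
    qed
  qed (use A Bs in \<open>auto simp: indicator_def\<close>)
  then have lim0: "(\<lambda>n. \<integral>\<gamma>. \<bar>indicator A \<gamma> - indicator (B n) \<gamma>\<bar> \<partial>\<mu>) \<longlonglongrightarrow> (0::real)" by simp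
  have "\<exists>a\<in>Cyl. unit_valued a \<and> ind_dist A a < \<epsilon>" if "\<epsilon> > 0" for \<epsilon>
  proof -
    have \<epsilon>: "\<epsilon> / 2 > 0" using that by simp
    obtain n where n: "(\<integral>\<gamma>. \<bar>indicator A \<gamma> - indicator (B n) \<gamma>\<bar> \<partial>\<mu>) < \<epsilon> / 2"
      using eventually_happens'[OF sequentially_bot order_tendstoD(2)[OF lim0 \<epsilon>]] by blast
    obtain a where a: "a \<in> Cyl" "\<And>\<gamma>. 0 \<le> cyl_fun a \<gamma>" "\<And>\<gamma>. cyl_fun a \<gamma> \<le> 1"
      "ind_dist (B n) a < \<epsilon> / 2" by (rule approximableD[OF B \<epsilon>]) blast
    have i1: "integrable \<mu> (\<lambda>\<gamma>. \<bar>indicator A \<gamma> - indicator (B n) \<gamma>\<bar> :: real)"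
      by (intro integrable_abs Bochner_Integration.integrable_diff indicator_integrable A Bs)
    note i2 = indicator_diff_integrable[OF Bs a(1)]
    have "ind_dist A a \<le>
      (\<integral>\<gamma>. \<bar>indicator A \<gamma> - indicator (B n) \<gamma>\<bar> + \<bar>indicator (B n) \<gamma> - cyl_fun a \<gamma>\<bar> \<partial>\<mu>)"
      by (rule integral_mono[OF indicator_diff_integrable[OF A a(1)]]) (use i1 i2 in auto)
    also have "\<dots> < \<epsilon>" using a(4) n i1 i2 by simp
    finally show ?thesis using a by blast
  qed
  then show ?thesis using A unfolding approximable_def by auto
qed

lemma approximable_sigma_algebra: "sigma_algebra (space \<mu>) approximable"
  unfolding sigma_algebra_iff2
proof (intro conjI ballI allI impI)
  show "approximable \<subseteq> Pow (space \<mu>)" using sets.sets_into_space by (auto simp: approximable_def)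
  fix A :: "nat \<Rightarrow> 'x measure set" assume A: "range A \<subseteq> approximable"
  have fin: "(\<Union>i<n. A i) \<in> approximable" for n
    by (induction n) (use A in \<open>auto simp: approximable_empty lessThan_Suc intro!: approximable_Un\<close>)
  show "(\<Union>i. A i) \<in> approximable"
  proof (rule approximable_limit[OF _ fin])
    show "(\<Union>i. A i) \<in> sets \<mu>" using A by (intro sets.countable_UN) (auto simp: approximable_def)
    show "(\<lambda>n. indicator (\<Union>i<n. A i) \<gamma> :: real) \<longlonglongrightarrow> indicator (\<Union>i. A i) \<gamma>" for \<gamma>
      by (rule LIMSEQ_indicator_UN)
  qed
qed (auto intro: approximable_empty approximable_Compl)

text \<open>Only the \<open>\<sigma>\<close>-algebra of this measure, that of the approximable events, is used.\<close>

definition \<mu>a :: "'x measure measure" where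
  "\<mu>a = sigma (space \<mu>) approximable"

lemma space_\<mu>a: "space \<mu>a = Conf"
  using sets.sets_into_space by (auto simp: \<mu>a_def space_measure_of_conv space_mu)

lemma sets_\<mu>a: "sets \<mu>a = approximable"
  unfolding \<mu>a_def by (rule sigma_algebra.sets_measure_of_eq[OF approximable_sigma_algebra])

lemma star_approximable:
  assumes f: "f \<in> \<D>" shows "(\<lambda>\<gamma>. \<integral>x. f x \<partial>\<gamma>) \<in> borel_measurable \<mu>a"
  unfolding borel_measurable_iff_greater
proof
  fix c :: real
  let ?A = "{\<gamma> \<in> space \<mu>a. c < (\<integral>x. f x \<partial>\<gamma>)}"
  have fm: "(\<lambda>\<gamma>. \<integral>x. f x \<partial>\<gamma>) \<in> borel_measurable \<mu>"
    by (intro measurable_mu measurable_integral_CS D_measurable f)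
  have A: "?A \<in> sets \<mu>" using fm by (simp add: space_\<mu>a flip: space_mu)
  let ?a = "\<lambda>n. (1, \<lambda>x. soft_step c n (x 0), \<lambda>_. f)"
  have a: "?a n \<in> Cyl" for n using Cb_smooth_soft_step f by (auto simp: cylinders_def)
  have "(\<lambda>n. ind_dist ?A (?a n)) \<longlonglongrightarrow> (\<integral>\<gamma>. (0::real) \<partial>\<mu>)"
  proof (rule integral_dominated_convergence[where w = "\<lambda>_. 1"])
    show "AE \<gamma> in \<mu>. (\<lambda>n. \<bar>indicator ?A \<gamma> - cyl_fun (?a n) \<gamma>\<bar>) \<longlonglongrightarrow> 0"
    proof (rule AE_I2)
      fix \<gamma> assume "\<gamma> \<in> space \<mu>"
      then have "indicator ?A \<gamma> = (indicator {c<..} (\<integral>x. f x \<partial>\<gamma>) :: real)"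
        by (auto simp: indicator_def space_\<mu>a space_mu)
      moreover have "(\<lambda>n. \<bar>(indicator {c<..} (\<integral>x. f x \<partial>\<gamma>) :: real) - soft_step c n (\<integral>x. f x \<partial>\<gamma>)\<bar>) \<longlonglongrightarrow>
          \<bar>indicator {c<..} (\<integral>x. f x \<partial>\<gamma>) - indicator {c<..} (\<integral>x. f x \<partial>\<gamma>)\<bar>"
        by (intro tendsto_intros soft_step_tendsto)
      ultimately show "(\<lambda>n. \<bar>indicator ?A \<gamma> - cyl_fun (?a n) \<gamma>\<bar>) \<longlonglongrightarrow> 0" by simp
    qed
    show "AE \<gamma> in \<mu>. norm \<bar>indicator ?A \<gamma> - cyl_fun (?a n) \<gamma>\<bar> \<le> 1" for n
    proof (rule AE_I2)
      fix \<gamma>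
      show "norm \<bar>indicator ?A \<gamma> - cyl_fun (?a n) \<gamma>\<bar> \<le> 1"
        using soft_step_bounds[of c n "\<integral>x. f x \<partial>\<gamma>"] by (cases "\<gamma> \<in> ?A") simp_all
    qed
    show "(\<lambda>\<gamma>. \<bar>indicator ?A \<gamma> - cyl_fun (?a n) \<gamma>\<bar>) \<in> borel_measurable \<mu>" for n
      by (rule borel_measurable_integrable[OF indicator_diff_integrable[OF A a]])
  qed simp_all
  then have lim: "(\<lambda>n. ind_dist ?A (?a n)) \<longlonglongrightarrow> 0" by simp
  have "\<exists>a\<in>Cyl. unit_valued a \<and> ind_dist ?A a < \<epsilon>" if \<epsilon>: "\<epsilon> > 0" for \<epsilon>
  proof -
    obtain n where "ind_dist ?A (?a n) < \<epsilon>"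
      using eventually_happens'[OF sequentially_bot order_tendstoD(2)[OF lim \<epsilon>]] by blast
    then show ?thesis using a[of n] soft_step_bounds by (intro bexI[of _ "?a n"]) auto
  qed
  then show "?A \<in> sets \<mu>a" unfolding sets_\<mu>a approximable_def using A by blast
qed

lemma D_soft_step_mult:
  assumes "f \<in> \<D>" "\<phi> \<in> \<D>" shows "(\<lambda>x. soft_step c n (f x) * \<phi> x) \<in> \<D>"
    and "(\<lambda>x. soft_step c n (f x) - soft_step c n 0) \<in> \<D>"
proof -
  show 1: "(\<lambda>x. soft_step c n (f x) - soft_step c n 0) \<in> \<D>"
    using D_compose[OF Cb_smooth_soft_step, of "\<lambda>_. f" c n] assms(1) by simp
  have "(\<lambda>x. (soft_step c n (f x) - soft_step c n 0) * \<phi> x + soft_step c n 0 * \<phi> x) \<in> \<D>"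
    by (intro D_add D_mult D_scale 1 assms)
  then show "(\<lambda>x. soft_step c n (f x) * \<phi> x) \<in> \<D>" by (simp add: algebra_simps)
qed

lemma cells_sets_m: "sigma_sets UNIV cells \<subseteq> sets m"
  using sigma_cells borel_subset by simp

text \<open>
  The factors \<open>indicator {f > c}\<close> are removed one at a time: each of them is a limit of smooth functions
  of \<open>f\<close>, whose product with \<open>\<phi>\<close> is again in \<open>\<D>\<close>.
\<close>

lemma cell_integral_approximable:
  assumes "fst ` set l \<subseteq> \<D>" "\<phi> \<in> \<D>"
  shows "(\<lambda>\<gamma>. \<integral>x. indicator {x. \<forall>(f, c)\<in>set l. c < f x} x * \<phi> x \<partial>\<gamma>) \<in> borel_measurable \<mu>a"
  using assms
proof (induction l arbitrary: \<phi>)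
  case Nil
  then show ?case using star_approximable by simp
next
  case (Cons p l)
  obtain f c where p: "p = (f, c)" by (cases p)
  have f: "f \<in> \<D>" using Cons.prems p by simp
  let ?B = "{x. \<forall>(f, c)\<in>set l. c < f x}" and ?B' = "{x. \<forall>(f, c)\<in>set (p # l). c < f x}"
  have "?B \<in> cells" using Cons.prems(1) unfolding cells_def by auto
  then have Bm: "?B \<in> sets m" using cells_sets_m by (auto intro: sigma_sets.Basic)
  show ?case
  proof (rule borel_measurable_LIMSEQ_real)
    show "(\<lambda>\<gamma>. \<integral>x. indicator ?B x * (soft_step c n (f x) * \<phi> x) \<partial>\<gamma>) \<in> borel_measurable \<mu>a" for n
      using Cons.prems by (intro Cons.IH D_soft_step_mult f) auto
    fix \<gamma> assume "\<gamma> \<in> space \<mu>a"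
    then have \<gamma>: "\<gamma> \<in> Conf" by (simp add: space_\<mu>a)
    note [measurable_cong] = Conf_sets[OF \<gamma>]
    have [measurable]: "?B \<in> sets \<gamma>" "f \<in> borel_measurable \<gamma>" "\<phi> \<in> borel_measurable \<gamma>"
      using Bm D_measurable[OF f] D_measurable[OF Cons.prems(2)] by (simp_all add: Conf_sets[OF \<gamma>] cong: measurable_cong_sets)
    have sm: "(\<lambda>x. soft_step c n (f x) * \<phi> x) \<in> borel_measurable \<gamma>" for n
      using borel_measurable_integrable[OF D_integrable[OF D_soft_step_mult(1)[OF f Cons.prems(2)] \<gamma>]] .
    have eq: "indicator ?B' x = indicator ?B x * (indicator {c<..} (f x) :: real)" for x
      by (auto simp: p indicator_def)
    show "(\<lambda>n. \<integral>x. indicator ?B x * (soft_step c n (f x) * \<phi> x) \<partial>\<gamma>) \<longlonglongrightarrow> (\<integral>x. indicator ?B' x * \<phi> x \<partial>\<gamma>)"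
      unfolding eq
    proof (rule integral_dominated_convergence[where w = "\<lambda>x. \<bar>\<phi> x\<bar>"])
      show "integrable \<gamma> (\<lambda>x. \<bar>\<phi> x\<bar>)" using D_integrable[OF Cons.prems(2) \<gamma>] by simp
      have "(\<lambda>n. indicator ?B x * (soft_step c n (f x) * \<phi> x)) \<longlonglongrightarrow> indicator ?B x * (indicator {c<..} (f x) * \<phi> x)" for x
        by (intro tendsto_intros soft_step_tendsto)
      then show "AE x in \<gamma>. (\<lambda>n. indicator ?B x * (soft_step c n (f x) * \<phi> x)) \<longlonglongrightarrow> indicator ?B x * indicator {c<..} (f x) * \<phi> x"
        by (simp add: mult.assoc)
      show "AE x in \<gamma>. norm (indicator ?B x * (soft_step c n (f x) * \<phi> x)) \<le> \<bar>\<phi> x\<bar>" for n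
        using soft_step_bounds[of c n] by (intro AE_I2) (auto simp: indicator_def abs_mult mult_left_le_one_le)
      show "(\<lambda>x. indicator ?B x * (soft_step c n (f x) * \<phi> x)) \<in> borel_measurable \<gamma>" for n
        using sm by measurable
    qed measurable
  qed
qed

lemma borel_integral_approximable:
  assumes "B \<in> sets borel" and \<phi>: "\<phi> \<in> \<D>"
  shows "(\<lambda>\<gamma>. \<integral>x. indicator B x * \<phi> x \<partial>\<gamma>) \<in> borel_measurable \<mu>a"
proof -
  have "Int_stable cells" using cells_Int by (auto simp: Int_stable_def)
  moreover have "cells \<subseteq> Pow UNIV" by simp
  moreover have "B \<in> sigma_sets UNIV cells" using assms(1) sigma_cells by simp
  ultimately show ?thesis
  proof (induction rule: sigma_sets_induct_disjoint)
    case (basic A)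
    then obtain l where "A = {x. \<forall>(f, c)\<in>set l. c < f x}" "fst ` set l \<subseteq> \<D>" by (auto simp: cells_def)
    then show ?case using cell_integral_approximable[OF _ \<phi>] by simp
  next
    case empty
    then show ?case by simp
  next
    case (compl A)
    have Am: "A \<in> sets m" using compl cells_sets_m by blast
    have "(\<integral>x. indicator (UNIV - A) x * \<phi> x \<partial>\<gamma>) = (\<integral>x. \<phi> x \<partial>\<gamma>) - (\<integral>x. indicator A x * \<phi> x \<partial>\<gamma>)"
      if "\<gamma> \<in> space \<mu>a" for \<gamma>
    proof -
      have \<gamma>: "\<gamma> \<in> Conf" using that by (simp add: space_\<mu>a)
      have int: "integrable \<gamma> \<phi>" by (rule D_integrable[OF \<phi> \<gamma>])
      have "integrable \<gamma> (\<lambda>x. indicator A x * \<phi> x)"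
        using integrable_real_mult_indicator[OF _ int, of A] Am Conf_sets[OF \<gamma>] by (simp add: mult.commute)
      then have "(\<integral>x. \<phi> x - indicator A x * \<phi> x \<partial>\<gamma>) = (\<integral>x. \<phi> x \<partial>\<gamma>) - (\<integral>x. indicator A x * \<phi> x \<partial>\<gamma>)"
        using int by simp
      moreover have "(\<lambda>x. indicator (UNIV - A) x * \<phi> x) = (\<lambda>x. \<phi> x - indicator A x * \<phi> x)"
        by (auto simp: indicator_def)
      ultimately show ?thesis by simp
    qed
    then show ?case using compl star_approximable[OF \<phi>] by (simp cong: measurable_cong)
  next
    case (union A)
    have Am: "A i \<in> sets m" for i using union cells_sets_m by blast
    show ?case
    proof (rule borel_measurable_LIMSEQ_real)
      show "(\<lambda>\<gamma>. \<Sum>i<n. \<integral>x. indicator (A i) x * \<phi> x \<partial>\<gamma>) \<in> borel_measurable \<mu>a" for n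
        using union by (intro borel_measurable_sum) auto
      fix \<gamma> assume "\<gamma> \<in> space \<mu>a"
      then have \<gamma>: "\<gamma> \<in> Conf" by (simp add: space_\<mu>a)
      have int: "integrable \<gamma> \<phi>" by (rule D_integrable[OF \<phi> \<gamma>])
      have As: "A i \<in> sets \<gamma>" for i using Am Conf_sets[OF \<gamma>] by simp
      have intA: "integrable \<gamma> (\<lambda>x. indicator (A i) x * \<phi> x)" for i
        using integrable_real_mult_indicator[OF As int] by (simp add: mult.commute)
      have fin: "(\<Sum>i<n. indicator (A i) x) = (indicator (\<Union>i<n. A i) x :: real)" for n x
        using union(1) by (intro indicator_UN_disjoint[symmetric]) (auto simp: disjoint_family_on_def)
      have "(\<lambda>n. \<integral>x. indicator (\<Union>i<n. A i) x * \<phi> x \<partial>\<gamma>) \<longlonglongrightarrow> (\<integral>x. indicator (\<Union>i. A i) x * \<phi> x \<partial>\<gamma>)"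
      proof (rule integral_dominated_convergence[where w = "\<lambda>x. \<bar>\<phi> x\<bar>"])
        show "AE x in \<gamma>. (\<lambda>n. indicator (\<Union>i<n. A i) x * \<phi> x) \<longlonglongrightarrow> indicator (\<Union>i. A i) x * \<phi> x"
          by (intro AE_I2 tendsto_mult tendsto_const LIMSEQ_indicator_UN)
        show "AE x in \<gamma>. norm (indicator (\<Union>i<n. A i) x * \<phi> x) \<le> \<bar>\<phi> x\<bar>" for n
          by (intro AE_I2) (simp add: indicator_def)
      qed (use int As in auto)
      moreover have "(\<Sum>i<n. \<integral>x. indicator (A i) x * \<phi> x \<partial>\<gamma>) = (\<integral>x. indicator (\<Union>i<n. A i) x * \<phi> x \<partial>\<gamma>)" for n
        unfolding fin[symmetric] sum_distrib_right by (rule Bochner_Integration.integral_sum[symmetric]) (rule intA)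
      ultimately show "(\<lambda>n. \<Sum>i<n. \<integral>x. indicator (A i) x * \<phi> x \<partial>\<gamma>) \<longlonglongrightarrow> (\<integral>x. indicator (\<Union>i. A i) x * \<phi> x \<partial>\<gamma>)"
        by simp
    qed
  qed
qed

text \<open>
  The indicator of \<open>{f > 0}\<close> is a limit of functions in \<open>\<D>\<close>, dominated by the indicator of an element of
  the ring outside of which \<open>f\<close> vanishes.
\<close>

lemma positive_part_approximable:
  assumes B: "B \<in> sets borel" and f: "f \<in> \<D>"
  shows "(\<lambda>\<gamma>. emeasure \<gamma> (B \<inter> {x. 0 < f x})) \<in> borel_measurable \<mu>a"
proof -
  obtain E where E: "E \<in> \<E>" "\<And>x. x \<notin> E \<Longrightarrow> f x = 0"
    using f D_subset by (auto simp: vanishing_outside_def)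
  let ?P = "{x. 0 < f x}"
  have P: "?P \<in> sets m" using D_measurable[OF f] space_m by (simp add: borel_measurable_iff_greater)
  have Bm: "B \<in> sets m" using B borel_subset by blast
  have "(\<lambda>\<gamma>. measure \<gamma> (B \<inter> ?P)) \<in> borel_measurable \<mu>a"
  proof (rule borel_measurable_LIMSEQ_real)
    show "(\<lambda>\<gamma>. \<integral>x. indicator B x * (soft_step 0 n (f x) - soft_step 0 n 0) \<partial>\<gamma>) \<in> borel_measurable \<mu>a" for n
      by (intro borel_integral_approximable B D_soft_step_mult(2)[OF f f])
    fix \<gamma> assume "\<gamma> \<in> space \<mu>a"
    then have \<gamma>: "\<gamma> \<in> Conf" by (simp add: space_\<mu>a)
    have [measurable]: "B \<in> sets \<gamma>" "?P \<in> sets \<gamma>" "E \<in> sets \<gamma>"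
      using Bm P ring_sets[OF E(1)] Conf_sets[OF \<gamma>] by auto
    have "(\<lambda>n. \<integral>x. indicator B x * (soft_step 0 n (f x) - soft_step 0 n 0) \<partial>\<gamma>) \<longlonglongrightarrow>
      (\<integral>x. indicator (B \<inter> ?P) x \<partial>\<gamma>)"
    proof (rule integral_dominated_convergence[where w = "indicator E"])
      show "AE x in \<gamma>. (\<lambda>n. indicator B x * (soft_step 0 n (f x) - soft_step 0 n 0)) \<longlonglongrightarrow> indicator (B \<inter> ?P) x"
      proof (rule AE_I2)
        fix x
        have "(\<lambda>n. indicator B x * (soft_step 0 n (f x) - soft_step 0 n 0)) \<longlonglongrightarrow>
            indicator B x * (indicator {0<..} (f x) - indicator {0<..} (0::real))"
          by (intro tendsto_intros soft_step_tendsto)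
        also have "indicator B x * (indicator {0<..} (f x) - indicator {0<..} (0::real)) = (indicator (B \<inter> ?P) x :: real)"
          by (auto simp: indicator_def)
        finally show "(\<lambda>n. indicator B x * (soft_step 0 n (f x) - soft_step 0 n 0)) \<longlonglongrightarrow> indicator (B \<inter> ?P) x" .
      qed
      show "AE x in \<gamma>. norm (indicator B x * (soft_step 0 n (f x) - soft_step 0 n 0)) \<le> indicator E x" for n
      proof (rule AE_I2)
        fix x
        have "\<bar>soft_step 0 n (f x) - soft_step 0 n 0\<bar> \<le> 1"
          using soft_step_bounds[of 0 n "f x"] soft_step_bounds[of 0 n 0] by (simp add: abs_le_iff)
        then show "norm (indicator B x * (soft_step 0 n (f x) - soft_step 0 n 0)) \<le> indicator E x"
          using E(2)[of x] by (cases "x \<in> E") (auto simp: indicator_def)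
      qed
      show "integrable \<gamma> (indicator E :: 'x \<Rightarrow> real)"
        using Conf_finite[OF \<gamma> E(1)] by (simp add: less_top)
      show "(\<lambda>x. indicator B x * (soft_step 0 n (f x) - soft_step 0 n 0)) \<in> borel_measurable \<gamma>" for n
        using borel_measurable_integrable[OF D_integrable[OF D_soft_step_mult(2)[OF f f] \<gamma>]] by measurable
    qed measurable
    then show "(\<lambda>n. \<integral>x. indicator B x * (soft_step 0 n (f x) - soft_step 0 n 0) \<partial>\<gamma>) \<longlonglongrightarrow> measure \<gamma> (B \<inter> ?P)"
      by simp
  qed
  moreover have "ennreal (measure \<gamma> (B \<inter> ?P)) = emeasure \<gamma> (B \<inter> ?P)" if "\<gamma> \<in> space \<mu>a" for \<gamma>
  proof -
    have \<gamma>: "\<gamma> \<in> Conf" using that by (simp add: space_\<mu>a)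
    have "B \<inter> ?P \<subseteq> E" using E(2) by force
    then have "emeasure \<gamma> (B \<inter> ?P) \<le> emeasure \<gamma> E"
      using ring_sets[OF E(1)] Conf_sets[OF \<gamma>] by (intro emeasure_mono) auto
    then have "emeasure \<gamma> (B \<inter> ?P) \<noteq> \<infinity>" using Conf_finite[OF \<gamma> E(1)] by (auto simp: top_unique)
    then show ?thesis by (simp add: emeasure_eq_ennreal_measure)
  qed
  ultimately show ?thesis
    using measurable_cong[of \<mu>a "\<lambda>\<gamma>. ennreal (measure \<gamma> (B \<inter> ?P))" "\<lambda>\<gamma>. emeasure \<gamma> (B \<inter> ?P)" borel] by simp
qed

lemma emeasure_approximable:
  assumes "B \<in> sets borel"
  shows "(\<lambda>\<gamma>. emeasure \<gamma> (B - zero_set)) \<in> borel_measurable \<mu>a"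
proof -
  obtain f :: "nat \<Rightarrow> 'x \<Rightarrow> real" where f: "\<And>n. f n \<in> \<D>" "(\<Union>n. {x. 0 < f n x}) = - zero_set"
    using countable_cover by blast
  let ?P = "\<lambda>n. {x. 0 < f n x}"
  have Pb: "?P n \<in> sets borel" for n
    using cells_single[OF f(1), of 0 n] sigma_cells by (auto intro: sigma_sets.Basic)
  let ?B = "\<lambda>n. (B - (\<Union>i<n. ?P i)) \<inter> ?P n"
  have B: "B - (\<Union>i<n. ?P i) \<in> sets borel" for n using assms Pb by auto
  have un: "(\<Union>n. ?B n) = B - zero_set"
  proof -
    have "(\<Union>n. ?B n) = B \<inter> (\<Union>n. disjointed ?P n)"
      by (auto simp: disjointed_def atLeast0LessThan)
    also have "\<dots> = B - zero_set" unfolding UN_disjointed_eq f(2) by auto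
    finally show ?thesis .
  qed
  have dis: "disjoint_family ?B"
    by (rule disjoint_family_subset[OF disjoint_family_disjointed[of ?P]]) (auto simp: disjointed_def atLeast0LessThan)
  have "emeasure \<gamma> (B - zero_set) = (\<Sum>n. emeasure \<gamma> (?B n))" if "\<gamma> \<in> space \<mu>a" for \<gamma>
  proof -
    have "range ?B \<subseteq> sets \<gamma>"
      using that B Pb borel_subset Conf_sets[of \<gamma>] by (auto simp: space_\<mu>a intro!: sets.Int)
    then show ?thesis using suminf_emeasure[OF _ dis, of \<gamma>] un by simp
  qed
  moreover have "(\<lambda>\<gamma>. \<Sum>n. emeasure \<gamma> (?B n)) \<in> borel_measurable \<mu>a"
    by (intro borel_measurable_suminf_order positive_part_approximable B f(1))
  ultimately show ?thesis by (simp cong: measurable_cong)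
qed

theorem approximable_sets: "sets \<mu> = approximable"
proof
  show "approximable \<subseteq> sets \<mu>" by (auto simp: approximable_def)
  let ?G = "\<Union>E\<in>\<E>. {(\<lambda>\<gamma>. emeasure \<gamma> E) -` B \<inter> Conf | B. B \<in> sets borel}"
  have "sets \<mu> = sigma_sets Conf ?G"
    unfolding sets_mu config_space_def by (rule sets_measure_of) auto
  also have "\<dots> \<subseteq> approximable"
  proof (rule sigma_algebra.sigma_sets_subset[OF approximable_sigma_algebra[unfolded space_mu]], rule subsetI)
    fix Y assume "Y \<in> ?G"
    then obtain E A where Y: "Y = (\<lambda>\<gamma>. emeasure \<gamma> E) -` A \<inter> Conf" "E \<in> \<E>" "A \<in> sets borel" by auto
    have Em: "E \<in> sets m" by (rule ring_sets[OF Y(2)])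
    obtain B N where B: "B \<in> sets borel" and N: "N \<in> sets m" "emeasure m N = 0" "E - N = B - N"
      using borel_approx[OF Em] by blast
    let ?Y = "(\<lambda>\<gamma>. emeasure \<gamma> (B - zero_set)) -` A \<inter> space \<mu>a"
    have "?Y \<in> approximable"
      using measurable_sets[OF emeasure_approximable[OF B] Y(3)] by (simp add: sets_\<mu>a)
    moreover have "Y \<in> sets \<mu>"
      using measurable_sets[OF measurable_mu[OF measurable_emeasure_ring[OF Y(2)]] Y(3)] by (simp add: Y(1) space_mu)
    moreover have "AE \<gamma> in \<mu>. \<gamma> \<in> ?Y \<longleftrightarrow> \<gamma> \<in> Y"
      using AE_null[OF N(1,2)] AE_null[OF zero_set_null(1,2)] AE_space
    proof eventually_elim
      case (elim \<gamma>)
      then have \<gamma>: "\<gamma> \<in> Conf" by (simp add: space_mu)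
      note s = Conf_sets[OF \<gamma>]
      have Bs: "B \<in> sets \<gamma>" "zero_set \<in> sets \<gamma>" "N \<in> sets \<gamma>" "E \<in> sets \<gamma>"
        using B borel_subset zero_set_null(1) N(1) Em s by auto
      have "emeasure \<gamma> (B - zero_set) = emeasure \<gamma> (B - zero_set - N)"
        using elim(1) Bs by (intro emeasure_Diff_null_set[symmetric] null_setsI) auto
      also have "\<dots> = emeasure \<gamma> (B - N - zero_set)" by (rule arg_cong[where f = "emeasure \<gamma>"]) auto
      also have "\<dots> = emeasure \<gamma> (E - N)"
        using elim(2) Bs N(3) by (subst emeasure_Diff_null_set) (auto intro: null_setsI)
      also have "\<dots> = emeasure \<gamma> E" using elim(1) Bs by (intro emeasure_Diff_null_set null_setsI) auto
      finally show ?case using \<gamma> by (simp add: Y(1) space_\<mu>a)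
    qed
    ultimately show "Y \<in> approximable" by (rule approximable_cong)
  qed
  finally show "sets \<mu> \<subseteq> approximable" .
qed

subsection \<open>Density in \<open>L\<^sup>2\<close>\<close>

interpretation L2: nonneg_form "sq_integrable \<mu>" "\<lambda>u v. \<integral>x. u x * v x \<partial>\<mu>"
  by (rule sq_integrable_nonneg_form)

interpretation V: nonneg_form V Q by (rule V_nonneg_form)

text \<open>The closure of the cylinder functions in \<open>L\<^sup>2\<close>.\<close>

definition L2_closure :: "('x measure \<Rightarrow> real) set" where
  "L2_closure = {u \<in> sq_integrable \<mu>. \<forall>\<epsilon>>0. \<exists>v\<in>V. L2dist \<mu> u v < \<epsilon>}"

lemma L2_closure_limit:
  assumes u: "u \<in> sq_integrable \<mu>" and U: "\<And>n. U n \<in> L2_closure"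
    and lim: "(\<lambda>n. L2dist \<mu> u (U n)) \<longlonglongrightarrow> 0"
  shows "u \<in> L2_closure"
proof -
  have "\<exists>v\<in>V. L2dist \<mu> u v < \<epsilon>" if "\<epsilon> > 0" for \<epsilon>
  proof -
    have \<epsilon>: "\<epsilon> / 4 > 0" using that by simp
    obtain n where n: "L2dist \<mu> u (U n) < \<epsilon> / 4"
      using eventually_happens'[OF sequentially_bot order_tendstoD(2)[OF lim \<epsilon>]] by blast
    obtain v where v: "v \<in> V" "L2dist \<mu> (U n) v < \<epsilon> / 4"
      using U[of n] \<epsilon> unfolding L2_closure_def by blast
    have "U n \<in> sq_integrable \<mu>" "v \<in> sq_integrable \<mu>" using U V_sq_integrable v by (auto simp: L2_closure_def)
    from L2.form_diff_le'[OF u this] n v(2)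
    have "L2dist \<mu> u v < \<epsilon>" by (simp add: power2_eq_square)
    then show ?thesis using v by blast
  qed
  then show ?thesis using u by (simp add: L2_closure_def)
qed

lemma L2_closure_add:
  assumes "u \<in> L2_closure" "v \<in> L2_closure" shows "(\<lambda>x. u x + v x) \<in> L2_closure"
proof -
  have uv: "u \<in> sq_integrable \<mu>" "v \<in> sq_integrable \<mu>" using assms by (auto simp: L2_closure_def)
  have "\<exists>w\<in>V. (\<integral>x. (u x + v x - w x)\<^sup>2 \<partial>\<mu>) < \<epsilon>" if "\<epsilon> > 0" for \<epsilon>
  proof -
    have \<epsilon>: "\<epsilon> / 4 > 0" using that by simp
    obtain u' where u': "u' \<in> V" "L2dist \<mu> u u' < \<epsilon> / 4"
      using assms(1) \<epsilon> unfolding L2_closure_def by blast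
    obtain v' where v': "v' \<in> V" "L2dist \<mu> v v' < \<epsilon> / 4"
      using assms(2) \<epsilon> unfolding L2_closure_def by blast
    have s: "u' \<in> sq_integrable \<mu>" "v' \<in> sq_integrable \<mu>" using V_sq_integrable u' v' by auto
    from L2.form_add_le[OF L2.diff[OF uv(1) s(1)] L2.diff[OF uv(2) s(2)]] u'(2) v'(2)
    have "(\<integral>x. (u x + v x - (u' x + v' x))\<^sup>2 \<partial>\<mu>) < \<epsilon>" by (simp add: power2_eq_square add_diff_add)
    then show ?thesis by (intro bexI[OF _ V.add[OF u'(1) v'(1)]])
  qed
  then show ?thesis using L2.add[OF uv] by (simp add: L2_closure_def)
qed

lemma L2_closure_scale:
  assumes "u \<in> L2_closure" shows "(\<lambda>x. c * u x) \<in> L2_closure"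
proof -
  have u: "u \<in> sq_integrable \<mu>" using assms by (auto simp: L2_closure_def)
  have "\<exists>w\<in>V. (\<integral>x. (c * u x - w x)\<^sup>2 \<partial>\<mu>) < \<epsilon>" if "\<epsilon> > 0" for \<epsilon>
  proof -
    have pos: "c\<^sup>2 + 1 > 0" by (simp add: add_nonneg_pos)
    then have "\<epsilon> / (c\<^sup>2 + 1) > 0" using that by simp
    then obtain v where v: "v \<in> V" "L2dist \<mu> u v < \<epsilon> / (c\<^sup>2 + 1)"
      using assms unfolding L2_closure_def by blast
    have "(\<integral>x. (c * u x - c * v x)\<^sup>2 \<partial>\<mu>) = c\<^sup>2 * L2dist \<mu> u v"
      by (simp flip: right_diff_distrib add: power_mult_distrib)
    also have "\<dots> \<le> (c\<^sup>2 + 1) * L2dist \<mu> u v" by (intro mult_right_mono) auto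
    also have "\<dots> < (c\<^sup>2 + 1) * (\<epsilon> / (c\<^sup>2 + 1))" using v(2) pos by (rule mult_strict_left_mono)
    also have "\<dots> = \<epsilon>" using pos by simp
    finally show ?thesis by (intro bexI[OF _ V.scale[OF v(1)]])
  qed
  then show ?thesis using L2.scale[OF u] by (simp add: L2_closure_def)
qed

lemma L2_closure_indicator:
  assumes "A \<in> sets \<mu>" shows "indicator A \<in> L2_closure"
proof -
  have A: "A \<in> approximable" using assms approximable_sets by simp
  have "indicator A \<in> sq_integrable \<mu>"
    using assms by (intro mu.bounded_sq_integrable[of _ 1]) (auto simp: indicator_def)
  moreover have "\<exists>v\<in>V. (\<integral>x. (indicator A x - v x)\<^sup>2 \<partial>\<mu>) < \<epsilon>" if \<epsilon>: "\<epsilon> > 0" for \<epsilon>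
  proof -
    obtain a where a: "a \<in> Cyl" "\<And>\<gamma>. 0 \<le> cyl_fun a \<gamma>" "\<And>\<gamma>. cyl_fun a \<gamma> \<le> 1"
      "ind_dist A a < \<epsilon>" by (rule approximableD[OF A \<epsilon>]) blast
    have "(\<integral>\<gamma>. (indicator A \<gamma> - cyl_fun a \<gamma>)\<^sup>2 \<partial>\<mu>) \<le> ind_dist A a"
    proof (rule integral_mono)
      show "integrable \<mu> (\<lambda>\<gamma>. (indicator A \<gamma> - cyl_fun a \<gamma>)\<^sup>2)"
        using \<open>indicator A \<in> sq_integrable \<mu>\<close> V_sq_integrable cyl_fun_V[OF a(1)]
        by (intro sq_integrableD(2) L2.diff) auto
      fix \<gamma>
      have "\<bar>indicator A \<gamma> - cyl_fun a \<gamma>\<bar> \<le> 1" using a(2,3)[of \<gamma>] by (auto simp: indicator_def)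
      then show "(indicator A \<gamma> - cyl_fun a \<gamma>)\<^sup>2 \<le> \<bar>indicator A \<gamma> - cyl_fun a \<gamma>\<bar>"
        using mult_left_le_one_le[of "\<bar>indicator A \<gamma> - cyl_fun a \<gamma>\<bar>" "\<bar>indicator A \<gamma> - cyl_fun a \<gamma>\<bar>"]
        by (simp add: power2_eq_square)
    qed (rule indicator_diff_integrable[OF assms a(1)])
    then show ?thesis using a(4) cyl_fun_V[OF a(1)] by (meson le_less_trans)
  qed
  ultimately show ?thesis by (simp add: L2_closure_def)
qed

lemma sq_integrable_dominated:
  assumes "v \<in> sq_integrable \<mu>" "u \<in> borel_measurable \<mu>" "\<And>x. x \<in> space \<mu> \<Longrightarrow> \<bar>u x\<bar> \<le> \<bar>v x\<bar>"
  shows "u \<in> sq_integrable \<mu>"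
proof -
  have "integrable \<mu> (\<lambda>x. (u x)\<^sup>2)"
    by (rule Bochner_Integration.integrable_bound[OF sq_integrableD(2)[OF assms(1)]])
      (use assms(2,3) in \<open>auto simp: abs_le_square_iff intro!: AE_I2\<close>)
  then show ?thesis using assms(2) by (simp add: sq_integrable_def)
qed

lemma L2_closure_nonneg:
  assumes "u \<in> borel_measurable \<mu>" "\<And>x. 0 \<le> u x"
  shows "u \<in> sq_integrable \<mu> \<longrightarrow> u \<in> L2_closure"
  using assms
proof (induction rule: borel_measurable_induct_real)
  case (set A)
  then show ?case using L2_closure_indicator by blast
next
  case (mult u c)
  show ?case
  proof (cases "c = 0")
    case True
    have "(\<lambda>x. 0) \<in> V" by (rule V.zero)
    then have "(\<lambda>x. 0) \<in> L2_closure" using L2.zero by (auto simp: L2_closure_def intro!: bexI[of _ "\<lambda>x. 0"])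
    then show ?thesis using True by simp
  next
    case False
    show ?thesis
    proof
      assume "(\<lambda>x. c * u x) \<in> sq_integrable \<mu>"
      from L2.scale[OF this, of "1 / c"] False have "u \<in> sq_integrable \<mu>" by simp
      then show "(\<lambda>x. c * u x) \<in> L2_closure" using mult L2_closure_scale by blast
    qed
  qed
next
  case (add u v)
  show ?case
  proof
    assume *: "(\<lambda>x. v x + u x) \<in> sq_integrable \<mu>"
    have "u \<in> sq_integrable \<mu>" by (rule sq_integrable_dominated[OF *]) (use add in auto)
    moreover have "v \<in> sq_integrable \<mu>" by (rule sq_integrable_dominated[OF *]) (use add in auto)
    ultimately show "(\<lambda>x. v x + u x) \<in> L2_closure" using add L2_closure_add by blast
  qed
next
  case (seq U)
  have inc: "incseq U" and lim: "\<And>x. x \<in> space \<mu> \<Longrightarrow> (\<lambda>i. U i x) \<longlonglongrightarrow> u x"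
    and U0: "\<And>i x. 0 \<le> U i x" and Um: "\<And>i. U i \<in> borel_measurable \<mu>"
    and IH: "\<And>i. U i \<in> sq_integrable \<mu> \<longrightarrow> U i \<in> L2_closure"
    using seq by blast+
  show ?case
  proof
    assume *: "u \<in> sq_integrable \<mu>"
    have le: "U i x \<le> u x" if "x \<in> space \<mu>" for i x
      by (rule incseq_le[OF _ lim[OF that]]) (use inc in \<open>auto simp: incseq_def le_fun_def\<close>)
    have Usq: "U i \<in> sq_integrable \<mu>" for i
    proof (rule sq_integrable_dominated[OF * Um])
      show "\<bar>U i x\<bar> \<le> \<bar>u x\<bar>" if "x \<in> space \<mu>" for x using le[OF that, of i] U0[of i x] by simp
    qed
    have "(\<lambda>n. L2dist \<mu> u (U n)) \<longlonglongrightarrow> (\<integral>x. 0 \<partial>\<mu>)"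
    proof (rule integral_dominated_convergence[where w = "\<lambda>x. (u x)\<^sup>2"])
      show "AE x in \<mu>. (\<lambda>n. (u x - U n x)\<^sup>2) \<longlonglongrightarrow> 0"
      proof (rule AE_I2)
        fix x assume "x \<in> space \<mu>"
        then have "(\<lambda>n. (u x - U n x)\<^sup>2) \<longlonglongrightarrow> (u x - u x)\<^sup>2" by (intro tendsto_intros lim)
        then show "(\<lambda>n. (u x - U n x)\<^sup>2) \<longlonglongrightarrow> 0" by simp
      qed
      show "AE x in \<mu>. norm ((u x - U n x)\<^sup>2) \<le> (u x)\<^sup>2" for n
      proof (rule AE_I2)
        fix x assume "x \<in> space \<mu>"
        then have "(u x - U n x)\<^sup>2 \<le> (u x)\<^sup>2" using le[of x n] U0[of n x] by (intro power_mono) auto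
        then show "norm ((u x - U n x)\<^sup>2) \<le> (u x)\<^sup>2" by simp
      qed
      show "(\<lambda>x. (u x - U n x)\<^sup>2) \<in> borel_measurable \<mu>" for n
        using sq_integrableD(1)[OF *] Um[of n] by measurable
    qed (simp_all add: sq_integrableD(2)[OF *])
    then have "(\<lambda>n. L2dist \<mu> u (U n)) \<longlonglongrightarrow> 0" by simp
    moreover have "U n \<in> L2_closure" for n using IH Usq by blast
    ultimately show "u \<in> L2_closure" by (intro L2_closure_limit[OF *])
  qed
qed

theorem V_dense: "L2_dense \<mu> V"
proof -
  have "u \<in> L2_closure" if u: "u \<in> sq_integrable \<mu>" for u
  proof -
    have [measurable]: "u \<in> borel_measurable \<mu>" using u by (rule sq_integrableD)
    have "(\<lambda>x. max 0 (u x)) \<in> sq_integrable \<mu>" "(\<lambda>x. max 0 (- u x)) \<in> sq_integrable \<mu>"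
      by (rule sq_integrable_dominated[OF u]; auto)+
    then have "(\<lambda>x. max 0 (u x)) \<in> L2_closure" "(\<lambda>x. max 0 (- u x)) \<in> L2_closure"
      using L2_closure_nonneg[of "\<lambda>x. max 0 (u x)"] L2_closure_nonneg[of "\<lambda>x. max 0 (- u x)"] by auto
    from L2_closure_add[OF this(1) L2_closure_scale[OF this(2), of "-1"]]
    have "(\<lambda>x. max 0 (u x) + -1 * max 0 (- u x)) \<in> L2_closure" .
    also have "(\<lambda>x. max 0 (u x) + -1 * max 0 (- u x)) = u" by (auto simp: max_def)
    finally show ?thesis .
  qed
  then show ?thesis using V_sq_integrable unfolding L2_dense_def L2_closure_def by blast
qed

sublocale closable_form \<mu> V Q
proof (unfold_locales)
  show "V \<subseteq> sq_integrable \<mu>" by (rule V_sq_integrable)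
  show "form_closable \<mu> V Q" by (rule V_closable)
  show "L2_dense \<mu> V" by (rule V_dense)
qed (rule V_markov)

end

section \<open>The Dirichlet form\<close>

theorem theorem3p48:
  fixes m :: "'x::t2_space measure"
    and \<E> :: "'x set set"
    and \<D> :: "('x \<Rightarrow> real) set"
    and \<Gamma> :: "('x \<Rightarrow> real) \<Rightarrow> ('x \<Rightarrow> real) \<Rightarrow> 'x \<Rightarrow> real"
    and lft :: "('x \<Rightarrow> real) \<Rightarrow> 'x \<Rightarrow> real"
    and \<mu> :: "'x measure measure"
    and \<kappa> :: "'x set \<Rightarrow> 'x measure \<Rightarrow> 'x measure measure"
  assumes "topological_local_diffusion_space m \<E> \<D> \<Gamma>"
    and "strong_lifting m lft"
    and "prob_space \<mu>"
    and "space \<mu> = configurations m \<E>"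
    and "sets \<mu> = sets (config_space m \<E>)"
    and "\<And>E. E \<in> \<E> \<Longrightarrow> regular_cond_prob m \<E> \<mu> E (\<kappa> E)"
    and "cond_abs_continuous m \<E> \<kappa> \<mu>"
    and "cond_closability m \<E> \<D> \<Gamma> lft \<kappa> \<mu>"
  shows "cyl_form_well_defined \<D> \<Gamma> lft \<mu> \<and>
    L2_dense \<mu> (cyl_classes \<D> \<mu>) \<and>
    form_closable \<mu> (cyl_classes \<D> \<mu>) (cyl_form \<D> \<Gamma> lft \<mu>) \<and>
    dirichlet_form \<mu>
      (closure_dom \<mu> (cyl_classes \<D> \<mu>) (cyl_form \<D> \<Gamma> lft \<mu>))
      (closure_form \<mu> (cyl_classes \<D> \<mu>) (cyl_form \<D> \<Gamma> lft \<mu>))"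
proof -
  interpret topological_local_diffusion_space m \<E> \<D> \<Gamma> by (rule assms(1))
  interpret mu: prob_space \<mu> by (rule assms(3))
  interpret cond_closable_measure m \<E> \<D> \<Gamma> lft \<mu> \<kappa>
    by unfold_locales (fact assms(2,4,5,6,8))+
  show ?thesis
    using well_defined V_dense V_closable closure_dirichlet_form by blast
qed

end
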